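(* There is a universal constant $C>0$ such that the following holds. Let $U_1,\dots,U_k\in\mathbb{R}^{d\times m}$ have orthonormal columns, let $\alpha_1,\dots,\alpha_k>0$ with $\sum_i\alpha_i=1$, let $v\in\mathbb{R}^d$ satisfy $\|U_1^Tv\|>\|U_i^Tv\|$ for all $i\ne1$, and put $$A=\sum_{i=1}^k\alpha_iU_iU_i^T,\qquad B=\sum_{i=1}^k\alpha_i\|U_i^Tv\|^2U_iU_i^T+2\sum_{i=1}^k\alpha_iU_iU_i^Tvv^TU_iU_i^T,$$ where $\sigma_{mk}(A)>0$. Suppose that $\|\hat A-A\|\le\epsilon$ and $\|\hat B-B\|\le\epsilon$, where $\hat A,\hat B$ are symmetric $d\times d$ matrices, and that for some $\delta>0$ the side information vector $v$ satisfies $\|U_i^Tv\|^2\le(1/3-\delta)\|U_1^Tv\|^2$ for all $i\neq1$. Then the output $\hat U$ of the Subspace Algorithm on input $(\hat A,\hat B)$ satisfies $$\|\hat U\hat U^T-U_1U_1^T\|\le C\,\epsilon\,\alpha_1^{-1}\,\sigma_1(A)^2\,\sigma_{mk}(A)^{-2}\,\delta^{-1}.$$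
   Context: $\|\cdot\|$ is the Euclidean norm for vectors and the spectral norm for matrices; $\sigma_j(M)$ is the $j$th largest singular value of $M$. Subspace Algorithm. Input: $\hat A,\hat B\in\mathbb{R}^{d\times d}$ (and $k,m$). (1) Let $\{\sigma_j,v_j\}$ be the singular values and (orthonormal) singular vectors of $\hat A$, in non-increasing order of $\sigma_j$. (2) Let $V$ be the $d\times mk$ matrix whose $j$th column is $v_j$. (3) Let $D$ be the $mk\times mk$ diagonal matrix with $D_{jj}=\sigma_j$. (4) Let $Y=[u_1,\dots,u_m]$ be the matrix of orthonormal eigenvectors for the $m$ largest eigenvalues of $D^{-1/2}V^T\hat BVD^{-1/2}$. (5) Let $Z=VD^{1/2}Y$. (6) Let the columns of $\hat U$ be $m$ orthonormal eigenvectors of $ZZ^T$ (for its $m$ largest eigenvalues).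
   Formalization: The formal theorem adds the normalization ‖U_1^T v‖ ≥ 1 (B scales quadratically in v, so without it no universal C exists) and δ ≤ 1/3 (automatic for k ≥ 2; for k = 1 the separation condition is vacuous and large δ makes the claim false). *)

theory Defs
  imports
    Complex_Main
    "Jordan_Normal_Form.Char_Poly"
begin

text \<open>
  All dimensions are natural numbers carried by the matrices, so that a constant
  can be quantified before the dimensions.  Families and singular values are
  indexed from 1, matrix entries and columns from 0.
\<close>

definition l2norm :: "real vec \<Rightarrow> real" where
  "l2norm x = sqrt (x \<bullet> x)"

definition spectral_norm :: "real mat \<Rightarrow> real" where
  "spectral_norm M = Sup {l2norm (M *\<^sub>v x) | x. x \<in> carrier_vec (dim_col M) \<and> l2norm x \<le> 1}"

definition orthonormal_cols :: "real mat \<Rightarrow> bool" where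
  "orthonormal_cols Q \<longleftrightarrow> transpose_mat Q * Q = 1\<^sub>m (dim_col Q)"

text \<open>Real eigenvalues, repeated by algebraic multiplicity, in non-increasing order.\<close>

definition eigvals :: "real mat \<Rightarrow> real list" where
  "eigvals M = rev (sorted_list_of_multiset (proots (char_poly M)))"

text \<open>
  The \<open>j\<close>-th largest singular value, \<open>j \<ge> 1\<close>.  Out of range (\<open>j = 0\<close> or \<open>j\<close> larger than
  the number of columns) the value is \<open>0\<close>; hence \<open>0 < sing_val j M\<close> entails that \<open>j\<close> is in range.
\<close>

definition sing_val :: "nat \<Rightarrow> real mat \<Rightarrow> real" where
  "sing_val j M =
     (if 1 \<le> j \<and> j \<le> dim_col M then sqrt (eigvals (transpose_mat M * M) ! (j - 1)) else 0)"

definition singular_vector :: "real mat \<Rightarrow> real \<Rightarrow> real vec \<Rightarrow> bool" where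
  "singular_vector M s v \<longleftrightarrow>
     v \<in> carrier_vec (dim_col M) \<and> l2norm v = 1 \<and>
     (\<exists>u \<in> carrier_vec (dim_row M). l2norm u = 1 \<and>
        M *\<^sub>v v = s \<cdot>\<^sub>v u \<and> transpose_mat M *\<^sub>v u = s \<cdot>\<^sub>v v)"

text \<open>The columns of \<open>Y\<close> are orthonormal eigenvectors for the \<open>m\<close> largest eigenvalues of \<open>M\<close>.\<close>

definition top_eigenvectors :: "nat \<Rightarrow> real mat \<Rightarrow> real mat \<Rightarrow> bool" where
  "top_eigenvectors m M Y \<longleftrightarrow>
     Y \<in> carrier_mat (dim_row M) m \<and> orthonormal_cols Y \<and>
     (\<forall>j < m. eigenvector M (col Y j) (eigvals M ! j))"

definition outer :: "real vec \<Rightarrow> real vec \<Rightarrow> real mat" where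
  "outer x y = mat (dim_vec x) (dim_vec y) (\<lambda>(i, j). x $ i * y $ j)"

text \<open>Sum of the \<open>d \<times> d\<close> matrices \<open>F 1, \<dots>, F k\<close>.\<close>

definition sum_mats :: "nat \<Rightarrow> nat \<Rightarrow> (nat \<Rightarrow> real mat) \<Rightarrow> real mat" where
  "sum_mats d k F = mat d d (\<lambda>(p, q). \<Sum>i = 1..k. F i $$ (p, q))"

definition proj :: "real mat \<Rightarrow> real mat" where
  "proj U = U * transpose_mat U"

definition A_mat :: "nat \<Rightarrow> nat \<Rightarrow> (nat \<Rightarrow> real) \<Rightarrow> (nat \<Rightarrow> real mat) \<Rightarrow> real mat" where
  "A_mat d k \<alpha> U = sum_mats d k (\<lambda>i. \<alpha> i \<cdot>\<^sub>m proj (U i))"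

definition B_mat ::
  "nat \<Rightarrow> nat \<Rightarrow> (nat \<Rightarrow> real) \<Rightarrow> (nat \<Rightarrow> real mat) \<Rightarrow> real vec \<Rightarrow> real mat" where
  "B_mat d k \<alpha> U v =
     sum_mats d k (\<lambda>i. (\<alpha> i * (l2norm (transpose_mat (U i) *\<^sub>v v))\<^sup>2) \<cdot>\<^sub>m proj (U i)) +
     2 \<cdot>\<^sub>m sum_mats d k (\<lambda>i. \<alpha> i \<cdot>\<^sub>m (proj (U i) * outer v v * proj (U i)))"

text \<open>
  The algorithm makes choices (singular vectors and eigenvectors are not unique), so it is a
  relation between input and output.  Singular values \<open>0\<close> on the diagonal of \<open>D\<close> fall
  under the convention \<open>1 / 0 = 0\<close>.
\<close>

definition subspace_algorithm ::
  "nat \<Rightarrow> nat \<Rightarrow> nat \<Rightarrow> real mat \<Rightarrow> real mat \<Rightarrow> real mat \<Rightarrow> bool" where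
  "subspace_algorithm d m k Ah Bh Uh \<longleftrightarrow>
     (\<exists>V Y.
        let D_sqrt = mat_diag (m * k) (\<lambda>j. sqrt (sing_val (j + 1) Ah));
            D_isqrt = mat_diag (m * k) (\<lambda>j. 1 / sqrt (sing_val (j + 1) Ah))
        in
          V \<in> carrier_mat d (m * k) \<and> orthonormal_cols V \<and>
          (\<forall>j < m * k. singular_vector Ah (sing_val (j + 1) Ah) (col V j)) \<and>
          top_eigenvectors m (D_isqrt * transpose_mat V * Bh * V * D_isqrt) Y \<and>
          (let Z = V * D_sqrt * Y in top_eigenvectors m (Z * transpose_mat Z) Uh))"

end

theory Submission
  imports Defs "HOL-Combinatorics.Permutations"
begin

text \<open>
  Put \<open>n = m k\<close> and let \<open>W\<close> be the \<open>d \<times> n\<close> matrix whose blocks are the \<open>\<surd>\<alpha>\<^sub>i U\<^sub>i\<close>.  Then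
  \<open>A = W W\<^sup>T\<close> and \<open>B = W M W\<^sup>T\<close> with \<open>M\<close> block diagonal; its first block is at least \<open>w\<close>, the
  others are at most \<open>(1 - 3 \<delta>) w\<close>, where \<open>w = \<parallel>U\<^sub>1\<^sup>T v\<parallel>\<^sup>2\<close>.  Whitening with \<open>T = D\<^sup>-\<^sup>1\<^sup>/\<^sup>2 V\<^sup>T\<close> turns \<open>W\<close>
  into a square matrix \<open>O = T W\<close> with \<open>O O\<^sup>T\<close>, hence also \<open>O\<^sup>T O\<close>, at distance of order \<open>\<epsilon> / \<sigma>\<^sub>n(A)\<close> from
  the identity.  So the first \<open>m\<close> columns \<open>K\<close> of \<open>O\<close> nearly span an invariant subspace of the
  whitened \<open>B\<close>, and a Davis--Kahan estimate with gap \<open>\<delta> w\<close> shows that \<open>Y Y\<^sup>T\<close> is close to \<open>K K\<^sup>T\<close>.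
  Undoing the whitening gives \<open>Z Z\<^sup>T\<close> close to \<open>\<alpha>\<^sub>1 U\<^sub>1 U\<^sub>1\<^sup>T\<close>, and the same
  estimate with gap of order \<open>\<alpha>\<^sub>1\<close> gives the claim.  If \<open>\<epsilon>\<close> is too large for these
  perturbation arguments, the claimed bound exceeds \<open>2\<close> and is trivial.
\<close>

text \<open>The subspaces need not be mutually orthogonal, so the \<open>U i\<close> do not
  diagonalise \<open>B\<close>; only after whitening do the blocks of \<open>W\<close> become nearly
  orthonormal. On block i the matrix \<open>M\<close> is w_i times the identity plus twice u u^T,
  where u = U_i^T v has squared length w_i. Its form lies between w_i and 3 w_i, and this is why the
  hypothesis carries the constant 1/3: it keeps the first block above all others. Three defects
  arise: \<open>O\<close> is not exactly orthogonal, \<open>B\<close> carries noise, and the span of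
  \<open>V\<close> is not the range of \<open>A\<close>. All are bounded by multiples of \<eta> = 2
  \<epsilon> / \<sigma>_n(A). Eigenvalues may repeat and the algorithm chooses its eigenvectors
  freely, so eigenspaces are compared through quadratic forms on orthogonal complements, with a
  dimension count in place of any matching of eigenvectors.\<close>

section \<open>Bounds on the operator norm\<close>

text \<open>
  The library states the algebraic laws with carrier sets, whose free dimensions block rewriting;
  stated with dimensions, they are usable as simplification rules.
\<close>

lemma mult_mat_assoc_dim:
  fixes A B C :: "'a :: semiring_0 mat"
  shows "dim_col A = dim_row B \<Longrightarrow> dim_col B = dim_row C \<Longrightarrow> A * B * C = A * (B * C)"
  by (rule assoc_mult_mat[OF carrier_matI[OF refl refl] carrier_matI[OF _ refl] carrier_matI[OF _ refl]]) simp_all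

lemma mult_mat_vec_assoc_dim:
  fixes A B :: "'a :: semiring_0 mat"
  shows "dim_col A = dim_row B \<Longrightarrow> dim_col B = dim_vec x \<Longrightarrow> (A * B) *\<^sub>v x = A *\<^sub>v (B *\<^sub>v x)"
  by (rule assoc_mult_mat_vec[OF carrier_matI[OF refl refl] carrier_matI[OF _ refl] carrier_vecI]) simp_all

lemma minus_mat_vec_dim:
  fixes A B :: "'a :: ring mat"
  shows "dim_row A = dim_row B \<Longrightarrow> dim_col A = dim_col B \<Longrightarrow> dim_vec x = dim_col B \<Longrightarrow>
    (A - B) *\<^sub>v x = A *\<^sub>v x - B *\<^sub>v x"
  by (rule minus_mult_distrib_mat_vec[OF carrier_matI carrier_matI[OF refl refl] carrier_vecI]) simp_all

lemma add_mat_vec_dim: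
  fixes A B :: "'a :: ring mat"
  shows "dim_row A = dim_row B \<Longrightarrow> dim_col A = dim_col B \<Longrightarrow> dim_vec x = dim_col B \<Longrightarrow>
    (A + B) *\<^sub>v x = A *\<^sub>v x + B *\<^sub>v x"
  by (rule add_mult_distrib_mat_vec[OF carrier_matI carrier_matI[OF refl refl] carrier_vecI]) simp_all

lemma mat_vec_minus_dim:
  fixes A :: "'a :: ring mat"
  shows "dim_vec x = dim_col A \<Longrightarrow> dim_vec y = dim_col A \<Longrightarrow> A *\<^sub>v (x - y) = A *\<^sub>v x - A *\<^sub>v y"
  by (rule mult_minus_distrib_mat_vec[OF carrier_matI[OF refl refl] carrier_vecI carrier_vecI]) simp_all

lemma mat_vec_add_dim:
  fixes A :: "'a :: ring mat"
  shows "dim_vec x = dim_col A \<Longrightarrow> dim_vec y = dim_col A \<Longrightarrow> A *\<^sub>v (x + y) = A *\<^sub>v x + A *\<^sub>v y"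
  by (rule mult_add_distrib_mat_vec[OF carrier_matI[OF refl refl] carrier_vecI carrier_vecI]) simp_all

lemma mat_vec_smult_dim:
  fixes A :: "'a :: field mat"
  shows "dim_vec x = dim_col A \<Longrightarrow> A *\<^sub>v (c \<cdot>\<^sub>v x) = c \<cdot>\<^sub>v (A *\<^sub>v x)"
  by (rule mult_mat_vec[OF carrier_matI[OF refl refl] carrier_vecI]) simp_all

lemma smult_mat_vec_dim:
  fixes A :: "'a :: comm_ring mat"
  shows "dim_vec x = dim_col A \<Longrightarrow> (c \<cdot>\<^sub>m A) *\<^sub>v x = c \<cdot>\<^sub>v (A *\<^sub>v x)"
  by (rule eq_vecI) (simp_all only: index_mult_mat_vec index_smult_vec index_smult_mat dim_mult_mat_vec row_smult scalar_prod_smult_left index_row)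

lemma transpose_mult_dim:
  fixes A B :: "'a :: comm_semiring_0 mat"
  shows "dim_col A = dim_row B \<Longrightarrow> (A * B)\<^sup>T = B\<^sup>T * A\<^sup>T"
  by (rule transpose_mult[OF carrier_matI[OF refl refl] carrier_matI[OF _ refl]]) simp_all

lemma transpose_minus_dim:
  fixes A B :: "'a :: group_add mat"
  shows "dim_row A = dim_row B \<Longrightarrow> dim_col A = dim_col B \<Longrightarrow> (A - B)\<^sup>T = A\<^sup>T - B\<^sup>T"
  by (rule transpose_minus[OF carrier_matI carrier_matI[OF refl refl]]) simp_all

lemma one_mat_vec_dim: "dim_vec x = n \<Longrightarrow> 1\<^sub>m n *\<^sub>v x = (x :: 'a :: semiring_1 vec)"
  by (rule one_mult_mat_vec[OF carrier_vecI])

lemma scalar_prod_comm_dim: "dim_vec x = dim_vec y \<Longrightarrow> x \<bullet> y = y \<bullet> (x :: real vec)"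
  by (rule comm_scalar_prod[OF carrier_vecI[OF refl] carrier_vecI]) simp_all

lemma scalar_prod_minus_right: "dim_vec x = dim_vec z \<Longrightarrow> dim_vec y = dim_vec z \<Longrightarrow>
    x \<bullet> (y - z) = x \<bullet> y - x \<bullet> (z :: real vec)"
  by (rule scalar_prod_minus_distrib[OF carrier_vecI carrier_vecI carrier_vecI]) simp_all

lemma scalar_prod_minus_left: "dim_vec x = dim_vec z \<Longrightarrow> dim_vec y = dim_vec z \<Longrightarrow>
    (x - y) \<bullet> z = x \<bullet> z - y \<bullet> (z :: real vec)"
  by (rule minus_scalar_prod_distrib[OF carrier_vecI carrier_vecI carrier_vecI]) simp_all

lemma scalar_prod_add_right: "dim_vec x = dim_vec z \<Longrightarrow> dim_vec y = dim_vec z \<Longrightarrow>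
    x \<bullet> (y + z) = x \<bullet> y + x \<bullet> (z :: real vec)"
  by (rule scalar_prod_add_distrib[OF carrier_vecI carrier_vecI carrier_vecI]) simp_all

lemma scalar_prod_add_left: "dim_vec x = dim_vec z \<Longrightarrow> dim_vec y = dim_vec z \<Longrightarrow>
    (x + y) \<bullet> z = x \<bullet> z + y \<bullet> (z :: real vec)"
  by (rule add_scalar_prod_distrib[OF carrier_vecI carrier_vecI carrier_vecI]) simp_all

lemmas scalar_prod_expand = scalar_prod_minus_right scalar_prod_minus_left
  scalar_prod_add_right scalar_prod_add_left

lemmas mat_vec_expand = mult_mat_vec_assoc_dim minus_mat_vec_dim add_mat_vec_dim
  mat_vec_minus_dim mat_vec_add_dim mat_vec_smult_dim smult_mat_vec_dim one_mat_vec_dim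

lemma mult_mat_vec_zero: "A *\<^sub>v 0\<^sub>v (dim_col A) = 0\<^sub>v (dim_row (A :: real mat))"
  by (auto intro!: eq_vecI)

lemma mult_mat_vec_scalar_prod: 
  "dim_vec x = dim_col A \<Longrightarrow> dim_vec y = dim_row A \<Longrightarrow> (A *\<^sub>v x) \<bullet> y = x \<bullet> (A\<^sup>T *\<^sub>v (y :: real vec))"
  using transpose_vec_mult_scalar[OF carrier_matI[OF refl refl] carrier_vecI carrier_vecI, of x A y]
  by (simp add: scalar_prod_comm_dim[of "A *\<^sub>v x" y] scalar_prod_comm_dim[of x])

lemma mult_mat_vec_unit: "j < dim_col A \<Longrightarrow> A *\<^sub>v unit_vec (dim_col A) j = col A (j::nat)"
  for A :: "real mat"
  by (auto intro!: eq_vecI)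

section \<open>The Euclidean norm and the Cauchy-Schwarz inequality\<close>

lemma scalar_prod_self_ge_0: "0 \<le> x \<bullet> (x :: real vec)"
  by (simp add: scalar_prod_def sum_nonneg)

lemma scalar_prod_self_eq_0: "x \<bullet> x = 0 \<longleftrightarrow> x = 0\<^sub>v (dim_vec (x :: real vec))"
proof
  assume "x \<bullet> x = 0"
  then have "\<forall>i<dim_vec x. x $ i = 0"
    by (auto simp: scalar_prod_def sum_nonneg_eq_0_iff)
  then show "x = 0\<^sub>v (dim_vec x)" by (auto intro!: eq_vecI)
next
  assume "x = 0\<^sub>v (dim_vec x)"
  then show "x \<bullet> x = 0"
    by (metis carrier_vec_dim_vec scalar_prod_left_zero)
qed

lemma l2norm_ge_0: "0 \<le> l2norm x"
  by (simp add: l2norm_def scalar_prod_self_ge_0)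

lemma l2norm_sq: "(l2norm x)\<^sup>2 = x \<bullet> x"
  by (simp add: l2norm_def scalar_prod_self_ge_0)

lemma l2norm_eq_0: "l2norm x = 0 \<longleftrightarrow> x = 0\<^sub>v (dim_vec x)"
  by (simp add: l2norm_def scalar_prod_self_eq_0)

lemma l2norm_le_iff: "0 \<le> c \<Longrightarrow> l2norm x \<le> c \<longleftrightarrow> x \<bullet> x \<le> c\<^sup>2"
  by (metis abs_le_square_iff abs_of_nonneg l2norm_ge_0 l2norm_sq)

lemma l2norm_smult: "l2norm (c \<cdot>\<^sub>v x) = \<bar>c\<bar> * l2norm x"
proof -
  have "(c \<cdot>\<^sub>v x) \<bullet> (c \<cdot>\<^sub>v x) = c\<^sup>2 * (x \<bullet> x)"
    by (simp add: power2_eq_square)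
  then show ?thesis by (simp add: l2norm_def real_sqrt_mult)
qed

lemma Cauchy_Schwarz_l2norm:
  assumes "dim_vec x = dim_vec y"
  shows "\<bar>x \<bullet> y\<bar> \<le> l2norm x * l2norm y"
proof -
  have "(x \<bullet> y)\<^sup>2 \<le> (x \<bullet> x) * (y \<bullet> y)"
  proof (cases "y \<bullet> y = 0")
    case True
    then have "y = 0\<^sub>v (dim_vec x)" using assms by (simp add: scalar_prod_self_eq_0)
    then have "x \<bullet> y = 0" by (metis carrier_vec_dim_vec scalar_prod_right_zero)
    then show ?thesis by (simp add: scalar_prod_self_ge_0)
  next
    case False
    then have c: "y \<bullet> y > 0" using scalar_prod_self_ge_0[of y] by simp
    define z where "z = (y \<bullet> y) \<cdot>\<^sub>v x - (x \<bullet> y) \<cdot>\<^sub>v y"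
    have "z \<bullet> z = (y \<bullet> y) * ((y \<bullet> y) * (x \<bullet> x) - (x \<bullet> y)\<^sup>2)"
      unfolding z_def using assms scalar_prod_comm_dim[OF assms]
      by (simp add: scalar_prod_expand algebra_simps power2_eq_square)
    then have "0 \<le> (y \<bullet> y) * ((y \<bullet> y) * (x \<bullet> x) - (x \<bullet> y)\<^sup>2)"
      using scalar_prod_self_ge_0[of z] by simp
    then have "0 \<le> (y \<bullet> y) * (x \<bullet> x) - (x \<bullet> y)\<^sup>2" using c
      by (simp add: zero_le_mult_iff)
    then show ?thesis by (simp add: mult.commute)
  qed
  then have "\<bar>x \<bullet> y\<bar>\<^sup>2 \<le> (l2norm x * l2norm y)\<^sup>2"
    by (simp add: power_mult_distrib l2norm_sq)
  then show ?thesis by (rule power2_le_imp_le) (simp add: l2norm_ge_0)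
qed

lemma scalar_prod_le_l2norm:
  "dim_vec x = dim_vec y \<Longrightarrow> x \<bullet> y \<le> l2norm x * l2norm y"
  using Cauchy_Schwarz_l2norm by fastforce

lemma l2norm_add: 
  assumes "dim_vec x = dim_vec y"
  shows "l2norm (x + y) \<le> l2norm x + l2norm y"
proof -
  have "(x + y) \<bullet> (x + y) \<le> (l2norm x + l2norm y)\<^sup>2"
    using scalar_prod_le_l2norm[OF assms] assms scalar_prod_comm_dim[OF assms]
    by (simp add: scalar_prod_expand power2_sum l2norm_sq)
  then show ?thesis by (subst l2norm_le_iff) (auto simp: l2norm_ge_0)
qed

lemma l2norm_minus: 
  assumes "dim_vec x = dim_vec y"
  shows "l2norm (x - y) \<le> l2norm x + l2norm y"
proof -
  have "(x - y) \<bullet> (x - y) \<le> (l2norm x + l2norm y)\<^sup>2"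
    using Cauchy_Schwarz_l2norm[OF assms] assms scalar_prod_comm_dim[OF assms]
    by (simp add: scalar_prod_expand power2_sum l2norm_sq)
  then show ?thesis by (subst l2norm_le_iff) (auto simp: l2norm_ge_0)
qed

text \<open>Upper bounds as a predicate combine under sums, products and transposes without suprema;
  \<open>norm_bound_spectral_norm\<close> and \<open>spectral_norm_le\<close> translate from and to
  \<open>spectral_norm\<close>.\<close>

definition norm_bound :: "real mat \<Rightarrow> real \<Rightarrow> bool" where
  "norm_bound M c \<longleftrightarrow> (\<forall>x. dim_vec x = dim_col M \<longrightarrow> l2norm (M *\<^sub>v x) \<le> c * l2norm x)"

lemma norm_boundI: "(\<And>x. dim_vec x = dim_col M \<Longrightarrow> l2norm (M *\<^sub>v x) \<le> c * l2norm x) \<Longrightarrow> norm_bound M c"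
  by (simp add: norm_bound_def)

lemma norm_boundD: "norm_bound M c \<Longrightarrow> dim_vec x = dim_col M \<Longrightarrow> l2norm (M *\<^sub>v x) \<le> c * l2norm x"
  by (simp add: norm_bound_def)

lemma norm_boundD_sq: 
  assumes "norm_bound M c" "0 \<le> c" "dim_vec x = dim_col M"
  shows "(M *\<^sub>v x) \<bullet> (M *\<^sub>v x) \<le> c\<^sup>2 * (x \<bullet> x)"
  using power_mono[OF norm_boundD[OF assms(1,3)] l2norm_ge_0, of 2]
  by (simp add: l2norm_sq power_mult_distrib)

lemma norm_boundI_sq:
  assumes "0 \<le> c" "\<And>x. dim_vec x = dim_col M \<Longrightarrow> (M *\<^sub>v x) \<bullet> (M *\<^sub>v x) \<le> c\<^sup>2 * (x \<bullet> x)"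
  shows "norm_bound M c"
  using assms by (intro norm_boundI) (simp add: l2norm_le_iff l2norm_ge_0 power_mult_distrib l2norm_sq)

lemma norm_bound_mono: "norm_bound M c \<Longrightarrow> c \<le> c' \<Longrightarrow> norm_bound M c'"
  unfolding norm_bound_def by (meson l2norm_ge_0 mult_right_mono order_trans)

lemma norm_bound_mult:
  assumes "norm_bound A a" "norm_bound B b" "0 \<le> a" "dim_col A = dim_row B"
  shows "norm_bound (A * B) (a * b)"
proof (rule norm_boundI)
  fix x :: "real vec" assume x: "dim_vec x = dim_col (A * B)"
  then have "l2norm (A *\<^sub>v (B *\<^sub>v x)) \<le> a * l2norm (B *\<^sub>v x)"
    using assms by (intro norm_boundD) auto
  also have "\<dots> \<le> a * (b * l2norm x)"
    using assms x by (intro mult_left_mono norm_boundD) auto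
  finally show "l2norm (A * B *\<^sub>v x) \<le> a * b * l2norm x"
    using x assms by (simp add: mult_mat_vec_assoc_dim)
qed

lemma norm_bound_minus:
  assumes "norm_bound A a" "norm_bound B b" "dim_row A = dim_row B" "dim_col A = dim_col B"
  shows "norm_bound (A - B) (a + b)"
proof (rule norm_boundI)
  fix x :: "real vec" assume x: "dim_vec x = dim_col (A - B)"
  have "l2norm (A *\<^sub>v x - B *\<^sub>v x) \<le> l2norm (A *\<^sub>v x) + l2norm (B *\<^sub>v x)"
    using assms by (intro l2norm_minus) auto
  also have "\<dots> \<le> a * l2norm x + b * l2norm x"
    using assms x by (intro add_mono norm_boundD) auto
  finally show "l2norm ((A - B) *\<^sub>v x) \<le> (a + b) * l2norm x"
    using x assms by (simp add: minus_mat_vec_dim algebra_simps)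
qed

lemma norm_bound_add:
  assumes "norm_bound A a" "norm_bound B b" "dim_row A = dim_row B" "dim_col A = dim_col B"
  shows "norm_bound (A + B) (a + b)"
proof (rule norm_boundI)
  fix x :: "real vec" assume x: "dim_vec x = dim_col (A + B)"
  have "l2norm (A *\<^sub>v x + B *\<^sub>v x) \<le> l2norm (A *\<^sub>v x) + l2norm (B *\<^sub>v x)"
    using assms by (intro l2norm_add) auto
  also have "\<dots> \<le> a * l2norm x + b * l2norm x"
    using assms x by (intro add_mono norm_boundD) auto
  finally show "l2norm ((A + B) *\<^sub>v x) \<le> (a + b) * l2norm x"
    using x assms by (simp add: add_mat_vec_dim algebra_simps)
qed

lemma norm_bound_smult: "norm_bound A a \<Longrightarrow> norm_bound (c \<cdot>\<^sub>m A) (\<bar>c\<bar> * a)"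
  by (auto intro!: norm_boundI mult_left_mono dest: norm_boundD
      simp: smult_mat_vec_dim l2norm_smult mult.assoc)

lemma norm_bound_transpose:
  assumes "norm_bound A a" "0 \<le> a"
  shows "norm_bound (A\<^sup>T) a"
proof (rule norm_boundI)
  fix x :: "real vec" assume x: "dim_vec x = dim_col (A\<^sup>T)"
  let ?y = "A\<^sup>T *\<^sub>v x"
  have "(l2norm ?y)\<^sup>2 = x \<bullet> (A *\<^sub>v ?y)"
    using x mult_mat_vec_scalar_prod[of x "A\<^sup>T" ?y] by (simp add: l2norm_sq)
  also have "\<dots> \<le> l2norm x * l2norm (A *\<^sub>v ?y)" using x by (intro scalar_prod_le_l2norm) simp
  also have "\<dots> \<le> l2norm x * (a * l2norm ?y)"
    using assms x by (intro mult_left_mono norm_boundD) (auto simp: l2norm_ge_0)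
  finally have "l2norm ?y * l2norm ?y \<le> (a * l2norm x) * l2norm ?y"
    by (simp add: power2_eq_square algebra_simps)
  then show "l2norm ?y \<le> a * l2norm x"
    using assms l2norm_ge_0[of ?y] l2norm_ge_0[of x]
    by (cases "l2norm ?y = 0") auto
qed

text \<open>The constant is the Frobenius norm, by Cauchy-Schwarz on each row. It shows that the set
  behind \<open>spectral_norm\<close> is bounded above, so that its \<open>Sup\<close> is
  meaningful.\<close>

lemma norm_bound_exists: "\<exists>c\<ge>0. norm_bound (M :: real mat) c"
proof -
  define c where "c = sqrt (\<Sum>i<dim_row M. (l2norm (row M i))\<^sup>2)"
  have c: "0 \<le> c" by (simp add: c_def sum_nonneg)
  have "norm_bound M c"
  proof (rule norm_boundI_sq[OF c])
    fix x :: "real vec" assume x: "dim_vec x = dim_col M"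
    have "(M *\<^sub>v x) \<bullet> (M *\<^sub>v x) = (\<Sum>i<dim_row M. (row M i \<bullet> x)\<^sup>2)"
      by (simp add: scalar_prod_def[of "M *\<^sub>v x"] power2_eq_square atLeast0LessThan)
    also have "\<dots> \<le> (\<Sum>i<dim_row M. (l2norm (row M i) * l2norm x)\<^sup>2)"
      using x by (intro sum_mono) (metis Cauchy_Schwarz_l2norm abs_ge_zero index_row(2) power2_abs power_mono)
    also have "\<dots> = c\<^sup>2 * (x \<bullet> x)"
      by (simp add: c_def sum_nonneg power_mult_distrib l2norm_sq scalar_prod_self_ge_0 flip: sum_distrib_right)
    finally show "(M *\<^sub>v x) \<bullet> (M *\<^sub>v x) \<le> c\<^sup>2 * (x \<bullet> x)" .
  qed
  then show ?thesis using c by blast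
qed

lemma l2norm_zero [simp]: "l2norm (0\<^sub>v n) = 0"
  by (simp add: l2norm_eq_0)

lemma spectral_norm_le:
  assumes "norm_bound M c" "0 \<le> c"
  shows "spectral_norm M \<le> c"
  unfolding spectral_norm_def
proof (rule cSup_least)
  show "{l2norm (M *\<^sub>v x) | x. x \<in> carrier_vec (dim_col M) \<and> l2norm x \<le> 1} \<noteq> {}"
    by (auto intro!: exI[of _ "0\<^sub>v (dim_col M)"])
next
  fix y assume "y \<in> {l2norm (M *\<^sub>v x) | x. x \<in> carrier_vec (dim_col M) \<and> l2norm x \<le> 1}"
  then obtain x where x: "y = l2norm (M *\<^sub>v x)" "dim_vec x = dim_col M" "l2norm x \<le> 1" by auto
  have "y \<le> c * l2norm x" using x assms by (auto intro: norm_boundD)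
  also have "\<dots> \<le> c" using x(3) assms(2) by (simp add: mult_left_le)
  finally show "y \<le> c" .
qed

lemma norm_bound_spectral_norm: "norm_bound M (spectral_norm M)"
proof (rule norm_boundI)
  fix x :: "real vec" assume x: "dim_vec x = dim_col M"
  let ?S = "{l2norm (M *\<^sub>v x) | x. x \<in> carrier_vec (dim_col M) \<and> l2norm x \<le> 1}"
  obtain c where c: "0 \<le> c" "norm_bound M c" using norm_bound_exists by blast
  have bdd: "bdd_above ?S"
  proof (rule bdd_aboveI[of _ c], clarify)
    fix z :: "real vec" assume z: "z \<in> carrier_vec (dim_col M)" "l2norm z \<le> 1"
    have "l2norm (M *\<^sub>v z) \<le> c * l2norm z" using z c by (auto intro: norm_boundD)
    also have "\<dots> \<le> c" using z c by (simp add: mult_left_le)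
    finally show "l2norm (M *\<^sub>v z) \<le> c" .
  qed
  show "l2norm (M *\<^sub>v x) \<le> spectral_norm M * l2norm x"
  proof (cases "l2norm x = 0")
    case True
    then show ?thesis using x norm_boundD[OF c(2) x] by simp
  next
    case False
    then have p: "l2norm x > 0" using l2norm_ge_0[of x] by simp
    let ?z = "(1 / l2norm x) \<cdot>\<^sub>v x"
    have "l2norm (M *\<^sub>v ?z) \<le> spectral_norm M"
      unfolding spectral_norm_def using x p
      by (intro cSup_upper[OF _ bdd]) (auto simp: l2norm_smult intro!: carrier_vecI exI[of _ ?z])
    then show ?thesis using x p by (simp add: mat_vec_smult_dim l2norm_smult field_simps)
  qed
qed

lemma spectral_norm_nonneg:
  assumes "0 < dim_col M"
  shows "0 \<le> spectral_norm M"
proof -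
  have "0 \<le> spectral_norm M * l2norm (unit_vec (dim_col M) 0)"
    using norm_boundD[OF norm_bound_spectral_norm[of M], of "unit_vec (dim_col M) 0"]
    by (meson l2norm_ge_0 order_trans index_unit_vec(3))
  moreover have "l2norm (unit_vec (dim_col M) 0) = 1"
    using assms by (simp add: l2norm_def)
  ultimately show ?thesis by simp
qed

section \<open>Matrices with orthonormal columns\<close>

lemma orthonormal_cols_scalar_prod:
  assumes "orthonormal_cols Q" "i < dim_col Q" "j < dim_col Q"
  shows "col Q i \<bullet> col Q j = (if i = j then 1 else 0)"
proof -
  have "(Q\<^sup>T * Q) $$ (i, j) = (1\<^sub>m (dim_col Q)) $$ (i, j)"
    using assms(1) by (simp add: orthonormal_cols_def)
  then show ?thesis using assms by simp
qed

lemma orthonormal_colsI: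
  assumes "\<And>i j. i < dim_col Q \<Longrightarrow> j < dim_col Q \<Longrightarrow> col Q i \<bullet> col Q j = (if i = j then 1 else 0)"
  shows "orthonormal_cols Q"
  unfolding orthonormal_cols_def using assms by (intro eq_matI) auto

lemma orthonormal_cols_isometry:
  assumes "orthonormal_cols Q" "dim_vec x = dim_col Q"
  shows "Q\<^sup>T *\<^sub>v (Q *\<^sub>v x) = x" "(Q *\<^sub>v x) \<bullet> (Q *\<^sub>v x) = x \<bullet> x" "l2norm (Q *\<^sub>v x) = l2norm x"
proof -
  show 1: "Q\<^sup>T *\<^sub>v (Q *\<^sub>v x) = x"
    using assms by (simp add: orthonormal_cols_def one_mat_vec_dim flip: mult_mat_vec_assoc_dim)
  show 2: "(Q *\<^sub>v x) \<bullet> (Q *\<^sub>v x) = x \<bullet> x"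
    using assms 1 by (simp add: mult_mat_vec_scalar_prod)
  show "l2norm (Q *\<^sub>v x) = l2norm x" using 2 by (simp add: l2norm_def)
qed

lemma norm_bound_orthonormal: "orthonormal_cols Q \<Longrightarrow> norm_bound Q 1"
  by (simp add: norm_bound_def orthonormal_cols_isometry)

lemma norm_bound_mat_diag:
  assumes "\<And>j. j < n \<Longrightarrow> \<bar>f j\<bar> \<le> c" "0 \<le> c"
  shows "norm_bound (mat_diag n f) c"
proof (rule norm_boundI_sq[OF assms(2)])
  fix x :: "real vec" assume x: "dim_vec x = dim_col (mat_diag n f)"
  then have n: "dim_vec x = n" by (simp add: mat_diag_def)
  have eq: "mat_diag n f *\<^sub>v x = vec n (\<lambda>j. f j * x $ j)"
    using n by (auto intro!: eq_vecI simp: mat_diag_def scalar_prod_def if_distrib[of "\<lambda>x. x * _"] cong: if_cong)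
  have "(\<Sum>j<n. (f j * x $ j)\<^sup>2) \<le> (\<Sum>j<n. c\<^sup>2 * (x $ j)\<^sup>2)"
    using assms by (intro sum_mono) (simp add: power_mult_distrib mult_right_mono abs_le_square_iff[symmetric])
  then show "(mat_diag n f *\<^sub>v x) \<bullet> (mat_diag n f *\<^sub>v x) \<le> c\<^sup>2 * (x \<bullet> x)"
    unfolding eq by (simp add: scalar_prod_def n atLeast0LessThan power2_eq_square sum_distrib_left)
qed

text \<open>Fewer equations than unknowns: zero rows pad \<open>G\<close> to a singular square
  matrix. This is the dimension count behind the variational estimates.\<close>

lemma exists_nonzero_kernel:
  fixes G :: "real mat"
  assumes "G \<in> carrier_mat p q" "p < q"
  shows "\<exists>x. dim_vec x = q \<and> x \<noteq> 0\<^sub>v q \<and> G *\<^sub>v x = 0\<^sub>v p"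
proof -
  \<comment> \<open>Row \<open>p\<close> is listed separately, although the later rows vanish too,
    to match the shape of \<open>det_row_0\<close>.\<close>
  let ?G = "mat\<^sub>r q q (\<lambda>i. if i = p then 0\<^sub>v q else if i < p then row G i else 0\<^sub>v q)"
  have "det ?G = 0" using assms by (intro det_row_0) auto
  then obtain x where x: "dim_vec x = q" "x \<noteq> 0\<^sub>v q" "?G *\<^sub>v x = 0\<^sub>v q"
    using det_0_iff_vec_prod_zero[of ?G q] by (auto dest: carrier_vecD)
  have "G *\<^sub>v x = 0\<^sub>v p"
  proof (rule eq_vecI)
    fix i assume i: "i < dim_vec (0\<^sub>v p)"
    have "row G i = row ?G i" using i assms by (auto intro!: eq_vecI)
    moreover have "(?G *\<^sub>v x) $ i = 0" using x(3) i assms by simp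
    ultimately show "(G *\<^sub>v x) $ i = 0\<^sub>v p $ i" using i assms by simp
  qed (use assms in auto)
  then show ?thesis using x by blast
qed

section \<open>The spectral theorem for real symmetric matrices\<close>

lemma symmetric_scalar_prod:
  fixes M :: "real mat"
  assumes "M \<in> carrier_mat n n" "M\<^sup>T = M" "dim_vec x = n" "dim_vec y = n"
  shows "(M *\<^sub>v x) \<bullet> y = x \<bullet> (M *\<^sub>v y)"
  using assms by (subst mult_mat_vec_scalar_prod) auto

text \<open>A root of the complex characteristic polynomial gives an eigenvector a + i b. Symmetry
  forces the root to be real, and then whichever of a, b is nonzero is a real eigenvector.\<close>

lemma symmetric_real_eigenvector:
  fixes M :: "real mat"
  assumes M: "M \<in> carrier_mat n n" "M\<^sup>T = M" and n: "0 < n"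
  shows "\<exists>l q. dim_vec q = n \<and> q \<bullet> q = 1 \<and> M *\<^sub>v q = l \<cdot>\<^sub>v q"
proof -
  let ?Mc = "map_mat complex_of_real M"
  have Mc: "?Mc \<in> carrier_mat n n" using M by simp
  have "degree (char_poly ?Mc) = n" using degree_monic_char_poly[OF Mc] by simp
  then have "\<not> constant (poly (char_poly ?Mc))" using n by (simp add: constant_degree)
  then obtain z where "poly (char_poly ?Mc) z = 0" using fundamental_theorem_of_algebra by blast
  then obtain v where v: "v \<in> carrier_vec n" "v \<noteq> 0\<^sub>v n" "?Mc *\<^sub>v v = z \<cdot>\<^sub>v v"
    using eigenvalue_root_char_poly[OF Mc, of z] M by (auto simp: eigenvalue_def eigenvector_def)
  define a b where "a = map_vec Re v" and "b = map_vec Im v"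
  have dims: "dim_vec a = n" "dim_vec b = n" using v by (auto simp: a_def b_def)
  have idx: "(\<Sum>j<n. complex_of_real (M $$ (i, j)) * v $ j) = z * v $ i" if i: "i < n" for i
  proof -
    have "(?Mc *\<^sub>v v) $ i = (\<Sum>j<n. complex_of_real (M $$ (i, j)) * v $ j)"
      using i M(1) v(1) by (simp add: scalar_prod_def atLeast0LessThan)
    moreover have "(z \<cdot>\<^sub>v v) $ i = z * v $ i" using i v(1) by simp
    ultimately show ?thesis using v(3) by simp
  qed
  have Ma: "M *\<^sub>v a = Re z \<cdot>\<^sub>v a - Im z \<cdot>\<^sub>v b"
  proof (rule eq_vecI)
    fix i assume "i < dim_vec (Re z \<cdot>\<^sub>v a - Im z \<cdot>\<^sub>v b)"
    then have i: "i < n" using dims by simp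
    show "(M *\<^sub>v a) $ i = (Re z \<cdot>\<^sub>v a - Im z \<cdot>\<^sub>v b) $ i"
      using arg_cong[OF idx[OF i], of Re] i M v dims
      by (simp add: scalar_prod_def atLeast0LessThan a_def b_def Re_sum)
  qed (use M dims in auto)
  have Mb: "M *\<^sub>v b = Re z \<cdot>\<^sub>v b + Im z \<cdot>\<^sub>v a"
  proof (rule eq_vecI)
    fix i assume "i < dim_vec (Re z \<cdot>\<^sub>v b + Im z \<cdot>\<^sub>v a)"
    then have i: "i < n" using dims by simp
    show "(M *\<^sub>v b) $ i = (Re z \<cdot>\<^sub>v b + Im z \<cdot>\<^sub>v a) $ i"
      using arg_cong[OF idx[OF i], of Im] i M v dims
      by (simp add: scalar_prod_def atLeast0LessThan a_def b_def Im_sum)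
  qed (use M dims in auto)
  have "(M *\<^sub>v a) \<bullet> b = a \<bullet> (M *\<^sub>v b)" using M dims by (rule symmetric_scalar_prod)
  then have "Im z * (a \<bullet> a + b \<bullet> b) = 0"
    unfolding Ma Mb using dims by (simp add: scalar_prod_expand algebra_simps)
  moreover have ne: "a \<bullet> a + b \<bullet> b \<noteq> 0"
  proof
    assume "a \<bullet> a + b \<bullet> b = 0"
    then have "a \<bullet> a = 0" "b \<bullet> b = 0"
      using scalar_prod_self_ge_0[of a] scalar_prod_self_ge_0[of b] by linarith+
    then have z: "a = 0\<^sub>v n" "b = 0\<^sub>v n" using dims by (simp_all add: scalar_prod_self_eq_0)
    have "v = 0\<^sub>v n"
    proof (rule eq_vecI)
      fix i assume "i < dim_vec (0\<^sub>v n :: complex vec)"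
      then show "v $ i = 0\<^sub>v n $ i"
        using arg_cong[OF z(1), of "\<lambda>x. x $ i"] arg_cong[OF z(2), of "\<lambda>x. x $ i"] v
        by (simp add: a_def b_def complex_eq_iff)
    qed (use v in simp)
    then show False using v by simp
  qed
  ultimately have Im: "Im z = 0" by simp
  have "\<exists>c. dim_vec c = n \<and> c \<bullet> c \<noteq> 0 \<and> M *\<^sub>v c = Re z \<cdot>\<^sub>v c"
  proof (cases "a \<bullet> a = 0")
    case True
    then have "b \<bullet> b \<noteq> 0" using ne by simp
    moreover have "M *\<^sub>v b = Re z \<cdot>\<^sub>v b" unfolding Mb Im using dims by (auto intro!: eq_vecI)
    ultimately show ?thesis using dims by blast
  next
    case False
    moreover have "M *\<^sub>v a = Re z \<cdot>\<^sub>v a" unfolding Ma Im using dims by (auto intro!: eq_vecI)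
    ultimately show ?thesis using dims by blast
  qed
  then obtain c where c: "dim_vec c = n" "c \<bullet> c \<noteq> 0" "M *\<^sub>v c = Re z \<cdot>\<^sub>v c" by blast
  let ?q = "(1 / l2norm c) \<cdot>\<^sub>v c"
  have "?q \<bullet> ?q = 1" using c by (simp add: l2norm_def scalar_prod_self_ge_0)
  moreover have "M *\<^sub>v ?q = Re z \<cdot>\<^sub>v ?q"
    using c M by (simp add: mat_vec_smult_dim smult_smult_assoc mult.commute)
  moreover have "dim_vec ?q = n" using c(1) by simp
  ultimately show ?thesis by blast
qed

text \<open>The witness is the Householder reflection exchanging \<open>q\<close> and the first unit vector.\<close>

lemma symmetric_orthogonal_with_first_col:
  fixes q :: "real vec"
  assumes q: "dim_vec q = n" "q \<bullet> q = 1" and n: "0 < n"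
  shows "\<exists>P \<in> carrier_mat n n. P\<^sup>T = P \<and> P * P = 1\<^sub>m n \<and> col P 0 = q"
proof (cases "q = unit_vec n 0")
  case True
  then show ?thesis using n by (intro bexI[of _ "1\<^sub>m n"]) auto
next
  case False
  define u where "u = q - unit_vec n 0"
  have u: "dim_vec u = n" by (simp add: u_def)
  have u0: "u $ 0 = q $ 0 - 1" using n q by (simp add: u_def)
  have "q \<bullet> unit_vec n 0 = q $ 0" "unit_vec n 0 \<bullet> q = q $ 0" "unit_vec n 0 \<bullet> unit_vec n 0 = (1 :: real)"
    using n scalar_prod_left_unit[OF carrier_vecI[OF q(1)]] by simp_all
  then have "u \<bullet> u = 2 - 2 * q $ 0"
    unfolding u_def using q by (simp add: scalar_prod_expand)
  then have uu: "u \<bullet> u = - 2 * u $ 0" using u0 by simp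
  have uu0: "u \<bullet> u \<noteq> 0"
  proof
    assume "u \<bullet> u = 0"
    then have z: "u = 0\<^sub>v n" using u by (simp add: scalar_prod_self_eq_0)
    have "q = unit_vec n 0"
    proof (rule eq_vecI)
      fix i assume "i < dim_vec (unit_vec n 0 :: real vec)"
      then show "q $ i = unit_vec n 0 $ i"
        using arg_cong[OF z, of "\<lambda>x. x $ i"] q by (simp add: u_def)
    qed (use q in simp)
    then show False using False by simp
  qed
  define c where "c = 2 / (u \<bullet> u)"
  have cu: "c * (u \<bullet> u) = 2" using uu0 by (simp add: c_def)
  define P where "P = mat n n (\<lambda>(i, j). (if i = j then 1 else 0) - c * u $ i * u $ j)"
  have P: "P \<in> carrier_mat n n" by (simp add: P_def)
  have PT: "P\<^sup>T = P" by (rule eq_matI) (auto simp: P_def)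
  have "P * P = 1\<^sub>m n"
  proof (rule eq_matI)
    fix i j assume "i < dim_row (1\<^sub>m n :: real mat)" "j < dim_col (1\<^sub>m n :: real mat)"
    then have ij: "i < n" "j < n" by auto
    have "(P * P) $$ (i, j) = (\<Sum>l<n. ((if i = l then 1 else 0) - c * u $ i * u $ l) *
        ((if l = j then 1 else 0) - c * u $ l * u $ j))"
      using ij by (simp add: P_def scalar_prod_def atLeast0LessThan)
    also have "\<dots> = (\<Sum>l<n. (if l = i then (if i = j then 1 else 0) - c * u $ i * u $ j else 0)
        - (if l = j then c * u $ i * u $ j else 0) + c * u $ i * u $ j * (c * (u $ l * u $ l)))"
      by (rule sum.cong) (auto simp: algebra_simps)
    also have "\<dots> = (if i = j then 1 else 0) - 2 * c * u $ i * u $ j + c * u $ i * u $ j * (c * (u \<bullet> u))"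
      using ij by (simp add: sum.distrib sum_subtractf sum.delta scalar_prod_def u atLeast0LessThan
          flip: sum_distrib_left)
    also have "\<dots> = (if i = j then 1 else 0)" unfolding cu by simp
    finally show "(P * P) $$ (i, j) = 1\<^sub>m n $$ (i, j)" using ij by simp
  qed (use P in auto)
  moreover have "col P 0 = q"
  proof (rule eq_vecI)
    fix i assume i: "i < dim_vec q"
    \<comment> \<open>Column 0 of \<open>P\<close> is e_0 - c u_0 u, which becomes e_0 + u =
      q.\<close>
    have cu0: "c * u $ 0 = - 1" using cu uu by simp
    have "c * u $ i * u $ 0 = (c * u $ 0) * u $ i" by simp
    then have "c * u $ i * u $ 0 = - (u $ i)" unfolding cu0 by simp
    then show "col P 0 $ i = q $ i" using i n q by (auto simp: P_def u_def)
  qed (use P q in auto)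
  ultimately show ?thesis using P PT by blast
qed

text \<open>Deflation: conjugation by a reflection that moves a unit eigenvector to the first axis
  clears the first column, and by symmetry the first row, outside the diagonal.\<close>

lemma symmetric_diagonalizable:
  fixes M :: "real mat"
  assumes "M \<in> carrier_mat n n" "M\<^sup>T = M"
  shows "\<exists>Q f. Q \<in> carrier_mat n n \<and> Q\<^sup>T * Q = 1\<^sub>m n \<and> M * Q = Q * mat_diag n f"
  using assms
proof (induction n arbitrary: M)
  case 0
  then show ?case
    by (intro exI[of _ "1\<^sub>m 0"] exI[of _ "\<lambda>_. 0"]) (auto intro!: eq_matI simp: mat_diag_def)
next
  case (Suc n M)
  let ?n = "Suc n"
  obtain l q where q: "dim_vec q = ?n" "q \<bullet> q = 1" "M *\<^sub>v q = l \<cdot>\<^sub>v q"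
    using symmetric_real_eigenvector[OF Suc.prems] by blast
  obtain P where P: "P \<in> carrier_mat ?n ?n" "P\<^sup>T = P" "P * P = 1\<^sub>m ?n" "col P 0 = q"
    using symmetric_orthogonal_with_first_col[OF q(1,2)] by blast
  define N where "N = P * M * P"
  note [simp] = carrier_matD[OF P(1)] carrier_matD[OF Suc.prems(1)]
  have N: "N \<in> carrier_mat ?n ?n" by (auto simp: N_def)
  have NT: "N\<^sup>T = N" using P Suc.prems by (simp add: N_def transpose_mult_dim mult_mat_assoc_dim)
  have Pq: "P *\<^sub>v q = unit_vec ?n 0"
    using P(3,4) col_mult2[OF P(1) P(1), of 0] by simp
  have N0: "N $$ (i, 0) = (if i = 0 then l else 0)" if "i < ?n" for i
  proof -
    have "col N 0 = P * M *\<^sub>v q"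
      unfolding N_def using col_mult2[of "P * M" ?n ?n P ?n 0] P Suc.prems by simp
    also have "\<dots> = l \<cdot>\<^sub>v unit_vec ?n 0"
      using q P Pq by (simp add: mult_mat_vec_assoc_dim mat_vec_smult_dim)
    finally have "col N 0 $ i = (l \<cdot>\<^sub>v unit_vec ?n 0) $ i" by simp
    then show ?thesis using that N by simp
  qed
  define M' where "M' = mat n n (\<lambda>(i, j). N $$ (Suc i, Suc j))"
  have M': "M' \<in> carrier_mat n n" by (simp add: M'_def)
  have Nsym: "N $$ (i, j) = N $$ (j, i)" if "i < ?n" "j < ?n" for i j
    using that N arg_cong[OF NT, of "\<lambda>X. X $$ (i, j)"] by simp
  have "M'\<^sup>T = M'" by (rule eq_matI) (auto simp: M'_def Nsym)
  from Suc.IH[OF M' this] obtain Q' f where Q': "Q' \<in> carrier_mat n n" "Q'\<^sup>T * Q' = 1\<^sub>m n"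
    "M' * Q' = Q' * mat_diag n f" by blast
  define L where "L = mat 1 1 (\<lambda>_. l)"
  have L: "L \<in> carrier_mat 1 1" by (simp add: L_def)
  define D where "D = mat_diag n f"
  have D: "D \<in> carrier_mat n n" by (simp add: D_def)
  define R where "R = four_block_mat (1\<^sub>m 1) (0\<^sub>m 1 n) (0\<^sub>m n 1) Q'"
  have R: "R \<in> carrier_mat ?n ?n" using Q' by (auto simp: R_def)
  have Nb: "N = four_block_mat L (0\<^sub>m 1 n) (0\<^sub>m n 1) M'"
  proof (rule eq_matI)
    fix i j assume "i < dim_row (four_block_mat L (0\<^sub>m 1 n) (0\<^sub>m n 1) M')"
      "j < dim_col (four_block_mat L (0\<^sub>m 1 n) (0\<^sub>m n 1) M')"
    then have ij: "i < ?n" "j < ?n" using L M' by auto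
    show "N $$ (i, j) = four_block_mat L (0\<^sub>m 1 n) (0\<^sub>m n 1) M' $$ (i, j)"
      using ij N0[of i] N0[of j] Nsym[of i j] L M'
      by (cases i; cases j) (auto simp: L_def M'_def)
  qed (use N L M' in auto)
  have Db: "mat_diag ?n (case_nat l f) = four_block_mat L (0\<^sub>m 1 n) (0\<^sub>m n 1) D"
    by (rule eq_matI) (auto simp: mat_diag_def L_def D_def split: nat.split)
  have NR: "N * R = R * mat_diag ?n (case_nat l f)"
    unfolding Nb Db R_def using L M' Q'(1) Q'(3)[folded D_def] D
    by (simp add: mult_four_block_mat[of _ 1 1 _ n _ n _ _ 1 _ n] left_add_zero_mat[of _ 1 1]
      right_add_zero_mat[of _ 1 1] left_add_zero_mat[of _ n n])
  have RT: "R\<^sup>T = four_block_mat (1\<^sub>m 1) (0\<^sub>m 1 n) (0\<^sub>m n 1) (Q'\<^sup>T)"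
    unfolding R_def using Q' by (subst transpose_four_block_mat) auto
  have RR: "R\<^sup>T * R = 1\<^sub>m ?n"
    unfolding RT unfolding R_def using Q'
    by (simp add: mult_four_block_mat[of _ 1 1 _ n _ n _ _ 1 _ n] four_block_one_mat[of 1 n, simplified] right_add_zero_mat[of _ 1 1] left_add_zero_mat[of _ n n])
  note [simp] = carrier_matD[OF R] carrier_matD[OF N]
  have "(P * R)\<^sup>T * (P * R) = R\<^sup>T * (P * P) * R"
    using P(2) by (simp add: transpose_mult_dim mult_mat_assoc_dim)
  also have "\<dots> = 1\<^sub>m ?n" using P(3) RR R by simp
  finally have 1: "(P * R)\<^sup>T * (P * R) = 1\<^sub>m ?n" .
  have "P * N = (P * P) * M * P"
    by (simp add: N_def mult_mat_assoc_dim)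
  then have "P * N = M * P" using P(3) Suc.prems(1) by simp
  then have "M * (P * R) = P * (N * R)" by (simp flip: mult_mat_assoc_dim)
  also have "\<dots> = P * R * mat_diag ?n (case_nat l f)"
    unfolding NR by (subst mult_mat_assoc_dim) (auto simp: mat_diag_def)
  finally have 2: "M * (P * R) = P * R * mat_diag ?n (case_nat l f)" .
  have "P * R \<in> carrier_mat ?n ?n" using P R by simp
  with 1 2 show ?case by blast
qed

lemma proots_linear_factors: "proots (\<Prod>a\<leftarrow>es. [:- a, 1:]) = mset (es :: real list)"
proof (induction es)
  case (Cons a es)
  have "(\<Prod>a\<leftarrow>es. [:- a, 1:]) \<noteq> 0" by (auto simp: prod_list_zero_iff)
  then show ?case using Cons by (simp add: proots_mult del: mult_pCons_left)
qed simp

text \<open>Links the sorted roots of the characteristic polynomial to an orthonormal eigenbasis: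
  diagonalisation gives the same roots with multiplicity, and a permutation of the columns puts them
  in the order of \<open>eigvals\<close>.\<close>

lemma symmetric_spectral:
  fixes M :: "real mat"
  assumes M: "M \<in> carrier_mat n n" "M\<^sup>T = M"
  shows "length (eigvals M) = n" 
    and "\<And>i j. i \<le> j \<Longrightarrow> j < n \<Longrightarrow> eigvals M ! j \<le> eigvals M ! i"
    and "\<exists>Q \<in> carrier_mat n n. orthonormal_cols Q \<and> Q * Q\<^sup>T = 1\<^sub>m n \<and>
      (\<forall>j<n. M *\<^sub>v col Q j = eigvals M ! j \<cdot>\<^sub>v col Q j)"
proof -
  obtain Q f where Q: "Q \<in> carrier_mat n n" "Q\<^sup>T * Q = 1\<^sub>m n" "M * Q = Q * mat_diag n f"
    using symmetric_diagonalizable[OF M] by blast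
  have QQ: "Q * Q\<^sup>T = 1\<^sub>m n" using mat_mult_left_right_inverse[OF _ Q(1) Q(2)] Q(1) by simp
  note [simp] = carrier_matD[OF Q(1)] carrier_matD[OF M(1)]
  let ?D = "mat_diag n f"
  have "M = M * (Q * Q\<^sup>T)" using QQ M by simp
  also have "\<dots> = Q * ?D * Q\<^sup>T" using Q(3) by (simp flip: mult_mat_assoc_dim)
  finally have "similar_mat M ?D" using Q QQ M by (intro similar_matI[of _ _ Q "Q\<^sup>T" n]) auto
  then have "char_poly M = char_poly ?D" by (rule char_poly_similar)
  also have "\<dots> = (\<Prod>a\<leftarrow>diag_mat ?D. [:- a, 1:])"
    by (rule char_poly_upper_triangular[of _ n]) (auto simp: mat_diag_def)
  also have "diag_mat ?D = map f [0..<n]" by (auto simp: diag_mat_def mat_diag_def)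
  finally have "proots (char_poly M) = mset (map f [0..<n])" by (simp only: proots_linear_factors)
  then have ms: "mset (eigvals M) = mset (map f [0..<n])" by (simp add: eigvals_def)
  from mset_eq_length[OF this] show len: "length (eigvals M) = n" by simp
  show "eigvals M ! j \<le> eigvals M ! i" if "i \<le> j" "j < n" for i j
  proof -
    have "sorted_wrt (\<ge>) (eigvals M)" unfolding eigvals_def by (simp add: sorted_wrt_rev)
    then show ?thesis using that len by (cases "i = j") (auto simp: sorted_wrt_iff_nth_less)
  qed
  from mset_eq_permutation[OF ms] obtain p where p: "p permutes {..<n}"
    "permute_list p (map f [0..<n]) = eigvals M" by auto
  have pn: "p j < n" if "j < n" for j using permutes_in_image[OF p(1), of j] that by simp
  have ev: "eigvals M ! j = f (p j)" if "j < n" for j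
    using p that pn[OF that] by (auto simp flip: p(2) simp: permute_list_nth)
  define R where "R = mat n n (\<lambda>(i, j). Q $$ (i, p j))"
  have R: "R \<in> carrier_mat n n" by (simp add: R_def)
  have colR: "col R j = col Q (p j)" if "j < n" for j
    using that pn[OF that] by (auto intro!: eq_vecI simp: R_def)
  have oQ: "orthonormal_cols Q" using Q by (simp add: orthonormal_cols_def)
  have oR: "orthonormal_cols R"
  proof (rule orthonormal_colsI)
    fix i j assume "i < dim_col R" "j < dim_col R"
    then have ij: "i < n" "j < n" using R by auto
    have "p i = p j \<longleftrightarrow> i = j" using permutes_inj[OF p(1)] by (auto dest: injD)
    then show "col R i \<bullet> col R j = (if i = j then 1 else 0)"
      using ij pn orthonormal_cols_scalar_prod[OF oQ, of "p i" "p j"] by (simp add: colR)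
  qed
  have "R * R\<^sup>T = 1\<^sub>m n"
    using mat_mult_left_right_inverse[of "R\<^sup>T" n R] oR R by (simp add: orthonormal_cols_def)
  moreover have "M *\<^sub>v col R j = eigvals M ! j \<cdot>\<^sub>v col R j" if j: "j < n" for j
  proof -
    have "col (M * Q) (p j) = col (Q * ?D) (p j)" using Q(3) by simp
    moreover have "col (M * Q) (p j) = M *\<^sub>v col Q (p j)"
      using col_mult2[OF M(1) Q(1)] pn[OF j] by simp
    moreover have "col (Q * ?D) (p j) = f (p j) \<cdot>\<^sub>v col Q (p j)"
      using pn[OF j] mat_diag_mult_right[OF Q(1), of f] by (auto intro!: eq_vecI)
    ultimately show ?thesis using j by (simp add: colR ev)
  qed
  ultimately show "\<exists>Q \<in> carrier_mat n n. orthonormal_cols Q \<and> Q * Q\<^sup>T = 1\<^sub>m n \<and>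
      (\<forall>j<n. M *\<^sub>v col Q j = eigvals M ! j \<cdot>\<^sub>v col Q j)"
    using R oR by blast
qed

section \<open>Coordinates in an eigenbasis\<close>

lemma mat_diag_dims [simp]: "dim_row (mat_diag n f) = n" "dim_col (mat_diag n f) = n"
  by (simp_all add: mat_diag_def)

lemma col_mult_dim: "dim_col A = dim_row B \<Longrightarrow> j < dim_col B \<Longrightarrow> col (A * B) j = A *\<^sub>v col B j"
  by (rule eq_vecI) simp_all

lemma col_mult_mat_diag: "j < dim_col A \<Longrightarrow> col (A * mat_diag (dim_col A) f) j = f j \<cdot>\<^sub>v col A j"
  for A :: "real mat"
  by (subst mat_diag_mult_right[OF carrier_matI[OF refl refl]]) (auto intro!: eq_vecI)

lemma eigenvector_cols_mult:
  fixes M :: "real mat"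
  assumes "dim_col M = dim_row Y" "dim_row M = dim_row Y"
    and "\<And>j. j < dim_col Y \<Longrightarrow> M *\<^sub>v col Y j = f j \<cdot>\<^sub>v col Y j"
  shows "M * Y = Y * mat_diag (dim_col Y) f"
proof (rule mat_col_eqI)
  fix j assume "j < dim_col (Y * mat_diag (dim_col Y) f)"
  then have j: "j < dim_col Y" by simp
  show "col (M * Y) j = col (Y * mat_diag (dim_col Y) f) j"
    unfolding col_mult_mat_diag[OF j] using assms j by (subst col_mult_dim) auto
qed (use assms in auto)

lemma mat_diag_mult_vec: "dim_vec x = n \<Longrightarrow> mat_diag n f *\<^sub>v x = vec n (\<lambda>j. f j * x $ j)"
  for x :: "real vec"
  by (auto intro!: eq_vecI simp: mat_diag_def scalar_prod_def if_distrib[of "\<lambda>x. x * _"] cong: if_cong)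

lemma parseval:
  fixes Q :: "real mat"
  assumes Q: "Q \<in> carrier_mat n n" "Q * Q\<^sup>T = 1\<^sub>m n" and x: "dim_vec x = n" "dim_vec y = n"
  shows "x \<bullet> y = (\<Sum>j<n. (col Q j \<bullet> x) * (col Q j \<bullet> y))"
proof -
  note [simp] = carrier_matD[OF Q(1)] x
  have "x \<bullet> y = x \<bullet> (Q *\<^sub>v (Q\<^sup>T *\<^sub>v y))"
    using Q(2) by (simp add: one_mat_vec_dim flip: mult_mat_vec_assoc_dim)
  also have "\<dots> = (Q\<^sup>T *\<^sub>v x) \<bullet> (Q\<^sup>T *\<^sub>v y)"
    by (simp add: mult_mat_vec_scalar_prod)
  finally show ?thesis by (simp add: scalar_prod_def[of "Q\<^sup>T *\<^sub>v x"] atLeast0LessThan)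
qed

lemma spectral_quadratic_form:
  fixes M :: "real mat"
  assumes M: "M \<in> carrier_mat n n" "M\<^sup>T = M"
    and Q: "Q \<in> carrier_mat n n" "Q * Q\<^sup>T = 1\<^sub>m n" "\<forall>j<n. M *\<^sub>v col Q j = f j \<cdot>\<^sub>v col Q j"
    and x: "dim_vec x = n"
  shows "x \<bullet> (M *\<^sub>v x) = (\<Sum>j<n. f j * (col Q j \<bullet> x)\<^sup>2)"
proof -
  note [simp] = carrier_matD[OF Q(1)] carrier_matD[OF M(1)] x
  have "col Q j \<bullet> (M *\<^sub>v x) = f j * (col Q j \<bullet> x)" if "j < n" for j
    using symmetric_scalar_prod[OF M, of "col Q j" x] Q(3) that by simp
  then show ?thesis
    by (subst parseval[OF Q(1,2)]) (auto intro!: sum.cong simp: power2_eq_square)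
qed

section \<open>Variational estimates\<close>

definition first_cols :: "nat \<Rightarrow> real mat \<Rightarrow> real mat" where
  "first_cols p Q = mat (dim_row Q) p (\<lambda>(i, j). Q $$ (i, j))"

lemma first_cols_dims [simp]: "dim_row (first_cols p Q) = dim_row Q" "dim_col (first_cols p Q) = p"
  by (simp_all add: first_cols_def)

lemma col_first_cols [simp]: "j < p \<Longrightarrow> p \<le> dim_col Q \<Longrightarrow> col (first_cols p Q) j = col Q j"
  by (auto intro!: eq_vecI simp: first_cols_def)

lemma orthonormal_first_cols:
  assumes "orthonormal_cols Q" "p \<le> dim_col Q"
  shows "orthonormal_cols (first_cols p Q)"
  using assms by (intro orthonormal_colsI) (auto simp: orthonormal_cols_scalar_prod)

lemma col_scalar_prod_first_cols:
  assumes "orthonormal_cols Q" "p \<le> dim_col Q" "dim_vec a = p" "j < dim_col Q"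
  shows "col Q j \<bullet> (first_cols p Q *\<^sub>v a) = (if j < p then a $ j else 0)"
proof -
  have "(first_cols p Q)\<^sup>T *\<^sub>v col Q j = vec p (\<lambda>i. if i = j then 1 else 0)"
    using assms by (intro eq_vecI) (auto simp: orthonormal_cols_scalar_prod)
  moreover have "col Q j \<bullet> (first_cols p Q *\<^sub>v a) = a \<bullet> ((first_cols p Q)\<^sup>T *\<^sub>v col Q j)"
    using assms by (subst scalar_prod_comm_dim) (auto simp: mult_mat_vec_scalar_prod)
  ultimately show ?thesis using assms(3)
    by (simp add: scalar_prod_def if_distrib[of "\<lambda>x. _ * x"] cong: if_cong)
qed

text \<open>One half of the Courant-Fischer principle: \<open>K\<close> has only \<open>m\<close>
  columns, so the span of the top m + 1 eigenvectors contains a nonzero vector orthogonal to all of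
  them, and there the form is at least \<open>eigvals H ! m\<close>. Counted from 0, this is the
  (m+1)-st largest eigenvalue.\<close>

lemma eigvals_le:
  fixes H :: "real mat"
  assumes H: "H \<in> carrier_mat n n" "H\<^sup>T = H"
    and K: "K \<in> carrier_mat n m" and mn: "m < n"
    and le: "\<And>x. dim_vec x = n \<Longrightarrow> K\<^sup>T *\<^sub>v x = 0\<^sub>v m \<Longrightarrow> x \<bullet> (H *\<^sub>v x) \<le> \<mu> * (x \<bullet> x)"
  shows "eigvals H ! m \<le> \<mu>"
proof -
  note sp = symmetric_spectral[OF H]
  obtain Q where Q: "Q \<in> carrier_mat n n" "orthonormal_cols Q" "Q * Q\<^sup>T = 1\<^sub>m n"
    "\<forall>j<n. H *\<^sub>v col Q j = eigvals H ! j \<cdot>\<^sub>v col Q j" using sp(3) by blast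
  note [simp] = carrier_matD[OF Q(1)] carrier_matD[OF H(1)] carrier_matD[OF K]
  let ?Q = "first_cols (Suc m) Q"
  have "K\<^sup>T * ?Q \<in> carrier_mat m (Suc m)" by (auto intro: carrier_matI)
  from exists_nonzero_kernel[OF this] obtain a where
    a: "dim_vec a = Suc m" "a \<noteq> 0\<^sub>v (Suc m)" "K\<^sup>T * ?Q *\<^sub>v a = 0\<^sub>v m" by blast
  define z where "z = ?Q *\<^sub>v a"
  have z: "dim_vec z = n" by (simp add: z_def)
  have "K\<^sup>T *\<^sub>v z = 0\<^sub>v m" using a by (simp add: z_def mult_mat_vec_assoc_dim)
  then have "z \<bullet> (H *\<^sub>v z) \<le> \<mu> * (z \<bullet> z)" using le z by blast
  moreover have "eigvals H ! m * (z \<bullet> z) \<le> z \<bullet> (H *\<^sub>v z)"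
  proof -
    have "eigvals H ! m * (col Q j \<bullet> z)\<^sup>2 \<le> eigvals H ! j * (col Q j \<bullet> z)\<^sup>2"
      if "j < n" for j
      using sp(2)[of j m] that mn col_scalar_prod_first_cols[OF Q(2), of "Suc m" a j] a(1)
      by (auto simp: z_def intro: mult_right_mono)
    then show ?thesis
      unfolding spectral_quadratic_form[OF H Q(1,3,4) z] parseval[OF Q(1,3) z z]
      by (auto simp: sum_distrib_left power2_eq_square intro!: sum_mono)
  qed
  moreover have "z \<bullet> z > 0"
  proof -
    have "z \<bullet> z = a \<bullet> a" unfolding z_def
      using a mn by (intro orthonormal_cols_isometry orthonormal_first_cols Q) auto
    moreover have "a \<bullet> a \<noteq> 0" using a by (simp add: scalar_prod_self_eq_0)
    ultimately show ?thesis using scalar_prod_self_ge_0[of z] by simp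
  qed
  ultimately show ?thesis by (meson mult_le_cancel_right_pos order_trans)
qed

text \<open>The other half: the range of \<open>G\<close> has dimension p + 1 and so contains a
  nonzero vector orthogonal to the top \<open>p\<close> eigenvectors, where the form is at most
  \<open>eigvals H ! p\<close>.\<close>

lemma eigvals_ge:
  fixes H :: "real mat"
  assumes H: "H \<in> carrier_mat n n" "H\<^sup>T = H"
    and G: "G \<in> carrier_mat n (Suc p)" "orthonormal_cols G" and pn: "p < n"
    and ge: "\<And>c. dim_vec c = Suc p \<Longrightarrow> \<nu> * (c \<bullet> c) \<le> (G *\<^sub>v c) \<bullet> (H *\<^sub>v (G *\<^sub>v c))"
  shows "\<nu> \<le> eigvals H ! p"
proof -
  note sp = symmetric_spectral[OF H]
  obtain Q where Q: "Q \<in> carrier_mat n n" "orthonormal_cols Q" "Q * Q\<^sup>T = 1\<^sub>m n"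
    "\<forall>j<n. H *\<^sub>v col Q j = eigvals H ! j \<cdot>\<^sub>v col Q j" using sp(3) by blast
  note [simp] = carrier_matD[OF Q(1)] carrier_matD[OF H(1)] carrier_matD[OF G(1)]
  have "(first_cols p Q)\<^sup>T * G \<in> carrier_mat p (Suc p)" by (auto intro: carrier_matI)
  from exists_nonzero_kernel[OF this] obtain c where
    c: "dim_vec c = Suc p" "c \<noteq> 0\<^sub>v (Suc p)" "(first_cols p Q)\<^sup>T * G *\<^sub>v c = 0\<^sub>v p" by blast
  define z where "z = G *\<^sub>v c"
  have z: "dim_vec z = n" by (simp add: z_def)
  have z0: "(first_cols p Q)\<^sup>T *\<^sub>v z = 0\<^sub>v p" using c by (simp add: z_def mult_mat_vec_assoc_dim)
  have qz: "col Q j \<bullet> z = 0" if "j < p" for j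
    using arg_cong[OF z0, of "\<lambda>x. x $ j"] that pn by simp
  have "z \<bullet> (H *\<^sub>v z) \<le> eigvals H ! p * (z \<bullet> z)"
  proof -
    have "eigvals H ! j * (col Q j \<bullet> z)\<^sup>2 \<le> eigvals H ! p * (col Q j \<bullet> z)\<^sup>2"
      if "j < n" for j
      using sp(2)[of p j] that qz[of j] by (cases "j < p") (auto intro: mult_right_mono)
    then show ?thesis
      unfolding spectral_quadratic_form[OF H Q(1,3,4) z] parseval[OF Q(1,3) z z]
      by (auto simp: sum_distrib_left power2_eq_square intro!: sum_mono)
  qed
  moreover have "z \<bullet> z = c \<bullet> c" unfolding z_def using c by (intro orthonormal_cols_isometry G) auto
  moreover have "c \<bullet> c > 0"
    using c scalar_prod_self_ge_0[of c] scalar_prod_self_eq_0[of c] by simp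
  moreover have "\<nu> * (c \<bullet> c) \<le> z \<bullet> (H *\<^sub>v z)" using ge c by (simp add: z_def)
  ultimately show ?thesis by (metis mult_le_cancel_right_pos order_trans)
qed

text \<open>
  Only the eigenvalues above \<open>\<mu>\<close> matter: for these, the matrix \<open>G\<close> of inner products of the columns
  of \<open>Y\<close> with a spectral basis is square with orthonormal columns, hence orthogonal.
\<close>

lemma quadratic_form_orthogonal_top:
  fixes H :: "real mat"
  assumes H: "H \<in> carrier_mat n n" "H\<^sup>T = H"
    and Y: "Y \<in> carrier_mat n m" "orthonormal_cols Y" "\<And>j. j < m \<Longrightarrow> H *\<^sub>v col Y j = eigvals H ! j \<cdot>\<^sub>v col Y j"
    and mn: "m \<le> n" and le: "m < n \<Longrightarrow> eigvals H ! m \<le> \<mu>"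
    and x: "dim_vec x = n" "Y\<^sup>T *\<^sub>v x = 0\<^sub>v m"
  shows "x \<bullet> (H *\<^sub>v x) \<le> \<mu> * (x \<bullet> x)"
proof -
  note sp = symmetric_spectral[OF H]
  obtain Q where Q: "Q \<in> carrier_mat n n" "orthonormal_cols Q" "Q * Q\<^sup>T = 1\<^sub>m n"
    "\<forall>j<n. H *\<^sub>v col Q j = eigvals H ! j \<cdot>\<^sub>v col Q j" using sp(3) by blast
  note [simp] = carrier_matD[OF Q(1)] carrier_matD[OF H(1)] carrier_matD[OF Y(1)] x(1)
  let ?l = "\<lambda>j. eigvals H ! j"
  \<comment> \<open>\<open>p\<close> counts the eigenvalues among the top \<open>m\<close> that
    exceed \<mu>. Cutting there instead of at \<open>m\<close> separates the eigenvalues strictly,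
    even if the one at \<open>m\<close> is repeated.\<close>
  define p where "p = (LEAST j. j = m \<or> ?l j \<le> \<mu>)"
  have p: "p = m \<or> ?l p \<le> \<mu>" unfolding p_def by (rule LeastI[of _ m]) simp
  have pm: "p \<le> m" unfolding p_def by (rule Least_le) simp
  have small: "?l j > \<mu>" if "j < p" for j
    using not_less_Least[of j "\<lambda>j. j = m \<or> ?l j \<le> \<mu>"] that by (auto simp: p_def)
  have large: "?l j \<le> \<mu>" if "p \<le> j" "j < n" for j
    using sp(2)[OF that] p le that by force
  have yx: "col Y j \<bullet> x = 0" if "j < m" for j
    using arg_cong[OF x(2), of "\<lambda>x. x $ j"] that by simp
  have qy: "col Q i \<bullet> col Y j = 0" if "p \<le> i" "i < n" "j < p" for i j
  proof -
    have "?l i * (col Q i \<bullet> col Y j) = ?l j * (col Q i \<bullet> col Y j)"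
      using symmetric_scalar_prod[OF H, of "col Q i" "col Y j"] Q(4) Y(3)[of j] that pm by simp
    moreover have "?l i \<noteq> ?l j" using large[of i] small[of j] that by simp
    ultimately show ?thesis by simp
  qed
  have pn: "p \<le> n" using pm mn by simp
  \<comment> \<open>By \<open>qy\<close> the first \<open>p\<close> columns of \<open>Y\<close> have
    no component along the later columns of \<open>Q\<close>, so Parseval sums against them may stop
    at \<open>p\<close>.\<close>
  have restrict: "(\<Sum>i<p. (col Q i \<bullet> col Y j) * f i) = (\<Sum>i<n. (col Q i \<bullet> col Y j) * f i)"
    if "j < p" for j f
    using pn qy that by (intro sum.mono_neutral_left) auto
  define G where "G = mat p p (\<lambda>(i, j). col Q i \<bullet> col Y j)"
  have G: "G \<in> carrier_mat p p" by (simp add: G_def)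
  have "G\<^sup>T * G = 1\<^sub>m p"
  proof (rule eq_matI)
    fix i j assume "i < dim_row (1\<^sub>m p :: real mat)" "j < dim_col (1\<^sub>m p :: real mat)"
    then have ij: "i < p" "j < p" by auto
    have "(G\<^sup>T * G) $$ (i, j) = (\<Sum>l<p. (col Q l \<bullet> col Y i) * (col Q l \<bullet> col Y j))"
      using ij by (simp add: G_def scalar_prod_def[of "col _ _"] scalar_prod_def[of "row _ _"] scalar_prod_def[of "vec _ _"] atLeast0LessThan)
    also have "\<dots> = col Y i \<bullet> col Y j"
      using ij by (subst restrict) (auto simp: parseval[OF Q(1,3), of "col Y i" "col Y j"])
    finally show "(G\<^sup>T * G) $$ (i, j) = 1\<^sub>m p $$ (i, j)"
      using ij pm by (simp add: orthonormal_cols_scalar_prod[OF Y(2)])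
  qed (auto simp: G_def)
  then have GG: "G * G\<^sup>T = 1\<^sub>m p" using mat_mult_left_right_inverse[of "G\<^sup>T" p G] G by simp
  define c where "c = vec p (\<lambda>i. col Q i \<bullet> x)"
  have "G\<^sup>T *\<^sub>v c = 0\<^sub>v p"
  proof (rule eq_vecI)
    fix j assume "j < dim_vec (0\<^sub>v p :: real vec)"
    then have j: "j < p" by simp
    have "(G\<^sup>T *\<^sub>v c) $ j = (\<Sum>l<p. (col Q l \<bullet> col Y j) * (col Q l \<bullet> x))"
      using j by (simp add: G_def c_def scalar_prod_def[of "col _ _"] scalar_prod_def[of "row _ _"] scalar_prod_def[of "vec _ _"] atLeast0LessThan)
    also have "\<dots> = col Y j \<bullet> x"
      using j by (subst restrict) (auto simp: parseval[OF Q(1,3), of "col Y j" x])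
    finally show "(G\<^sup>T *\<^sub>v c) $ j = 0\<^sub>v p $ j" using yx j pm by simp
  qed (use G in auto)
  then have "G * G\<^sup>T *\<^sub>v c = G *\<^sub>v 0\<^sub>v (dim_col G)"
    using G by (simp add: c_def mult_mat_vec_assoc_dim)
  then have c0: "c = 0\<^sub>v p" unfolding GG mult_mat_vec_zero using G by (simp add: c_def one_mat_vec_dim)
  have qx: "col Q i \<bullet> x = 0" if "i < p" for i
    using arg_cong[OF c0, of "\<lambda>x. x $ i"] that by (simp add: c_def)
  have "?l j * (col Q j \<bullet> x)\<^sup>2 \<le> \<mu> * (col Q j \<bullet> x)\<^sup>2" if "j < n" for j
    using large[of j] qx[of j] that by (cases "j < p") (auto intro: mult_right_mono)
  then show ?thesis
    unfolding spectral_quadratic_form[OF H Q(1,3,4) x(1)] parseval[OF Q(1,3) x(1) x(1)]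
    by (auto simp: sum_distrib_left power2_eq_square intro!: sum_mono)
qed

lemma quadratic_form_le_top_eigval:
  fixes H :: "real mat"
  assumes H: "H \<in> carrier_mat n n" "H\<^sup>T = H" and x: "dim_vec x = n"
  shows "x \<bullet> (H *\<^sub>v x) \<le> eigvals H ! 0 * (x \<bullet> x)"
  by (rule quadratic_form_orthogonal_top[OF H, of "mat n 0 (\<lambda>_. 0)" 0])
    (use x in \<open>auto simp: orthonormal_cols_def\<close>)

text \<open>A bound on the complement of any \<open>m\<close> columns \<open>K\<close> carries over
  to the complement of the top \<open>m\<close> eigenvectors, because by Courant-Fischer it bounds
  the next eigenvalue.\<close>

lemma quadratic_form_orthogonal_eigenvectors:
  fixes H :: "real mat"
  assumes H: "H \<in> carrier_mat n n" "H\<^sup>T = H"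
    and Y: "Y \<in> carrier_mat n m" "orthonormal_cols Y" "\<And>j. j < m \<Longrightarrow> H *\<^sub>v col Y j = eigvals H ! j \<cdot>\<^sub>v col Y j"
    and mn: "m \<le> n" and K: "K \<in> carrier_mat n m"
    and le: "\<And>x. dim_vec x = n \<Longrightarrow> K\<^sup>T *\<^sub>v x = 0\<^sub>v m \<Longrightarrow> x \<bullet> (H *\<^sub>v x) \<le> \<mu> * (x \<bullet> x)"
    and x: "dim_vec x = n" "Y\<^sup>T *\<^sub>v x = 0\<^sub>v m"
  shows "x \<bullet> (H *\<^sub>v x) \<le> \<mu> * (x \<bullet> x)"
  using quadratic_form_orthogonal_top[OF H Y mn _ x] eigvals_le[OF H K _ le] by blast

section \<open>Perturbation of top eigenspaces\<close>

text \<open>With F = X X^T - 1 one has (X^T X - 1) X^T y = X^T F y, and every x is some X^T y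
  because \<eta> \<le> 1/2 makes X^T invertible. The factor 2 combines |X^T F y|^2 \<le> 2 |F y|^2
  with |y|^2 \<le> 2 |x|^2.\<close>

lemma norm_bound_gram_swap:
  fixes X :: "real mat"
  assumes X: "X \<in> carrier_mat n n" and b: "norm_bound (X * X\<^sup>T - 1\<^sub>m n) \<eta>" and \<eta>: "0 \<le> \<eta>" "\<eta> \<le> 1 / 2"
  shows "norm_bound (X\<^sup>T * X - 1\<^sub>m n) (2 * \<eta>)"
proof (rule norm_boundI_sq)
  note [simp] = carrier_matD[OF X]
  define F where "F = X * X\<^sup>T - 1\<^sub>m n"
  have F [simp]: "dim_row F = n" "dim_col F = n" by (simp_all add: F_def)
  have XXT: "X *\<^sub>v (X\<^sup>T *\<^sub>v y) = y + F *\<^sub>v y" if "dim_vec y = n" for y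
    using that by (auto intro!: eq_vecI simp: F_def mat_vec_expand)
  have FB: "l2norm (F *\<^sub>v y) \<le> \<eta> * l2norm y" if "dim_vec y = n" for y
    using b that by (intro norm_boundD) (auto simp: F_def)
  have FQ: "\<bar>y \<bullet> (F *\<^sub>v y)\<bar> \<le> \<eta> * (y \<bullet> y)" if "dim_vec y = n" for y
  proof -
    have "\<bar>y \<bullet> (F *\<^sub>v y)\<bar> \<le> l2norm y * l2norm (F *\<^sub>v y)" using that
      by (intro Cauchy_Schwarz_l2norm) simp
    also have "\<dots> \<le> l2norm y * (\<eta> * l2norm y)" using FB[OF that]
      by (simp add: mult_left_mono l2norm_ge_0)
    also have "\<dots> = \<eta> * (y \<bullet> y)" by (simp add: power2_eq_square flip: l2norm_sq)
    finally show ?thesis .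
  qed
  have sq: "(X\<^sup>T *\<^sub>v y) \<bullet> (X\<^sup>T *\<^sub>v y) = y \<bullet> y + y \<bullet> (F *\<^sub>v y)"
    if "dim_vec y = n" for y
    using that XXT[OF that] by (simp add: mult_mat_vec_scalar_prod scalar_prod_expand)
  have "det (X\<^sup>T) \<noteq> 0"
  proof
    assume "det (X\<^sup>T) = 0"
    then obtain y where y: "dim_vec y = n" "y \<noteq> 0\<^sub>v n" "X\<^sup>T *\<^sub>v y = 0\<^sub>v n"
      using det_0_iff_vec_prod_zero[of "X\<^sup>T" n] X by (auto dest: carrier_vecD)
    have "y \<bullet> y + y \<bullet> (F *\<^sub>v y) = 0"
      using sq[OF y(1)] unfolding y(3) by simp
    then have "y \<bullet> y \<le> \<eta> * (y \<bullet> y)" using FQ[OF y(1)] by linarith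
    moreover have "\<eta> * (y \<bullet> y) \<le> 1 / 2 * (y \<bullet> y)"
      using \<eta>(2) scalar_prod_self_ge_0 by (rule mult_right_mono)
    ultimately have "y \<bullet> y = 0" using scalar_prod_self_ge_0[of y] by linarith
    then show False using y scalar_prod_self_eq_0 by metis
  qed
  then obtain Z where Z: "Z \<in> carrier_mat n n" "X\<^sup>T * Z = 1\<^sub>m n"
    using det_non_zero_imp_unit[of "X\<^sup>T" n] X by (auto simp: Units_def ring_mat_def)
  fix x :: "real vec" assume "dim_vec x = dim_col (X\<^sup>T * X - 1\<^sub>m n)"
  then have x: "dim_vec x = n" by simp
  define y where "y = Z *\<^sub>v x"
  have y: "dim_vec y = n" using Z by (simp add: y_def)
  have xy: "x = X\<^sup>T *\<^sub>v y"
    using Z x by (simp add: y_def one_mat_vec_dim flip: mult_mat_vec_assoc_dim)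
  have "(X\<^sup>T * X - 1\<^sub>m n) *\<^sub>v x = X\<^sup>T *\<^sub>v (F *\<^sub>v y)"
    using y unfolding xy by (auto intro!: eq_vecI simp: minus_mat_vec_dim mult_mat_vec_assoc_dim XXT mat_vec_add_dim one_mat_vec_dim)
  then have "((X\<^sup>T * X - 1\<^sub>m n) *\<^sub>v x) \<bullet> ((X\<^sup>T * X - 1\<^sub>m n) *\<^sub>v x) =
      (F *\<^sub>v y) \<bullet> (F *\<^sub>v y) + (F *\<^sub>v y) \<bullet> (F *\<^sub>v (F *\<^sub>v y))"
    by (simp add: sq)
  also have "\<dots> \<le> 2 * ((F *\<^sub>v y) \<bullet> (F *\<^sub>v y))"
  proof -
    have "\<eta> * ((F *\<^sub>v y) \<bullet> (F *\<^sub>v y)) \<le> 1 * ((F *\<^sub>v y) \<bullet> (F *\<^sub>v y))"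
      using \<eta> scalar_prod_self_ge_0 by (intro mult_right_mono) auto
    then show ?thesis using FQ[of "F *\<^sub>v y"] by simp
  qed
  also have "\<dots> \<le> 2 * (\<eta>\<^sup>2 * (y \<bullet> y))"
    using norm_boundD_sq[of F \<eta> y] b \<eta> y by (simp add: F_def)
  also have "\<dots> \<le> 2 * (\<eta>\<^sup>2 * (2 * (x \<bullet> x)))"
  proof -
    have "\<eta> * (y \<bullet> y) \<le> 1 / 2 * (y \<bullet> y)"
      using \<eta>(2) scalar_prod_self_ge_0 by (rule mult_right_mono)
    then have "y \<bullet> y \<le> 2 * (x \<bullet> x)" using sq[OF y] FQ[OF y] by (simp add: xy)
    then show ?thesis by (intro mult_left_mono) auto
  qed
  finally show "((X\<^sup>T * X - 1\<^sub>m n) *\<^sub>v x) \<bullet> ((X\<^sup>T * X - 1\<^sub>m n) *\<^sub>v x) \<le> (2 * \<eta>)\<^sup>2 * (x \<bullet> x)"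
    by (simp add: power_mult_distrib)
qed (use \<eta> in simp)

lemma norm_bound_of_gram:
  assumes "norm_bound (X\<^sup>T * X - 1\<^sub>m (dim_col X)) \<eta>" "0 \<le> \<eta>" 
  shows "norm_bound X (sqrt (1 + \<eta>))"
proof (rule norm_boundI_sq)
  fix x :: "real vec" assume x: "dim_vec x = dim_col X"
  let ?F = "X\<^sup>T * X - 1\<^sub>m (dim_col X)"
  have "X\<^sup>T *\<^sub>v (X *\<^sub>v x) = x + ?F *\<^sub>v x"
    using x by (auto intro!: eq_vecI simp: mat_vec_expand)
  then have "(X *\<^sub>v x) \<bullet> (X *\<^sub>v x) = x \<bullet> x + x \<bullet> (?F *\<^sub>v x)"
    using x by (simp add: mult_mat_vec_scalar_prod scalar_prod_add_right)
  also have "x \<bullet> (?F *\<^sub>v x) \<le> l2norm x * l2norm (?F *\<^sub>v x)"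
    using x by (intro scalar_prod_le_l2norm) simp
  also have "\<dots> \<le> l2norm x * (\<eta> * l2norm x)"
    using x assms by (intro mult_left_mono norm_boundD) (auto simp: l2norm_ge_0)
  also have "\<dots> = \<eta> * (x \<bullet> x)" by (simp add: power2_eq_square flip: l2norm_sq)
  finally show "(X *\<^sub>v x) \<bullet> (X *\<^sub>v x) \<le> (sqrt (1 + \<eta>))\<^sup>2 * (x \<bullet> x)"
    using assms by (simp add: algebra_simps)
qed (use assms in simp)

text \<open>The norm is attained at a top eigenvector of the Gram matrix, so the bound need only be
  checked at unit vectors that satisfy the singular vector equation, which is then available for the
  check.\<close>

lemma norm_bound_singular_vector:
  fixes G :: "real mat"
  assumes m: "0 < dim_col G" and g: "0 \<le> g"
    and top: "\<And>z. dim_vec z = dim_col G \<Longrightarrow> z \<bullet> z = 1 \<Longrightarrow>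
      G\<^sup>T *\<^sub>v (G *\<^sub>v z) = ((G *\<^sub>v z) \<bullet> (G *\<^sub>v z)) \<cdot>\<^sub>v z \<Longrightarrow> l2norm (G *\<^sub>v z) \<le> g"
  shows "norm_bound G g"
proof (rule norm_boundI_sq[OF g])
  let ?S = "G\<^sup>T * G" and ?m = "dim_col G"
  have S: "?S \<in> carrier_mat ?m ?m" "?S\<^sup>T = ?S" by (auto intro: carrier_matI simp: transpose_mult_dim)
  obtain Q where Q: "Q \<in> carrier_mat ?m ?m" "orthonormal_cols Q"
    "\<forall>j<?m. ?S *\<^sub>v col Q j = eigvals ?S ! j \<cdot>\<^sub>v col Q j"
      using symmetric_spectral(3)[OF S] by blast
  note [simp] = carrier_matD[OF Q(1)]
  define z where "z = col Q 0"
  have z: "dim_vec z = ?m" "z \<bullet> z = 1"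
    using m orthonormal_cols_scalar_prod[OF Q(2), of 0 0] by (auto simp: z_def)
  have Sz: "G\<^sup>T *\<^sub>v (G *\<^sub>v z) = eigvals ?S ! 0 \<cdot>\<^sub>v z"
    using Q(3) m z by (simp add: z_def mult_mat_vec_assoc_dim)
  then have l: "(G *\<^sub>v z) \<bullet> (G *\<^sub>v z) = eigvals ?S ! 0"
    using z by (simp add: mult_mat_vec_scalar_prod)
  have "l2norm (G *\<^sub>v z) \<le> g" using top z Sz l by simp
  then have le: "eigvals ?S ! 0 \<le> g\<^sup>2" using g by (simp add: l2norm_le_iff l)
  fix x :: "real vec" assume x: "dim_vec x = ?m"
  have "(G *\<^sub>v x) \<bullet> (G *\<^sub>v x) = x \<bullet> (?S *\<^sub>v x)"
    using x by (simp add: mult_mat_vec_scalar_prod mult_mat_vec_assoc_dim)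
  also have "\<dots> \<le> eigvals ?S ! 0 * (x \<bullet> x)" using quadratic_form_le_top_eigval[OF S x] .
  also have "\<dots> \<le> g\<^sup>2 * (x \<bullet> x)" using le scalar_prod_self_ge_0 by (rule mult_right_mono)
  finally show "(G *\<^sub>v x) \<bullet> (G *\<^sub>v x) \<le> g\<^sup>2 * (x \<bullet> x)" .
qed

lemma top_eigenvectorsD:
  assumes "top_eigenvectors m H Y" "H \<in> carrier_mat n n"
  shows "Y \<in> carrier_mat n m" "orthonormal_cols Y"
    "\<And>j. j < m \<Longrightarrow> H *\<^sub>v col Y j = eigvals H ! j \<cdot>\<^sub>v col Y j"
  using assms by (auto simp: top_eigenvectors_def eigenvector_def)

text \<open>
  The Davis--Kahan argument: along the top singular vector of the component of \<open>K\<close> orthogonal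
  to the eigenspace, the Sylvester equation for that component becomes a scalar inequality.
\<close>

lemma top_eigenvectors_perturbation:
  fixes H Y K L :: "real mat"
  assumes H: "H \<in> carrier_mat n n" "H\<^sup>T = H" and Y: "top_eigenvectors m H Y"
    and m: "1 \<le> m" "m \<le> n" and K: "K \<in> carrier_mat n m" and L: "L \<in> carrier_mat m m"
    and gram: "norm_bound (K\<^sup>T * K - 1\<^sub>m m) \<eta>" "0 \<le> \<eta>" "\<eta> \<le> 1 / 4"
    and lower: "\<And>z. dim_vec z = m \<Longrightarrow> w * (z \<bullet> z) \<le> z \<bullet> (L *\<^sub>v z)"
    and upper: "\<And>x. dim_vec x = n \<Longrightarrow> K\<^sup>T *\<^sub>v x = 0\<^sub>v m \<Longrightarrow> x \<bullet> (H *\<^sub>v x) \<le> \<mu> * (x \<bullet> x)"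
    and gap: "\<mu> < w"
    and residual: "norm_bound (H * K - K * L) r" "0 \<le> r"
    and small: "r / (w - \<mu>) \<le> 1 / 2"
  shows "norm_bound (Y * Y\<^sup>T - K * K\<^sup>T) (2 * \<eta> + 5 * (r / (w - \<mu>)))"
proof -
  note Yd = top_eigenvectorsD[OF Y H(1)]
  note [simp] = carrier_matD[OF H(1)] carrier_matD[OF Yd(1)] carrier_matD[OF K] carrier_matD[OF L]
  let ?D = "mat_diag m (\<lambda>j. eigvals H ! j)"
  have HY: "H * Y = Y * ?D" using eigenvector_cols_mult[of H Y "\<lambda>j. eigvals H ! j"] Yd(3) by simp
  define g where "g = r / (w - \<mu>)"
  have g: "0 \<le> g" "g \<le> 1 / 2" using gap residual small by (auto simp: g_def)
  define G where "G = K - Y * (Y\<^sup>T * K)"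
  have G [simp]: "dim_row G = n" "dim_col G = m" by (auto simp: G_def)
  have Gv: "G *\<^sub>v z = K *\<^sub>v z - Y *\<^sub>v (Y\<^sup>T *\<^sub>v (K *\<^sub>v z))"
    if "dim_vec z = m" for z
    using that by (simp add: G_def mat_vec_expand)
  have YG: "Y\<^sup>T *\<^sub>v (G *\<^sub>v z) = 0\<^sub>v m" if "dim_vec z = m" for z
    using that by (auto intro!: eq_vecI simp: Gv mat_vec_expand orthonormal_cols_isometry[OF Yd(2)])
  have Gperp: "(G *\<^sub>v z) \<bullet> (Y *\<^sub>v t) = 0" if "dim_vec z = m" "dim_vec t = m" for z t
    using that YG[OF that(1)] mult_mat_vec_scalar_prod[of "G *\<^sub>v z" "Y\<^sup>T" t]
    by (simp add: scalar_prod_def)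
  have GB: "norm_bound G g"
  proof (rule norm_bound_singular_vector)
    fix z :: "real vec" assume z: "dim_vec z = dim_col G" "z \<bullet> z = 1"
      "G\<^sup>T *\<^sub>v (G *\<^sub>v z) = ((G *\<^sub>v z) \<bullet> (G *\<^sub>v z)) \<cdot>\<^sub>v z"
    then have zm [simp]: "dim_vec z = m" by simp
    define b where "b = G *\<^sub>v z"
    have b [simp]: "dim_vec b = n" by (simp add: b_def)
    have "b \<bullet> (H *\<^sub>v b) \<le> \<mu> * (b \<bullet> b)"
    proof (rule quadratic_form_orthogonal_eigenvectors[OF H Yd m(2) K])
      show "Y\<^sup>T *\<^sub>v b = 0\<^sub>v m" unfolding b_def using YG zm by blast
    qed (use upper in auto)
    \<comment> \<open>\<open>K z\<close> differs from \<open>b\<close> by a vector in the span of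
      \<open>Y\<close>, which \<open>H\<close> preserves and to which \<open>b\<close> is
      orthogonal.\<close>
    moreover have "b \<bullet> (H *\<^sub>v b) = b \<bullet> (H *\<^sub>v (K *\<^sub>v z))"
    proof -
      let ?t = "Y\<^sup>T *\<^sub>v (K *\<^sub>v z)"
      have "H *\<^sub>v (Y *\<^sub>v ?t) = Y *\<^sub>v (?D *\<^sub>v ?t)"
        using arg_cong[OF HY, of "\<lambda>X. X *\<^sub>v ?t"] by (simp add: mult_mat_vec_assoc_dim)
      then have "H *\<^sub>v b = H *\<^sub>v (K *\<^sub>v z) - Y *\<^sub>v (?D *\<^sub>v ?t)"
        by (simp add: b_def Gv mat_vec_minus_dim)
      then show ?thesis using Gperp[of z "?D *\<^sub>v ?t"] by (simp add: scalar_prod_expand flip: b_def)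
    qed
    \<comment> \<open>Here the choice of \<open>z\<close> matters: \<open>b\<close> sees only the
      \<open>G\<close> part of \<open>K\<close>, and the singular vector equation turns G^T b into a
      multiple of \<open>z\<close>, leaving the form of \<open>L\<close> at
      \<open>z\<close>.\<close>
    moreover have "b \<bullet> (K *\<^sub>v (L *\<^sub>v z)) = (b \<bullet> b) * (z \<bullet> (L *\<^sub>v z))"
    proof -
      define k where "k = K *\<^sub>v (L *\<^sub>v z)"
      have k [simp]: "dim_vec k = n" by (simp add: k_def)
      have "k = G *\<^sub>v (L *\<^sub>v z) + Y *\<^sub>v (Y\<^sup>T *\<^sub>v k)"
        by (auto intro!: eq_vecI simp: Gv k_def)
      then have "b \<bullet> k = b \<bullet> (G *\<^sub>v (L *\<^sub>v z) + Y *\<^sub>v (Y\<^sup>T *\<^sub>v k))" by simp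
      also have "\<dots> = b \<bullet> (G *\<^sub>v (L *\<^sub>v z))"
        using Gperp[of z "Y\<^sup>T *\<^sub>v k"] by (simp add: scalar_prod_expand flip: b_def)
      also have "\<dots> = (G\<^sup>T *\<^sub>v b) \<bullet> (L *\<^sub>v z)"
        by (simp add: mult_mat_vec_scalar_prod)
      finally show ?thesis using z(3) by (simp add: b_def k_def)
    qed
    moreover have "w * (b \<bullet> b) \<le> (b \<bullet> b) * (z \<bullet> (L *\<^sub>v z))"
      using mult_left_mono[OF lower[OF zm] scalar_prod_self_ge_0[of b]] z(2) by (simp add: mult.commute)
    moreover have "- (l2norm b * r) \<le> b \<bullet> (H *\<^sub>v (K *\<^sub>v z)) - b \<bullet> (K *\<^sub>v (L *\<^sub>v z))"
    proof -
      have "\<bar>b \<bullet> ((H * K - K * L) *\<^sub>v z)\<bar> \<le> l2norm b * l2norm ((H * K - K * L) *\<^sub>v z)"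
        by (intro Cauchy_Schwarz_l2norm) simp
      also have "\<dots> \<le> l2norm b * (r * l2norm z)"
        by (intro mult_left_mono norm_boundD residual) (auto simp: l2norm_ge_0)
      finally have "\<bar>b \<bullet> ((H * K - K * L) *\<^sub>v z)\<bar> \<le> l2norm b * r" using z(2)
        by (simp add: l2norm_def)
      then show ?thesis by (simp add: mat_vec_expand scalar_prod_expand)
    qed
    ultimately have "w * (b \<bullet> b) - l2norm b * r \<le> \<mu> * (b \<bullet> b)" by linarith
    then have "(w - \<mu>) * l2norm b * l2norm b \<le> r * l2norm b"
      by (simp add: power2_eq_square algebra_simps flip: l2norm_sq)
    then have "l2norm b = 0 \<or> (w - \<mu>) * l2norm b \<le> r"
      using l2norm_ge_0[of b] by (cases "l2norm b = 0") (auto intro: mult_right_le_imp_le)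
    then show "l2norm (G *\<^sub>v z) \<le> g"
      using g(1) gap by (auto simp: g_def field_simps simp flip: b_def)
  qed (use m g in auto)
  have KB: "norm_bound K 2"
  proof -
    have "sqrt (1 + \<eta>) \<le> 2" using gram(2,3) by (intro real_le_lsqrt) auto
    then show ?thesis using norm_bound_of_gram[of K \<eta>] gram by (auto intro: norm_bound_mono)
  qed
  \<comment> \<open>In K = Y P + G the square matrix \<open>P\<close> is nearly orthogonal, since
    \<open>G\<close> is small and orthogonal to \<open>Y\<close>.\<close>
  define P where "P = Y\<^sup>T * K"
  have P [simp]: "dim_row P = m" "dim_col P = m" by (auto simp: P_def)
  have YB: "norm_bound Y 1" "norm_bound (Y\<^sup>T) 1"
    using norm_bound_orthonormal[OF Yd(2)] by (auto intro: norm_bound_transpose)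
  have PB: "norm_bound P 2" using norm_bound_mult[OF YB(2) KB] by (simp add: P_def)
  have Kv: "K *\<^sub>v z = Y *\<^sub>v (P *\<^sub>v z) + G *\<^sub>v z" if "dim_vec z = m" for z
    using that by (auto intro!: eq_vecI simp: Gv P_def mat_vec_expand)
  have KTv: "K\<^sup>T *\<^sub>v x = P\<^sup>T *\<^sub>v (Y\<^sup>T *\<^sub>v x) + G\<^sup>T *\<^sub>v x"
    if "dim_vec x = n" for x
  proof -
    have "K = Y * P + G" by (auto intro!: eq_matI simp: G_def P_def)
    moreover have "(Y * P + G)\<^sup>T = (Y * P)\<^sup>T + G\<^sup>T"
      by (rule transpose_add[of _ n m]) (auto intro: carrier_matI)
    ultimately have "K\<^sup>T = P\<^sup>T * Y\<^sup>T + G\<^sup>T" by (simp add: transpose_mult_dim)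
    then show ?thesis using that by (simp add: mat_vec_expand)
  qed
  have gramP: "norm_bound (P\<^sup>T * P - 1\<^sub>m m) (\<eta> + g\<^sup>2)"
  proof -
    have "norm_bound ((K\<^sup>T * K - 1\<^sub>m m) - G\<^sup>T * G) (\<eta> + g * g)"
      using gram GB g by (intro norm_bound_minus norm_bound_mult norm_bound_transpose) auto
    moreover have "(K\<^sup>T * K - 1\<^sub>m m) *\<^sub>v z - (G\<^sup>T * G) *\<^sub>v z = (P\<^sup>T * P - 1\<^sub>m m) *\<^sub>v z" if z: "dim_vec z = m"
      for z
    proof -
      have "G\<^sup>T *\<^sub>v (Y *\<^sub>v t) = 0\<^sub>v m" if t: "dim_vec t = m" for t
      proof -
        let ?u = "G\<^sup>T *\<^sub>v (Y *\<^sub>v t)"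
        have "?u \<bullet> ?u = (G *\<^sub>v ?u) \<bullet> (Y *\<^sub>v t)" by (simp add: mult_mat_vec_scalar_prod)
        then have "?u \<bullet> ?u = 0" using t by (simp add: Gperp)
        then show ?thesis by (simp add: scalar_prod_self_eq_0)
      qed
      then have "K\<^sup>T *\<^sub>v (K *\<^sub>v z) = P\<^sup>T *\<^sub>v (P *\<^sub>v z) + G\<^sup>T *\<^sub>v (G *\<^sub>v z)"
        using z by (auto intro!: eq_vecI simp: KTv Kv mat_vec_add_dim orthonormal_cols_isometry[OF Yd(2)] YG mult_mat_vec_zero[of "P\<^sup>T", simplified])
      then show ?thesis using z by (auto intro!: eq_vecI simp: mat_vec_expand)
    qed
    ultimately show ?thesis
      by (simp add: norm_bound_def minus_mat_vec_dim power2_eq_square)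
  qed
  \<comment> \<open>With \<eta> \<le> 1/4 and g \<le> 1/2 this yields \<eta> + g^2 \<le> 1/2, as
    \<open>norm_bound_gram_swap\<close> demands; it also absorbs 2 g^2 into the final 5 g.\<close>
  have gg: "g\<^sup>2 \<le> g / 2" using mult_left_mono[OF g(2) g(1)] by (simp add: power2_eq_square)
  have swap: "norm_bound (1\<^sub>m m - P * P\<^sup>T) (2 * (\<eta> + g\<^sup>2))"
  proof -
    have "norm_bound (P * P\<^sup>T - 1\<^sub>m m) (2 * (\<eta> + g\<^sup>2))"
      using norm_bound_gram_swap[of "P\<^sup>T" m "\<eta> + g\<^sup>2"] gramP gram g gg by (simp add: carrier_matI)
    from norm_bound_smult[OF this, of "-1"]
    have "norm_bound (- 1 \<cdot>\<^sub>m (P * P\<^sup>T - 1\<^sub>m m)) (2 * (\<eta> + g\<^sup>2))" by simp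
    moreover have "- 1 \<cdot>\<^sub>m (P * P\<^sup>T - 1\<^sub>m m) = 1\<^sub>m m - P * P\<^sup>T"
      by (auto intro!: eq_matI)
    ultimately show ?thesis by simp
  qed
  \<comment> \<open>Inserting K = Y P + G into K K^T, first on the left and then on the right of the
    \<open>Y P\<close> term, leaves exactly these three errors.\<close>
  have "norm_bound (Y * ((1\<^sub>m m - P * P\<^sup>T) * Y\<^sup>T) - Y * (P * G\<^sup>T) - G * K\<^sup>T)
      (1 * ((2 * (\<eta> + g\<^sup>2)) * 1) + 1 * (2 * g) + g * 2)"
    using YB swap PB GB KB g gram
    by (intro norm_bound_minus norm_bound_mult norm_bound_transpose) auto
  moreover have "(Y * ((1\<^sub>m m - P * P\<^sup>T) * Y\<^sup>T) - Y * (P * G\<^sup>T) - G * K\<^sup>T) *\<^sub>v x = (Y * Y\<^sup>T - K * K\<^sup>T) *\<^sub>v x"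
    if "dim_vec x = n" for x
    using that by (auto intro!: eq_vecI simp: mat_vec_expand KTv Kv)
  ultimately have "norm_bound (Y * Y\<^sup>T - K * K\<^sup>T) (1 * ((2 * (\<eta> + g\<^sup>2)) * 1) + 1 * (2 * g) + g * 2)"
    by (simp add: norm_bound_def)
  then show ?thesis by (rule norm_bound_mono) (use gg in \<open>simp flip: g_def\<close>)
qed

section \<open>The unperturbed matrices\<close>

text \<open>Column j of a matrix made of blocks of width \<open>m\<close> is column j mod m of block
  j div m; the products of \<open>W\<close> and \<open>E\<close> are evaluated through this
  regrouping.\<close>

lemma sum_div_mod:
  "(\<Sum>j<m * k. f (j div m) (j mod m)) = (\<Sum>i<k. \<Sum>l<m. f i l :: real)" for m k :: nat
proof (cases "m = 0")
  case False
  have "(\<Sum>j<m * k. f (j div m) (j mod m)) = (\<Sum>i<k. \<Sum>j\<in>{i * m..<i * m + m}. f (j div m) (j mod m))"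
    by (simp add: sum.nat_group mult.commute)
  also have "\<dots> = (\<Sum>i<k. \<Sum>l<m. f i l)"
  proof (rule sum.cong[OF refl])
    fix i
    have "(\<Sum>j\<in>{i * m..<i * m + m}. f (j div m) (j mod m)) = (\<Sum>l\<in>{0..<m}. f ((l + i * m) div m) ((l + i * m) mod m))"
      using sum.shift_bounds_nat_ivl[of "\<lambda>j. f (j div m) (j mod m)" 0 "i * m" m] by (simp add: add.commute)
    also have "\<dots> = (\<Sum>l<m. f i l)"
      using False by (intro sum.cong) (auto simp: atLeast0LessThan)
    finally show "(\<Sum>j\<in>{i * m..<i * m + m}. f (j div m) (j mod m)) = (\<Sum>l<m. f i l)" .
  qed
  finally show ?thesis .
qed simp

lemma mult_transpose_index:
  "p < dim_row X \<Longrightarrow> q < dim_row X \<Longrightarrow> (X * X\<^sup>T) $$ (p, q) = (\<Sum>i<dim_col X. X $$ (p, i) * X $$ (q, i))"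
  by (simp add: scalar_prod_def atLeast0LessThan)

text \<open>For symmetric P the product P v v^T P is the outer square of P v. This matches the
  rank-one terms of \<open>B_mat\<close> with the columns of \<open>W * E\<close>.\<close>

lemma sandwich_outer_index:
  assumes "P \<in> carrier_mat d d" "P\<^sup>T = P" "dim_vec v = d" "p < d" "q < d"
  shows "(P * outer v v * P) $$ (p, q) = (P *\<^sub>v v) $ p * (P *\<^sub>v v) $ q"
proof -
  note [simp] = carrier_matD[OF assms(1)] assms(3-5)
  have Pq: "P $$ (r, q) = P $$ (q, r)" if "r < d" for r
    using that arg_cong[OF assms(2), of "\<lambda>X. X $$ (q, r)"] by simp
  have "(P * outer v v) $$ (p, r) = (P *\<^sub>v v) $ p * v $ r" if "r < d" for r
    using that by (simp add: outer_def scalar_prod_def sum_distrib_right mult.assoc)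
  then have "(P * outer v v * P) $$ (p, q) = (\<Sum>r<d. (P *\<^sub>v v) $ p * v $ r * P $$ (r, q))"
    by (simp add: scalar_prod_def[of "row _ _" "col _ _"] atLeast0LessThan outer_def)
  also have "\<dots> = (P *\<^sub>v v) $ p * (\<Sum>r<d. P $$ (q, r) * v $ r)"
    unfolding sum_distrib_left by (rule sum.cong) (auto simp: Pq mult_ac)
  also have "(\<Sum>r<d. P $$ (q, r) * v $ r) = (P *\<^sub>v v) $ q"
    by (simp add: scalar_prod_def atLeast0LessThan)
  finally show ?thesis .
qed

locale subspace_mixture =
  fixes d m k :: nat and U :: "nat \<Rightarrow> real mat" and \<alpha> :: "nat \<Rightarrow> real" and v :: "real vec" 
  assumes m: "1 \<le> m" and k: "1 \<le> k"
    and U: "\<And>i. i \<in> {1..k} \<Longrightarrow> U i \<in> carrier_mat d m \<and> orthonormal_cols (U i)"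
    and \<alpha>: "\<And>i. i \<in> {1..k} \<Longrightarrow> 0 < \<alpha> i"
    and v: "v \<in> carrier_vec d"
begin

abbreviation "n \<equiv> m * k"

definition wt :: "nat \<Rightarrow> real" where
  "wt i = (l2norm ((U i)\<^sup>T *\<^sub>v v))\<^sup>2"

text \<open>
  The index \<open>i * m + l\<close> below \<open>n\<close> stands for column \<open>l\<close> of \<open>U (Suc i)\<close>.  The matrix \<open>E E\<^sup>T\<close> is
  block diagonal with the blocks \<open>U\<^sub>i\<^sup>T v v\<^sup>T U\<^sub>i\<close>.
\<close>

definition W :: "real mat" where
  "W = mat d n (\<lambda>(p, j). sqrt (\<alpha> (Suc (j div m))) * U (Suc (j div m)) $$ (p, j mod m))"

definition E :: "real mat" where
  "E = mat n k (\<lambda>(j, i). if j div m = i then col (U (Suc i)) (j mod m) \<bullet> v else 0)"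

definition Lam :: "real mat" where
  "Lam = mat_diag n (\<lambda>j. wt (Suc (j div m)))"

definition M :: "real mat" where
  "M = Lam + 2 \<cdot>\<^sub>m (E * E\<^sup>T)"

text \<open>Inclusion of the first block: multiplication by \<open>J\<close> on the right keeps the
  columns that belong to \<open>U 1\<close>.\<close>

definition J :: "real mat" where
  "J = first_cols m (1\<^sub>m n)"

lemma dims [simp]: "dim_row W = d" "dim_col W = n" "dim_row E = n" "dim_col E = k"
  "dim_row Lam = n" "dim_col Lam = n" "dim_row M = n" "dim_col M = n" "dim_row J = n" "dim_col J = m" "dim_vec v = d"
  using v by (simp_all add: W_def E_def Lam_def M_def J_def)

lemma U_dims [simp]: "i < k \<Longrightarrow> dim_row (U (Suc i)) = d" "i < k \<Longrightarrow> dim_col (U (Suc i)) = m"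
  using U[of "Suc i"] by auto

lemma U1: "U 1 \<in> carrier_mat d m" "orthonormal_cols (U 1)" "0 < \<alpha> 1"
  using U[of 1] \<alpha>[of 1] k by auto

lemma m_le_n: "m \<le> n" using k by simp

lemma less_n [simp]: "l < m \<Longrightarrow> l < n" using m_le_n by linarith

lemma div_less_k [simp]: "j < n \<Longrightarrow> j div m < k"
  using m by (simp add: div_less_iff_less_mult mult.commute)

lemma mod_less_m [simp]: "j mod m < m"
  using m by simp

lemma wt_Suc: "i < k \<Longrightarrow> wt (Suc i) = (\<Sum>l<m. (col (U (Suc i)) l \<bullet> v)\<^sup>2)"
  unfolding wt_def l2norm_sq
  by (simp add: scalar_prod_def[of "(U (Suc i))\<^sup>T *\<^sub>v v"] power2_eq_square atLeast0LessThan)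

lemma sqrt_\<alpha>_mult: "i < k \<Longrightarrow> (sqrt (\<alpha> (Suc i)) * x) * (sqrt (\<alpha> (Suc i)) * y) = \<alpha> (Suc i) * (x * y)"
proof -
  assume "i < k"
  then have "sqrt (\<alpha> (Suc i)) * sqrt (\<alpha> (Suc i)) = \<alpha> (Suc i)"
    using \<alpha>[of "Suc i"] by simp
  moreover have "(sqrt (\<alpha> (Suc i)) * x) * (sqrt (\<alpha> (Suc i)) * y) =
      (sqrt (\<alpha> (Suc i)) * sqrt (\<alpha> (Suc i))) * (x * y)" by (simp only: mult_ac)
  ultimately show ?thesis by simp
qed

lemma W_index: "p < d \<Longrightarrow> j < n \<Longrightarrow> W $$ (p, j) = sqrt (\<alpha> (Suc (j div m))) * U (Suc (j div m)) $$ (p, j mod m)"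
  by (simp add: W_def)

lemma W_index_mult: "p < d \<Longrightarrow> q < d \<Longrightarrow> j < n \<Longrightarrow> W $$ (p, j) * W $$ (q, j) =
    \<alpha> (Suc (j div m)) * (U (Suc (j div m)) $$ (p, j mod m) * U (Suc (j div m)) $$ (q, j mod m))"
  unfolding W_index by (rule sqrt_\<alpha>_mult) simp

lemma A_eq: "A_mat d k \<alpha> U = W * W\<^sup>T"
proof (rule eq_matI)
  fix p q assume "p < dim_row (W * W\<^sup>T)" "q < dim_col (W * W\<^sup>T)"
  then have pq [simp]: "p < d" "q < d" by auto
  have "(W * W\<^sup>T) $$ (p, q) = (\<Sum>j<n. W $$ (p, j) * W $$ (q, j))"
    by (simp add: scalar_prod_def atLeast0LessThan)
  also have "\<dots> = (\<Sum>j<n. (\<lambda>i l. \<alpha> (Suc i) * (U (Suc i) $$ (p, l) * U (Suc i) $$ (q, l))) (j div m) (j mod m))"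
    by (rule sum.cong[OF refl]) (simp add: W_index_mult)
  also have "\<dots> = (\<Sum>i<k. \<Sum>l<m. \<alpha> (Suc i) * (U (Suc i) $$ (p, l) * U (Suc i) $$ (q, l)))"
    by (rule sum_div_mod)
  also have "\<dots> = A_mat d k \<alpha> U $$ (p, q)"
    by (simp add: A_mat_def sum_mats_def sum.atLeast1_atMost_eq proj_def scalar_prod_def
        atLeast0LessThan sum_distrib_left)
  finally show "A_mat d k \<alpha> U $$ (p, q) = (W * W\<^sup>T) $$ (p, q)" by simp
qed (auto simp: A_mat_def sum_mats_def)

lemma WE_index:
  assumes "p < d" "i < k"
  shows "(W * E) $$ (p, i) = sqrt (\<alpha> (Suc i)) * (proj (U (Suc i)) *\<^sub>v v) $ p"
proof -
  have "(W * E) $$ (p, i) = (\<Sum>j<n. W $$ (p, j) * E $$ (j, i))"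
    using assms by (simp add: scalar_prod_def atLeast0LessThan)
  also have "\<dots> = (\<Sum>j<n. (\<lambda>i' l. if i' = i then sqrt (\<alpha> (Suc i)) * (U (Suc i) $$ (p, l) * (col (U (Suc i)) l \<bullet> v)) else 0) (j div m) (j mod m))"
    using assms by (intro sum.cong[OF refl]) (auto simp: W_def E_def)
  also have "\<dots> = (\<Sum>i'<k. \<Sum>l<m. if i' = i then sqrt (\<alpha> (Suc i)) * (U (Suc i) $$ (p, l) * (col (U (Suc i)) l \<bullet> v)) else 0)"
    by (rule sum_div_mod)
  also have "\<dots> = (\<Sum>i'<k. if i' = i then \<Sum>l<m. sqrt (\<alpha> (Suc i)) * (U (Suc i) $$ (p, l) * (col (U (Suc i)) l \<bullet> v)) else 0)"
    by (rule sum.cong) auto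
  also have "\<dots> = (\<Sum>l<m. sqrt (\<alpha> (Suc i)) * (U (Suc i) $$ (p, l) * (col (U (Suc i)) l \<bullet> v)))"
    using assms by simp
  also have "\<dots> = sqrt (\<alpha> (Suc i)) * (proj (U (Suc i)) *\<^sub>v v) $ p"
  proof -
    have "(proj (U (Suc i)) *\<^sub>v v) = U (Suc i) *\<^sub>v ((U (Suc i))\<^sup>T *\<^sub>v v)"
      using assms by (simp add: proj_def mult_mat_vec_assoc_dim)
    then show ?thesis
      using assms by (simp add: scalar_prod_def[of "row _ _"] sum_distrib_left atLeast0LessThan)
  qed
  finally show ?thesis .
qed

text \<open>\<open>Lam\<close> produces the first sum of \<open>B_mat\<close>. \<open>E\<close>
  produces the second, since column \<open>i\<close> of \<open>W * E\<close> is a multiple of the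
  projection of \<open>v\<close> onto the range of \<open>U (Suc i)\<close>.\<close>

lemma B_eq: "B_mat d k \<alpha> U v = W * M * W\<^sup>T"
proof -
  have 1: "W * M * W\<^sup>T = W * Lam * W\<^sup>T + 2 \<cdot>\<^sub>m ((W * E) * (W * E)\<^sup>T)"
  proof -
    have "W * M = W * Lam + W * (2 \<cdot>\<^sub>m (E * E\<^sup>T))"
      unfolding M_def by (rule mult_add_distrib_mat[of _ d n _ n]) (auto intro: carrier_matI)
    also have "W * (2 \<cdot>\<^sub>m (E * E\<^sup>T)) = 2 \<cdot>\<^sub>m (W * (E * E\<^sup>T))"
      by (rule mult_smult_distrib[of _ d n _ n]) (auto intro: carrier_matI)
    finally have "W * M * W\<^sup>T = W * Lam * W\<^sup>T + (2 \<cdot>\<^sub>m (W * (E * E\<^sup>T))) * W\<^sup>T"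
      by (simp add: add_mult_distrib_mat[of _ d n _ _ d] carrier_matI)
    also have "(2 \<cdot>\<^sub>m (W * (E * E\<^sup>T))) * W\<^sup>T = 2 \<cdot>\<^sub>m (W * (E * E\<^sup>T) * W\<^sup>T)"
      by (rule mult_smult_assoc_mat[of _ d n _ d]) (auto intro: carrier_matI)
    also have "W * (E * E\<^sup>T) * W\<^sup>T = (W * E) * (W * E)\<^sup>T"
      by (simp add: transpose_mult_dim mult_mat_assoc_dim)
    finally show ?thesis .
  qed
  have 2: "(W * Lam * W\<^sup>T) $$ (p, q) = (\<Sum>i<k. \<alpha> (Suc i) * wt (Suc i) * (proj (U (Suc i)) $$ (p, q)))"
    if pq [simp]: "p < d" "q < d" for p q
  proof -
    have "W * Lam = mat d n (\<lambda>(p, j). W $$ (p, j) * wt (Suc (j div m)))"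
      unfolding Lam_def by (rule mat_diag_mult_right) (auto intro: carrier_matI)
    then have "(W * Lam * W\<^sup>T) $$ (p, q) = (\<Sum>j<n. wt (Suc (j div m)) * (W $$ (p, j) * W $$ (q, j)))"
      by (simp add: scalar_prod_def atLeast0LessThan mult_ac)
    also have "\<dots> = (\<Sum>j<n. (\<lambda>i l. \<alpha> (Suc i) * wt (Suc i) * (U (Suc i) $$ (p, l) * U (Suc i) $$ (q, l))) (j div m) (j mod m))"
      by (rule sum.cong[OF refl]) (simp add: W_index_mult)
    also have "\<dots> = (\<Sum>i<k. \<Sum>l<m. \<alpha> (Suc i) * wt (Suc i) * (U (Suc i) $$ (p, l) * U (Suc i) $$ (q, l)))"
      by (rule sum_div_mod)
    finally show ?thesis
      by (simp add: proj_def scalar_prod_def atLeast0LessThan sum_distrib_left)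
  qed
  have 3: "((W * E) * (W * E)\<^sup>T) $$ (p, q) = (\<Sum>i<k. \<alpha> (Suc i) * (proj (U (Suc i)) * outer v v * proj (U (Suc i))) $$ (p, q))"
    if pq [simp]: "p < d" "q < d" for p q
  proof -
    have "((W * E) * (W * E)\<^sup>T) $$ (p, q) = (\<Sum>i<k. (W * E) $$ (p, i) * (W * E) $$ (q, i))"
      by (simp add: mult_transpose_index del: index_mult_mat(1))
    also have "\<dots> = (\<Sum>i<k. \<alpha> (Suc i) * (proj (U (Suc i)) * outer v v * proj (U (Suc i))) $$ (p, q))"
    proof (rule sum.cong[OF refl])
      fix i assume "i \<in> {..<k}"
      then have i: "i < k" by simp
      have P: "proj (U (Suc i)) \<in> carrier_mat d d" "(proj (U (Suc i)))\<^sup>T = proj (U (Suc i))"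
        using i by (auto simp: proj_def transpose_mult_dim intro: carrier_matI)
      show "(W * E) $$ (p, i) * (W * E) $$ (q, i) = \<alpha> (Suc i) * (proj (U (Suc i)) * outer v v * proj (U (Suc i))) $$ (p, q)"
        unfolding sandwich_outer_index[OF P dims(11) pq] WE_index[OF pq(1) i] WE_index[OF pq(2) i]
        by (rule sqrt_\<alpha>_mult[OF i])
    qed
    finally show ?thesis .
  qed
  show ?thesis unfolding 1
  proof (rule eq_matI)
    fix p q assume "p < dim_row (W * Lam * W\<^sup>T + 2 \<cdot>\<^sub>m ((W * E) * (W * E)\<^sup>T))"
      "q < dim_col (W * Lam * W\<^sup>T + 2 \<cdot>\<^sub>m ((W * E) * (W * E)\<^sup>T))"
    then have pq: "p < d" "q < d" by auto
    have a: "(W * Lam * W\<^sup>T + 2 \<cdot>\<^sub>m ((W * E) * (W * E)\<^sup>T)) $$ (p, q) =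
      (W * Lam * W\<^sup>T) $$ (p, q) + 2 * ((W * E) * (W * E)\<^sup>T) $$ (p, q)"
      using pq by (subst index_add_mat) (auto simp del: index_mult_mat(1))
    have b: "B_mat d k \<alpha> U v $$ (p, q) = 
      (\<Sum>i<k. \<alpha> (Suc i) * wt (Suc i) * (proj (U (Suc i)) $$ (p, q)))
      + 2 * (\<Sum>i<k. \<alpha> (Suc i) * (proj (U (Suc i)) * outer v v * proj (U (Suc i))) $$ (p, q))"
    proof -
      have d: "dim_row (proj (U (Suc i))) = d" "dim_col (proj (U (Suc i))) = d" if "i < k" for i
        using that by (simp_all add: proj_def)
      show ?thesis unfolding B_mat_def sum_mats_def wt_def using pq d
        by (simp add: sum.atLeast1_atMost_eq del: index_mult_mat(1))
    qed
    show "B_mat d k \<alpha> U v $$ (p, q) = (W * Lam * W\<^sup>T + 2 \<cdot>\<^sub>m ((W * E) * (W * E)\<^sup>T)) $$ (p, q)"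
      unfolding a b 2[OF pq] 3[OF pq] ..
  qed (auto simp: B_mat_def sum_mats_def)
qed

text \<open>The columns of \<open>E\<close> are supported on disjoint blocks, and column
  \<open>i\<close> holds the coordinates of \<open>v\<close> along \<open>U (Suc i)\<close>.\<close>

lemma gram_E: "E\<^sup>T * E = mat_diag k (\<lambda>i. wt (Suc i))"
proof (rule eq_matI)
  fix i i' assume "i < dim_row (mat_diag k (\<lambda>i. wt (Suc i)))" "i' < dim_col (mat_diag k (\<lambda>i. wt (Suc i)))"
  then have i: "i < k" "i' < k" by auto
  have "(E\<^sup>T * E) $$ (i, i') = (\<Sum>j<n. E $$ (j, i) * E $$ (j, i'))"
    using i by (simp add: scalar_prod_def atLeast0LessThan)
  also have "\<dots> = (\<Sum>j<n. (\<lambda>i'' l. if i'' = i then if i = i' then (col (U (Suc i)) l \<bullet> v)\<^sup>2 else 0 else 0) (j div m) (j mod m))"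
    using i by (intro sum.cong[OF refl]) (auto simp: E_def power2_eq_square)
  also have "\<dots> = (\<Sum>i''<k. \<Sum>l<m. if i'' = i then if i = i' then (col (U (Suc i)) l \<bullet> v)\<^sup>2 else 0 else 0)"
    by (rule sum_div_mod)
  also have "\<dots> = (\<Sum>i''<k. if i'' = i then \<Sum>l<m. if i = i' then (col (U (Suc i)) l \<bullet> v)\<^sup>2 else 0 else 0)"
    by (rule sum.cong) auto
  also have "\<dots> = (if i = i' then wt (Suc i) else 0)"
    using i by (simp add: wt_Suc)
  finally show "(E\<^sup>T * E) $$ (i, i') = mat_diag k (\<lambda>i. wt (Suc i)) $$ (i, i')"
    using i by (simp add: mat_diag_def)
qed auto

lemma M_vec: "dim_vec y = n \<Longrightarrow> M *\<^sub>v y = Lam *\<^sub>v y + 2 \<cdot>\<^sub>v (E *\<^sub>v (E\<^sup>T *\<^sub>v y))"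
  by (simp add: M_def mat_vec_expand)

lemma E_sq: "dim_vec c = k \<Longrightarrow> (E *\<^sub>v c) \<bullet> (E *\<^sub>v c) = (\<Sum>i<k. wt (Suc i) * (c $ i)\<^sup>2)"
proof -
  assume c: "dim_vec c = k"
  have "(E *\<^sub>v c) \<bullet> (E *\<^sub>v c) = c \<bullet> (mat_diag k (\<lambda>i. wt (Suc i)) *\<^sub>v c)"
    using c by (simp add: mult_mat_vec_scalar_prod mult_mat_vec_assoc_dim flip: gram_E)
  also have "\<dots> = (\<Sum>i<k. wt (Suc i) * (c $ i)\<^sup>2)"
    using c by (simp add: mat_diag_mult_vec scalar_prod_def atLeast0LessThan power2_eq_square mult_ac)
  finally show ?thesis .
qed

lemma norm_bound_M:
  assumes "\<And>i. i < k \<Longrightarrow> wt (Suc i) \<le> w" "0 \<le> w"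
  shows "norm_bound M (3 * w)"
proof -
  have "norm_bound E (sqrt w)"
  proof (rule norm_boundI_sq)
    fix c :: "real vec" assume "dim_vec c = dim_col E"
    then have c: "dim_vec c = k" by simp
    show "(E *\<^sub>v c) \<bullet> (E *\<^sub>v c) \<le> (sqrt w)\<^sup>2 * (c \<bullet> c)"
      unfolding E_sq[OF c] using assms c
      by (auto simp: scalar_prod_def sum_distrib_left power2_eq_square atLeast0LessThan intro!: sum_mono mult_right_mono)
  qed (use assms in simp)
  then have "norm_bound (E * E\<^sup>T) (sqrt w * sqrt w)"
    using assms by (intro norm_bound_mult norm_bound_transpose) auto
  then have "norm_bound (2 \<cdot>\<^sub>m (E * E\<^sup>T)) (2 * w)"
    using norm_bound_smult[of "E * E\<^sup>T" w 2] assms by simp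
  moreover have "norm_bound Lam w"
    unfolding Lam_def using assms by (intro norm_bound_mat_diag) (auto simp: wt_def)
  ultimately have "norm_bound M (w + 2 * w)"
    unfolding M_def by (intro norm_bound_add) auto
  then show ?thesis by simp
qed

section \<open>The block of the first subspace and its complement\<close>

lemma J_index [simp]: "j < n \<Longrightarrow> l < m \<Longrightarrow> J $$ (j, l) = (if j = l then 1 else 0)"
  by (simp add: J_def first_cols_def)

lemma orthonormal_J: "orthonormal_cols J"
  unfolding J_def using m_le_n by (intro orthonormal_first_cols) (auto simp: orthonormal_cols_def)

lemma mult_J: "dim_col X = n \<Longrightarrow> X * J = first_cols m X"
proof (rule eq_matI)
  fix i j assume X: "dim_col X = n" and "i < dim_row (first_cols m X)" "j < dim_col (first_cols m X)"
  then have ij: "i < dim_row X" "j < m" by auto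
  have "(X * J) $$ (i, j) = (\<Sum>l<n. X $$ (i, l) * (if l = j then 1 else 0))"
    using ij X by (simp add: scalar_prod_def atLeast0LessThan)
  also have "\<dots> = X $$ (i, j)" using ij by (simp add: if_distrib[of "\<lambda>x. _ * x"] cong: if_cong)
  finally show "(X * J) $$ (i, j) = first_cols m X $$ (i, j)" using ij by (simp add: first_cols_def)
qed auto

lemma W_J: "W * J = sqrt (\<alpha> 1) \<cdot>\<^sub>m U 1"
  unfolding mult_J[OF dims(2)]
proof (rule eq_matI)
  fix p l assume "p < dim_row (sqrt (\<alpha> 1) \<cdot>\<^sub>m U 1)" "l < dim_col (sqrt (\<alpha> 1) \<cdot>\<^sub>m U 1)"
  then have pl: "p < d" "l < m" using carrier_matD[OF U1(1)] by simp_all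
  then have "l < n" using m_le_n by linarith
  then show "first_cols m W $$ (p, l) = (sqrt (\<alpha> 1) \<cdot>\<^sub>m U 1) $$ (p, l)"
    using pl U1(1) by (simp add: first_cols_def W_index)
qed (use U1(1) in auto)

lemma J_transpose_index: "dim_vec y = n \<Longrightarrow> l < m \<Longrightarrow> (J\<^sup>T *\<^sub>v y) $ l = y $ l"
proof -
  assume y: "dim_vec y = n" and l: "l < m"
  have "(J\<^sup>T *\<^sub>v y) $ l = (\<Sum>j<n. (if j = l then 1 else 0) * y $ j)"
    using y l by (simp add: scalar_prod_def atLeast0LessThan)
  also have "\<dots> = y $ l" using l by (simp add: if_distrib[of "\<lambda>x. x * _"] cong: if_cong)
  finally show ?thesis .
qed

lemma E_first_col: "m \<le> j \<Longrightarrow> j < n \<Longrightarrow> E $$ (j, 0) = 0"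
  using m k by (auto simp: E_def div_eq_0_iff)

lemma E_first_rows: "l < m \<Longrightarrow> i < k \<Longrightarrow> i \<noteq> 0 \<Longrightarrow> E $$ (l, i) = 0"
  by (simp add: E_def)

definition M1 :: "real mat" where
  "M1 = J\<^sup>T * (M * J)"

lemma M1_dims [simp]: "dim_row M1 = m" "dim_col M1 = m"
  by (simp_all add: M1_def)

text \<open>Block diagonality of \<open>M\<close> in the form needed later: if \<open>Oh\<close>
  were orthogonal, the columns of \<open>Oh * J\<close> would span an exactly invariant subspace of
  the whitened \<open>B\<close>.\<close>

lemma M_J: "M * J = J * M1"
proof (rule eq_matI)
  fix j l assume "j < dim_row (J * M1)" "l < dim_col (J * M1)"
  then have jl: "j < n" "l < m" by auto
  have ln: "l < n" using jl m_le_n by linarith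
  have MJ: "(M * J) $$ (i, l) = M $$ (i, l)" if "i < n" for i
    unfolding mult_J[OF dims(8)] using that jl by (simp add: first_cols_def)
  have M1: "M1 $$ (i, l) = M $$ (i, l)" if "i < m" for i
  proof -
    have i: "i < n" using that m_le_n by linarith
    have "M1 $$ (i, l) = (J\<^sup>T *\<^sub>v col (M * J) l) $ i"
      using that jl by (simp add: M1_def)
    also have "\<dots> = col (M * J) l $ i" using that by (intro J_transpose_index) simp_all
    finally show ?thesis using i jl MJ by (simp del: index_mult_mat(1))
  qed
  have "(J * M1) $$ (j, l) = (\<Sum>i<m. (if j = i then 1 else 0) * M1 $$ (i, l))"
    using jl by (simp add: scalar_prod_def atLeast0LessThan)
  also have "\<dots> = (if j < m then M $$ (j, l) else 0)"
    using M1 by (simp add: if_distrib[of "\<lambda>x. x * _"] cong: if_cong)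
  also have "\<dots> = M $$ (j, l)"
  proof (cases "j < m")
    case False
    have "(E * E\<^sup>T) $$ (j, l) = (\<Sum>i<k. E $$ (j, i) * E $$ (l, i))"
      using jl ln by (simp add: scalar_prod_def atLeast0LessThan)
    also have "\<dots> = 0"
      using False jl E_first_col[of j] E_first_rows[of l]
      by (intro sum.neutral) (metis lessThan_iff mult_eq_0_iff not_less)
    finally have "M $$ (j, l) = Lam $$ (j, l)" using jl ln by (simp add: M_def)
    also have "\<dots> = 0" using False jl ln by (auto simp: Lam_def mat_diag_def)
    finally show ?thesis using False by simp
  qed simp
  finally show "(M * J) $$ (j, l) = (J * M1) $$ (j, l)" using MJ jl by simp
qed auto

lemma M1_lower:
  assumes "dim_vec z = m"
  shows "wt 1 * (z \<bullet> z) \<le> z \<bullet> (M1 *\<^sub>v z)"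
proof -
  define y where "y = J *\<^sub>v z"
  have y: "dim_vec y = n" by (simp add: y_def)
  have yj: "y $ j = (if j < m then z $ j else 0)" if j: "j < n" for j
  proof -
    have "y $ j = (\<Sum>l<m. (if j = l then 1 else 0) * z $ l)"
      using assms j by (simp add: y_def scalar_prod_def atLeast0LessThan)
    also have "\<dots> = (if j < m then z $ j else 0)"
      by (simp add: if_distrib[of "\<lambda>x. x * _"] cong: if_cong)
    finally show ?thesis .
  qed
  have "z \<bullet> (M1 *\<^sub>v z) = y \<bullet> (M *\<^sub>v y)"
    using assms by (simp add: y_def M1_def mult_mat_vec_assoc_dim mult_mat_vec_scalar_prod)
  also have "\<dots> = y \<bullet> (Lam *\<^sub>v y) + 2 * ((E\<^sup>T *\<^sub>v y) \<bullet> (E\<^sup>T *\<^sub>v y))"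
    using y by (simp add: M_vec scalar_prod_expand mult_mat_vec_scalar_prod)
  also have "\<dots> \<ge> y \<bullet> (Lam *\<^sub>v y)"
    using scalar_prod_self_ge_0[of "E\<^sup>T *\<^sub>v y"] by simp
  also have "y \<bullet> (Lam *\<^sub>v y) = (\<Sum>j<n. wt (Suc (j div m)) * (y $ j)\<^sup>2)"
    using y by (simp add: Lam_def mat_diag_mult_vec scalar_prod_def atLeast0LessThan power2_eq_square mult_ac)
  also have "\<dots> = (\<Sum>j<n. wt 1 * (y $ j)\<^sup>2)" by (rule sum.cong) (auto simp: yj)
  also have "\<dots> = wt 1 * (y \<bullet> y)"
    by (simp add: y scalar_prod_def atLeast0LessThan power2_eq_square sum_distrib_left)
  also have "y \<bullet> y = z \<bullet> z"
    using assms by (simp add: y_def orthonormal_cols_isometry orthonormal_J)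
  finally show ?thesis .
qed

text \<open>Source of the factor 3: on the remaining blocks \<open>Lam\<close> contributes \<rho>,
  and E E^T, whose form there is again at most \<rho>, enters \<open>M\<close> with coefficient
  2.\<close>

lemma M_upper:
  assumes y: "dim_vec y = n" "J\<^sup>T *\<^sub>v y = 0\<^sub>v m" and \<rho>: "0 \<le> \<rho>" "\<And>i. i \<in> {1..k} \<Longrightarrow> i \<noteq> 1 \<Longrightarrow> wt i \<le> \<rho>"
  shows "y \<bullet> (M *\<^sub>v y) \<le> 3 * \<rho> * (y \<bullet> y)"
proof -
  have y0: "y $ j = 0" if "j < m" for j
    using J_transpose_index[OF y(1) that] y(2) that by simp
  have wt: "wt (Suc i) \<le> \<rho>" if "i < k" "i \<noteq> 0" for i using \<rho>(2)[of "Suc i"] that by auto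
  have lam: "y \<bullet> (Lam *\<^sub>v y) \<le> \<rho> * (y \<bullet> y)"
  proof -
    have "y \<bullet> (Lam *\<^sub>v y) = (\<Sum>j<n. wt (Suc (j div m)) * (y $ j)\<^sup>2)"
      using y by (simp add: Lam_def mat_diag_mult_vec scalar_prod_def atLeast0LessThan power2_eq_square mult_ac)
    also have "\<dots> \<le> (\<Sum>j<n. \<rho> * (y $ j)\<^sup>2)"
    proof (rule sum_mono)
      fix j assume "j \<in> {..<n}"
      then have j: "j < n" by simp
      show "wt (Suc (j div m)) * (y $ j)\<^sup>2 \<le> \<rho> * (y $ j)\<^sup>2"
      proof (cases "j < m")
        case False
        then have "j div m \<noteq> 0" using m by (simp add: div_eq_0_iff)
        then show ?thesis using wt j by (intro mult_right_mono) auto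
      qed (simp add: y0)
    qed
    also have "\<dots> = \<rho> * (y \<bullet> y)"
      by (simp add: y(1) scalar_prod_def atLeast0LessThan power2_eq_square sum_distrib_left)
    finally show ?thesis .
  qed
  define c where "c = E\<^sup>T *\<^sub>v y"
  have c: "dim_vec c = k" by (simp add: c_def)
  have c0: "c $ 0 = 0"
  proof -
    have "c $ 0 = (\<Sum>j<n. E $$ (j, 0) * y $ j)"
      using k y by (simp add: c_def scalar_prod_def atLeast0LessThan)
    also have "\<dots> = 0" using E_first_col y0 by (intro sum.neutral) (metis lessThan_iff mult_eq_0_iff not_less)
    finally show ?thesis .
  qed
  have Ec: "(E *\<^sub>v c) \<bullet> (E *\<^sub>v c) \<le> \<rho> * (c \<bullet> c)"
  proof -
    have "wt (Suc i) * (c $ i)\<^sup>2 \<le> \<rho> * (c $ i)\<^sup>2" if "i < k" for i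
      using wt[OF that] c0 by (cases "i = 0") (auto intro: mult_right_mono)
    then show ?thesis unfolding E_sq[OF c]
      by (auto simp: c scalar_prod_def sum_distrib_left power2_eq_square atLeast0LessThan intro!: sum_mono)
  qed
  \<comment> \<open>Since c \<bullet> c = y \<bullet> E c and \<open>c\<close> vanishes at index 0,
    Cauchy-Schwarz with \<open>Ec\<close> bounds the square of c \<bullet> c, and one factor c
    \<bullet> c cancels.\<close>
  have cc: "c \<bullet> c \<le> \<rho> * (y \<bullet> y)"
  proof (cases "c \<bullet> c = 0")
    case True
    then show ?thesis using \<rho> scalar_prod_self_ge_0[of y] by simp
  next
    case False
    have "c \<bullet> c = y \<bullet> (E *\<^sub>v c)"
      using y by (simp add: c_def mult_mat_vec_scalar_prod)
    then have "(c \<bullet> c)\<^sup>2 \<le> (l2norm y * l2norm (E *\<^sub>v c))\<^sup>2"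
      using scalar_prod_le_l2norm[of y "E *\<^sub>v c"] y scalar_prod_self_ge_0[of c] by (intro power_mono) auto
    also have "\<dots> \<le> (y \<bullet> y) * (\<rho> * (c \<bullet> c))"
      unfolding power_mult_distrib l2norm_sq using Ec scalar_prod_self_ge_0 by (rule mult_left_mono)
    finally have "(c \<bullet> c) * (c \<bullet> c) \<le> (\<rho> * (y \<bullet> y)) * (c \<bullet> c)"
      by (simp add: power2_eq_square mult_ac)
    then show ?thesis using False scalar_prod_self_ge_0[of c] by (auto intro: mult_right_le_imp_le)
  qed
  have "y \<bullet> (M *\<^sub>v y) = y \<bullet> (Lam *\<^sub>v y) + 2 * (c \<bullet> c)"
    using y by (simp add: M_vec scalar_prod_expand mult_mat_vec_scalar_prod c_def)
  then show ?thesis using lam cc by simp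
qed

end

section \<open>Singular values\<close>

lemma gram_carrier: "X\<^sup>T * X \<in> carrier_mat (dim_col X) (dim_col X)" "(X\<^sup>T * X)\<^sup>T = X\<^sup>T * X"
  for X :: "real mat"
  by (auto intro: carrier_matI simp: transpose_mult_dim)

lemma gram_quadratic_form: "dim_vec x = dim_col X \<Longrightarrow> x \<bullet> (X\<^sup>T * X *\<^sub>v x) = (l2norm (X *\<^sub>v x))\<^sup>2"
  by (simp add: l2norm_sq mult_mat_vec_assoc_dim mult_mat_vec_scalar_prod)

text \<open>Eigenvalues of a Gram matrix are squared lengths |X q|^2, so the square root in
  \<open>sing_val\<close> is taken of a nonnegative number.\<close>

lemma sing_val_nonneg: "0 \<le> sing_val j X"
  and sing_val_sq: "1 \<le> j \<Longrightarrow> j \<le> dim_col X \<Longrightarrow> (sing_val j X)\<^sup>2 = eigvals (X\<^sup>T * X) ! (j - 1)"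
proof -
  obtain Q where Q: "Q \<in> carrier_mat (dim_col X) (dim_col X)" "orthonormal_cols Q"
    "\<forall>j<dim_col X. X\<^sup>T * X *\<^sub>v col Q j = eigvals (X\<^sup>T * X) ! j \<cdot>\<^sub>v col Q j"
    using symmetric_spectral(3)[OF gram_carrier] by blast
  have e: "0 \<le> eigvals (X\<^sup>T * X) ! (j - 1)" if "1 \<le> j" "j \<le> dim_col X"
  proof -
    let ?q = "col Q (j - 1)"
    have j: "j - 1 < dim_col X" using that by linarith
    have "?q \<bullet> (X\<^sup>T * X *\<^sub>v ?q) = eigvals (X\<^sup>T * X) ! (j - 1) * (?q \<bullet> ?q)"
      using Q j by simp
    also have "?q \<bullet> ?q = 1" using orthonormal_cols_scalar_prod[OF Q(2)] Q(1) j by simp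
    finally have "eigvals (X\<^sup>T * X) ! (j - 1) = ?q \<bullet> (X\<^sup>T * X *\<^sub>v ?q)" by simp
    also have "\<dots> = (l2norm (X *\<^sub>v ?q))\<^sup>2" using Q(1) by (intro gram_quadratic_form) simp
    finally show ?thesis by simp
  qed
  show "0 \<le> sing_val j X" using e by (simp add: sing_val_def)
  show "1 \<le> j \<Longrightarrow> j \<le> dim_col X \<Longrightarrow> (sing_val j X)\<^sup>2 = eigvals (X\<^sup>T * X) ! (j - 1)"
    using e by (simp add: sing_val_def)
qed

lemma sing_val_antimono:
  assumes "1 \<le> i" "i \<le> j" "j \<le> dim_col X"
  shows "sing_val j X \<le> sing_val i X"
proof (rule power2_le_imp_le[OF _ sing_val_nonneg])
  show "(sing_val j X)\<^sup>2 \<le> (sing_val i X)\<^sup>2"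
    using assms by (simp add: sing_val_sq symmetric_spectral(2)[OF gram_carrier])
qed

lemma norm_bound_sing_val:
  assumes "1 \<le> dim_col X"
  shows "norm_bound X (sing_val 1 X)"
proof (rule norm_boundI_sq[OF sing_val_nonneg])
  fix x :: "real vec" assume x: "dim_vec x = dim_col X"
  have "(X *\<^sub>v x) \<bullet> (X *\<^sub>v x) = x \<bullet> (X\<^sup>T * X *\<^sub>v x)"
    using gram_quadratic_form[OF x] by (simp add: l2norm_sq)
  also have "\<dots> \<le> eigvals (X\<^sup>T * X) ! 0 * (x \<bullet> x)"
    by (rule quadratic_form_le_top_eigval[OF gram_carrier x])
  also have "eigvals (X\<^sup>T * X) ! 0 = (sing_val 1 X)\<^sup>2" using assms by (simp add: sing_val_sq)
  finally show "(X *\<^sub>v x) \<bullet> (X *\<^sub>v x) \<le> (sing_val 1 X)\<^sup>2 * (x \<bullet> x)" .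
qed

lemma sing_val_ge:
  assumes G: "G \<in> carrier_mat (dim_col X) (Suc p)" "orthonormal_cols G" and p: "p < dim_col X" and \<nu>: "0 \<le> \<nu>"
    and ge: "\<And>c. dim_vec c = Suc p \<Longrightarrow> \<nu> * l2norm c \<le> l2norm (X *\<^sub>v (G *\<^sub>v c))"
  shows "\<nu> \<le> sing_val (Suc p) X"
proof (rule power2_le_imp_le[OF _ sing_val_nonneg])
  have "\<nu>\<^sup>2 \<le> eigvals (X\<^sup>T * X) ! p"
  proof (rule eigvals_ge[OF gram_carrier G p])
    fix c :: "real vec" assume c: "dim_vec c = Suc p"
    have "(\<nu> * l2norm c)\<^sup>2 \<le> (l2norm (X *\<^sub>v (G *\<^sub>v c)))\<^sup>2"
      using ge[OF c] \<nu> by (intro power_mono) (auto simp: l2norm_ge_0)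
    then show "\<nu>\<^sup>2 * (c \<bullet> c) \<le> (G *\<^sub>v c) \<bullet> (X\<^sup>T * X *\<^sub>v (G *\<^sub>v c))"
      using G(1) by (subst gram_quadratic_form) (auto simp: power_mult_distrib l2norm_sq)
  qed
  then show "\<nu>\<^sup>2 \<le> (sing_val (Suc p) X)\<^sup>2" using p by (simp add: sing_val_sq)
qed

lemma sing_val_le:
  assumes "norm_bound X c" "0 \<le> c"
  shows "sing_val j X \<le> c"
proof (cases "1 \<le> j \<and> j \<le> dim_col X")
  case True
  have "eigvals (X\<^sup>T * X) ! (j - 1) \<le> c\<^sup>2"
  proof (rule eigvals_le[OF gram_carrier, of "mat (dim_col X) (j - 1) (\<lambda>_. 0)"])
    fix x :: "real vec" assume "dim_vec x = dim_col X"
    then show "x \<bullet> (X\<^sup>T * X *\<^sub>v x) \<le> c\<^sup>2 * (x \<bullet> x)"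
      using norm_boundD_sq[OF assms] gram_quadratic_form[of x X] by (simp add: l2norm_sq)
  qed (use True in auto)
  then have "(sing_val j X)\<^sup>2 \<le> c\<^sup>2" using True by (simp add: sing_val_sq)
  then show ?thesis using assms(2) by (rule power2_le_imp_le)
qed (use assms in \<open>auto simp: sing_val_def\<close>)

text \<open>The variational estimate for X^T X, in terms of norms. It is applied with
  \<open>K = W\<close> twice: to \<open>A\<close> with c = 0, and to \<open>Ah\<close> with c =
  \<epsilon>.\<close>

lemma norm_orthogonal_singular_vectors:
  assumes V: "V \<in> carrier_mat (dim_col X) n" "orthonormal_cols V"
      "\<And>j. j < n \<Longrightarrow> X\<^sup>T * X *\<^sub>v col V j = (sing_val (Suc j) X)\<^sup>2 \<cdot>\<^sub>v col V j"
    and n: "n \<le> dim_col X" and K: "K \<in> carrier_mat (dim_col X) n" and c: "0 \<le> c"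
    and le: "\<And>x. dim_vec x = dim_col X \<Longrightarrow> K\<^sup>T *\<^sub>v x = 0\<^sub>v n \<Longrightarrow> l2norm (X *\<^sub>v x) \<le> c * l2norm x"
    and x: "dim_vec x = dim_col X" "V\<^sup>T *\<^sub>v x = 0\<^sub>v n"
  shows "l2norm (X *\<^sub>v x) \<le> c * l2norm x"
proof -
  have "x \<bullet> (X\<^sup>T * X *\<^sub>v x) \<le> c\<^sup>2 * (x \<bullet> x)"
  proof (rule quadratic_form_orthogonal_eigenvectors[OF gram_carrier V(1,2) _ n K _ x])
    fix j assume "j < n"
    then show "X\<^sup>T * X *\<^sub>v col V j = eigvals (X\<^sup>T * X) ! j \<cdot>\<^sub>v col V j"
      using V(3)[of j] n by (simp add: sing_val_sq)
  next
    fix x :: "real vec" assume x: "dim_vec x = dim_col X" "K\<^sup>T *\<^sub>v x = 0\<^sub>v n"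
    have "(l2norm (X *\<^sub>v x))\<^sup>2 \<le> (c * l2norm x)\<^sup>2"
      using le[OF x] by (intro power_mono) (auto simp: l2norm_ge_0)
    then show "x \<bullet> (X\<^sup>T * X *\<^sub>v x) \<le> c\<^sup>2 * (x \<bullet> x)"
      using gram_quadratic_form[OF x(1)] by (simp add: power_mult_distrib l2norm_sq)
  qed
  then have "(l2norm (X *\<^sub>v x))\<^sup>2 \<le> (c * l2norm x)\<^sup>2"
    using gram_quadratic_form[OF x(1)] by (simp add: power_mult_distrib l2norm_sq)
  then show ?thesis by (rule power2_le_imp_le) (simp add: c l2norm_ge_0)
qed

lemma singular_vector_gram:
  assumes "singular_vector X \<sigma> v"
  shows "X\<^sup>T * X *\<^sub>v v = \<sigma>\<^sup>2 \<cdot>\<^sub>v v"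
proof -
  obtain u where u: "dim_vec v = dim_col X" "dim_vec u = dim_row X" "X *\<^sub>v v = \<sigma> \<cdot>\<^sub>v u" "X\<^sup>T *\<^sub>v u = \<sigma> \<cdot>\<^sub>v v"
    using assms by (auto simp: singular_vector_def dest: carrier_vecD)
  then show ?thesis
    by (simp add: mult_mat_vec_assoc_dim mat_vec_smult_dim smult_smult_assoc power2_eq_square)
qed

text \<open>
  A singular vector of a symmetric matrix need not be an eigenvector, as the eigenvalues
  \<open>\<sigma>\<close> and \<open>-\<sigma>\<close> share their singular vectors; the lower bound on the form excludes \<open>-\<sigma>\<close>.
\<close>

lemma singular_vector_eigenvector:
  fixes X :: "real mat"
  assumes X: "X \<in> carrier_mat d d" "X\<^sup>T = X" and v: "dim_vec v = d" "X\<^sup>T * X *\<^sub>v v = \<sigma>\<^sup>2 \<cdot>\<^sub>v v"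
    and lower: "\<And>x. dim_vec x = d \<Longrightarrow> - (\<epsilon> * (x \<bullet> x)) \<le> x \<bullet> (X *\<^sub>v x)" and \<sigma>: "\<epsilon> < \<sigma>"
  shows "X *\<^sub>v v = \<sigma> \<cdot>\<^sub>v v"
proof -
  note [simp] = carrier_matD[OF X(1)] v(1)
  \<comment> \<open>Since X (X v) = \<sigma>^2 v, this \<open>y\<close> satisfies X y = - \<sigma>
    y, and the lower bound on the form forces it to be 0.\<close>
  define y where "y = X *\<^sub>v v - \<sigma> \<cdot>\<^sub>v v"
  have y [simp]: "dim_vec y = d" by (simp add: y_def)
  have XX: "X *\<^sub>v (X *\<^sub>v v) = \<sigma>\<^sup>2 \<cdot>\<^sub>v v" using v(2) X(2)
    by (simp add: mult_mat_vec_assoc_dim)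
  have "X *\<^sub>v y = (- \<sigma>) \<cdot>\<^sub>v y"
    unfolding y_def by (auto intro!: eq_vecI simp: mat_vec_minus_dim mat_vec_smult_dim XX power2_eq_square algebra_simps)
  then have "y \<bullet> (X *\<^sub>v y) = - (\<sigma> * (y \<bullet> y))" by simp
  then have "\<sigma> * (y \<bullet> y) \<le> \<epsilon> * (y \<bullet> y)" using lower[of y] by simp
  then have "y \<bullet> y = 0" using \<sigma> scalar_prod_self_ge_0[of y]
    by (metis less_le_not_le mult_right_less_imp_less mult_strict_right_mono order_le_less)
  then have y0: "y = 0\<^sub>v d" by (simp add: scalar_prod_self_eq_0)
  show ?thesis
  proof (rule eq_vecI)
    fix i assume "i < dim_vec (\<sigma> \<cdot>\<^sub>v v)"
    then show "(X *\<^sub>v v) $ i = (\<sigma> \<cdot>\<^sub>v v) $ i"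
      using arg_cong[OF y0, of "\<lambda>y. y $ i"] by (simp add: y_def)
  qed simp
qed

section \<open>The range of \<open>A\<close> and its smallest positive singular value\<close>

context subspace_mixture
begin

abbreviation "A \<equiv> A_mat d k \<alpha> U"
abbreviation "B \<equiv> B_mat d k \<alpha> U v"

lemma AB_dims [simp]: "dim_row A = d" "dim_col A = d" "dim_row B = d" "dim_col B = d"
  by (simp_all add: A_mat_def B_mat_def sum_mats_def)

lemma A_sym: "A\<^sup>T = A"
  unfolding A_eq by (simp add: transpose_mult_dim)

lemma A_quadratic_form: "dim_vec x = d \<Longrightarrow> x \<bullet> (A *\<^sub>v x) = (W\<^sup>T *\<^sub>v x) \<bullet> (W\<^sup>T *\<^sub>v x)"
  unfolding A_eq by (simp add: mult_mat_vec_assoc_dim mult_mat_vec_scalar_prod)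

lemma A_kernel: "dim_vec x = d \<Longrightarrow> W\<^sup>T *\<^sub>v x = 0\<^sub>v n \<Longrightarrow> A *\<^sub>v x = 0\<^sub>v d"
  unfolding A_eq using mult_mat_vec_zero[of W] by (simp add: mult_mat_vec_assoc_dim)

lemma n_pos: "1 \<le> n" using mult_le_mono[OF m k] by simp

text \<open>The top \<open>n\<close> singular vectors \<open>Q\<close> span a space containing the
  range of \<open>W\<close>: on its complement \<open>A\<close> vanishes, and with it W^T. On that
  space \<open>A\<close> is bounded below by its n-th singular value, so every \<open>W b\<close>
  has a preimage of controlled length.\<close>

lemma A_range:
  assumes pos: "0 < sing_val n A"
  shows n_le_d: "n \<le> d"
    and "\<exists>Q \<in> carrier_mat d n. orthonormal_cols Q \<and> 
      (\<forall>c. dim_vec c = n \<longrightarrow> sing_val n A * l2norm c \<le> l2norm (A *\<^sub>v (Q *\<^sub>v c))) \<and>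
      (\<forall>b. dim_vec b = n \<longrightarrow> (\<exists>y. dim_vec y = d \<and> A *\<^sub>v y = W *\<^sub>v b \<and> sing_val n A * l2norm y \<le> l2norm (W *\<^sub>v b)))"
proof -
  show nd: "n \<le> d" using pos by (auto simp: sing_val_def split: if_splits)
  let ?s = "sing_val n A" and ?l = "\<lambda>j. eigvals (A\<^sup>T * A) ! j"
  have AA: "A\<^sup>T * A \<in> carrier_mat d d" using gram_carrier(1)[of A] by simp
  obtain R where R: "R \<in> carrier_mat d d" "orthonormal_cols R"
    "\<forall>j<d. A\<^sup>T * A *\<^sub>v col R j = ?l j \<cdot>\<^sub>v col R j"
    using symmetric_spectral(3)[OF AA gram_carrier(2)] by blast
  define Q where "Q = first_cols n R"
  have Q: "Q \<in> carrier_mat d n" "orthonormal_cols Q"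
    using R nd by (auto simp: Q_def intro: carrier_matI orthonormal_first_cols)
  note [simp] = carrier_matD[OF Q(1)]
  have AQ: "A\<^sup>T * A *\<^sub>v col Q j = ?l j \<cdot>\<^sub>v col Q j" if "j < n" for j
    using R that nd by (simp add: Q_def)
  have l: "?s\<^sup>2 \<le> ?l j" if "j < n" for j
  proof -
    have "?s \<le> sing_val (Suc j) A" using that nd by (intro sing_val_antimono) auto
    then have "?s\<^sup>2 \<le> (sing_val (Suc j) A)\<^sup>2" using pos by (intro power_mono) auto
    then show ?thesis using that nd by (simp add: sing_val_sq)
  qed
  have lpos: "0 < ?l j" if "j < n" for j
    using l[OF that] pos by (meson less_le_trans zero_less_power)
  let ?D = "mat_diag n ?l"
  have AAQ: "A *\<^sub>v (A *\<^sub>v (Q *\<^sub>v c)) = Q *\<^sub>v (?D *\<^sub>v c)" if "dim_vec c = n" for c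
  proof -
    have "A\<^sup>T * A * Q = Q * ?D" using eigenvector_cols_mult[of "A\<^sup>T * A" Q ?l] AQ by simp
    then have "A\<^sup>T * A * Q *\<^sub>v c = Q * ?D *\<^sub>v c" by simp
    then show ?thesis using that by (simp add: mult_mat_vec_assoc_dim A_sym)
  qed
  have 1: "?s * l2norm c \<le> l2norm (A *\<^sub>v (Q *\<^sub>v c))" if c: "dim_vec c = n" for c
  proof (rule power2_le_imp_le[OF _ l2norm_ge_0])
    have "(l2norm (A *\<^sub>v (Q *\<^sub>v c)))\<^sup>2 = (Q *\<^sub>v c) \<bullet> (A *\<^sub>v (A *\<^sub>v (Q *\<^sub>v c)))"
      by (simp add: l2norm_sq mult_mat_vec_scalar_prod A_sym)
    also have "\<dots> = c \<bullet> (?D *\<^sub>v c)"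
      using c by (simp add: AAQ mult_mat_vec_scalar_prod orthonormal_cols_isometry[OF Q(2)])
    also have "\<dots> = (\<Sum>j<n. ?l j * (c $ j)\<^sup>2)"
      using c by (simp add: mat_diag_mult_vec scalar_prod_def atLeast0LessThan power2_eq_square mult_ac)
    also have "\<dots> \<ge> (\<Sum>j<n. ?s\<^sup>2 * (c $ j)\<^sup>2)" using l
      by (intro sum_mono mult_right_mono) auto
    also have "(\<Sum>j<n. ?s\<^sup>2 * (c $ j)\<^sup>2) = ?s\<^sup>2 * (c \<bullet> c)"
      by (simp add: c scalar_prod_def atLeast0LessThan power2_eq_square sum_distrib_left)
    finally show "(?s * l2norm c)\<^sup>2 \<le> (l2norm (A *\<^sub>v (Q *\<^sub>v c)))\<^sup>2"
      by (simp add: power_mult_distrib l2norm_sq)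
  qed
  have 2: "\<exists>y. dim_vec y = d \<and> A *\<^sub>v y = W *\<^sub>v b \<and> ?s * l2norm y \<le> l2norm (W *\<^sub>v b)" if b: "dim_vec b = n"
    for b
  proof -
    define u where "u = W *\<^sub>v b"
    define c where "c = Q\<^sup>T *\<^sub>v u"
    have dim [simp]: "dim_vec u = d" "dim_vec c = n" by (simp_all add: u_def c_def)
    define x where "x = u - Q *\<^sub>v c"
    have x [simp]: "dim_vec x = d" by (simp add: x_def)
    have Qx: "Q\<^sup>T *\<^sub>v x = 0\<^sub>v n"
      by (auto intro!: eq_vecI simp: x_def mat_vec_minus_dim orthonormal_cols_isometry[OF Q(2)] simp flip: c_def)
    \<comment> \<open>\<open>A\<close> vanishes on the kernel of W^T, which is cut out by
      \<open>n\<close> columns, so the variational bound holds with constant 0.\<close>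
    have "l2norm (A *\<^sub>v x) \<le> 0 * l2norm x"
    proof (rule norm_orthogonal_singular_vectors[of Q A n W])
      show "A\<^sup>T * A *\<^sub>v col Q j = (sing_val (Suc j) A)\<^sup>2 \<cdot>\<^sub>v col Q j"
        if "j < n" for j
        using AQ[OF that] that nd by (simp add: sing_val_sq)
      show "W \<in> carrier_mat (dim_col A) n" by (rule carrier_matI) simp_all
      show "l2norm (A *\<^sub>v x) \<le> 0 * l2norm x"
        if "dim_vec x = dim_col A" "W\<^sup>T *\<^sub>v x = 0\<^sub>v n" for x
        using A_kernel[of x] that by simp
    qed (use Q nd Qx in simp_all)
    then have Ax: "A *\<^sub>v x = 0\<^sub>v d"
      using l2norm_ge_0[of "A *\<^sub>v x"] l2norm_eq_0[of "A *\<^sub>v x"] by simp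
    have "x \<bullet> (A *\<^sub>v x) = 0" unfolding Ax by (metis carrier_vec_dim_vec scalar_prod_right_zero x)
    then have Wx: "W\<^sup>T *\<^sub>v x = 0\<^sub>v n"
      using A_quadratic_form[of x] scalar_prod_self_eq_0[of "W\<^sup>T *\<^sub>v x"] by simp
    have "u \<bullet> x = b \<bullet> (W\<^sup>T *\<^sub>v x)" using b
      by (simp add: u_def mult_mat_vec_scalar_prod)
    then have "u \<bullet> x = 0" unfolding Wx using b by (simp add: scalar_prod_def)
    moreover have "(Q *\<^sub>v c) \<bullet> x = c \<bullet> (Q\<^sup>T *\<^sub>v x)"
      by (simp add: mult_mat_vec_scalar_prod)
    then have "(Q *\<^sub>v c) \<bullet> x = 0" unfolding Qx by (simp add: scalar_prod_def)
    ultimately have "x \<bullet> x = 0" using scalar_prod_minus_left[of u x "Q *\<^sub>v c"] by (simp flip: x_def)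
    then have "x = 0\<^sub>v d" by (simp add: scalar_prod_self_eq_0)
    then have uQ: "u = Q *\<^sub>v c"
      by (metis (no_types, lifting) x_def carrier_vec_dim_vec dim(1) dim_mult_mat_vec carrier_matD(1)[OF Q(1)]
          minus_add_minus_vec eq_vecI index_minus_vec(1) index_zero_vec(1) right_minus_eq)
    \<comment> \<open>\<open>A * A\<close> acts on \<open>Q\<close> through \<open>?D\<close>, so
      dividing the coordinates of \<open>u\<close> by \<open>?l\<close> gives a preimage under
      \<open>A * A\<close>; applying \<open>A\<close> once to it gives a preimage under
      \<open>A\<close>.\<close>
    define e where "e = vec n (\<lambda>j. c $ j / ?l j)"
    have e [simp]: "dim_vec e = n" by (simp add: e_def)
    have De: "?D *\<^sub>v e = c"
      using lpos by (auto intro!: eq_vecI simp: mat_diag_mult_vec e_def less_imp_neq[OF lpos, symmetric])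
    define y where "y = A *\<^sub>v (Q *\<^sub>v e)"
    have y: "dim_vec y = d" by (simp add: y_def)
    have Ay: "A *\<^sub>v y = u" by (simp add: y_def AAQ De uQ)
    have "(?s * l2norm y)\<^sup>2 \<le> (l2norm u)\<^sup>2"
    proof -
      have "y \<bullet> y = (Q *\<^sub>v e) \<bullet> (A *\<^sub>v y)"
        by (simp add: y_def mult_mat_vec_scalar_prod A_sym)
      also have "\<dots> = e \<bullet> c"
        by (simp add: Ay uQ mult_mat_vec_scalar_prod orthonormal_cols_isometry[OF Q(2)])
      finally have "?s\<^sup>2 * (y \<bullet> y) = (\<Sum>j<n. ?s\<^sup>2 * ((c $ j)\<^sup>2 / ?l j))"
        by (simp add: e_def scalar_prod_def atLeast0LessThan power2_eq_square sum_distrib_left)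
      also have "\<dots> \<le> (\<Sum>j<n. (c $ j)\<^sup>2)"
      proof (rule sum_mono)
        fix j assume "j \<in> {..<n}"
        then have j: "j < n" by simp
        show "?s\<^sup>2 * ((c $ j)\<^sup>2 / ?l j) \<le> (c $ j)\<^sup>2"
          using mult_right_mono[OF l[OF j], of "(c $ j)\<^sup>2"] lpos[OF j] by (simp add: field_simps)
      qed
      also have "\<dots> = c \<bullet> c" by (simp add: scalar_prod_def atLeast0LessThan power2_eq_square)
      also have "\<dots> = u \<bullet> u" unfolding uQ by (simp add: orthonormal_cols_isometry[OF Q(2)])
      finally show ?thesis by (simp add: power_mult_distrib l2norm_sq)
    qed
    then have "?s * l2norm y \<le> l2norm u" by (rule power2_le_imp_le) (rule l2norm_ge_0)
    then show ?thesis using y Ay by (auto simp: u_def)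
  qed
  show "\<exists>Q \<in> carrier_mat d n. orthonormal_cols Q \<and> 
      (\<forall>c. dim_vec c = n \<longrightarrow> ?s * l2norm c \<le> l2norm (A *\<^sub>v (Q *\<^sub>v c))) \<and>
      (\<forall>b. dim_vec b = n \<longrightarrow> (\<exists>y. dim_vec y = d \<and> A *\<^sub>v y = W *\<^sub>v b \<and> ?s * l2norm y \<le> l2norm (W *\<^sub>v b)))"
    using Q 1 2 by blast
qed

lemma U1_range:
  assumes pos: "0 < sing_val n A" and z: "dim_vec z = m"
  shows "\<exists>y. dim_vec y = d \<and> A *\<^sub>v y = U 1 *\<^sub>v z \<and> sing_val n A * l2norm y \<le> l2norm z"
proof -
  have U1d: "dim_row (U 1) = d" "dim_col (U 1) = m" using U1(1) by auto
  let ?b = "(1 / sqrt (\<alpha> 1)) \<cdot>\<^sub>v (J *\<^sub>v z)"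
  have "W *\<^sub>v ?b = (1 / sqrt (\<alpha> 1)) \<cdot>\<^sub>v (W * J *\<^sub>v z)"
    using z by (simp add: mat_vec_smult_dim mult_mat_vec_assoc_dim)
  also have "\<dots> = U 1 *\<^sub>v z"
    unfolding W_J using z U1(3) U1d by (auto intro!: eq_vecI simp: smult_mat_vec_dim)
  finally have Wb: "W *\<^sub>v ?b = U 1 *\<^sub>v z" .
  obtain Q where "\<forall>b. dim_vec b = n \<longrightarrow> (\<exists>y. dim_vec y = d \<and> A *\<^sub>v y = W *\<^sub>v b \<and> sing_val n A * l2norm y \<le> l2norm (W *\<^sub>v b))"
    using A_range(2)[OF pos] by blast
  then have "\<exists>y. dim_vec y = d \<and> A *\<^sub>v y = W *\<^sub>v ?b \<and> sing_val n A * l2norm y \<le> l2norm (W *\<^sub>v ?b)" by simp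
  then show ?thesis unfolding Wb using orthonormal_cols_isometry(3)[OF U1(2), of z] z U1d by simp
qed

text \<open>Tested on the first column \<open>u\<close> of \<open>U 1\<close>, the form of
  \<open>A\<close> is |W^T u|^2, and the first block of W^T u alone contributes \<alpha> 1.\<close>

lemma \<alpha>1_le: 
  assumes "1 \<le> d"
  shows "\<alpha> 1 \<le> sing_val 1 A"
proof -
  have U1d: "dim_row (U 1) = d" "dim_col (U 1) = m" using U1(1) by auto
  define u where "u = col (U 1) 0"
  have u: "dim_vec u = d" "u \<bullet> u = 1"
    using orthonormal_cols_scalar_prod[OF U1(2), of 0 0] m U1d by (simp_all add: u_def)
  have "J\<^sup>T *\<^sub>v (W\<^sup>T *\<^sub>v u) = (W * J)\<^sup>T *\<^sub>v u"
    using u by (simp add: transpose_mult_dim mult_mat_vec_assoc_dim)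
  also have "\<dots> = sqrt (\<alpha> 1) \<cdot>\<^sub>v ((U 1)\<^sup>T *\<^sub>v u)"
    unfolding W_J using u U1d by (auto intro!: eq_vecI simp: scalar_prod_smult_left)
  also have "(U 1)\<^sup>T *\<^sub>v u = unit_vec m 0"
  proof (rule eq_vecI)
    fix i assume "i < dim_vec (unit_vec m 0 :: real vec)"
    then show "((U 1)\<^sup>T *\<^sub>v u) $ i = unit_vec m 0 $ i"
      using orthonormal_cols_scalar_prod[OF U1(2), of i 0] m U1d by (simp add: u_def)
  qed (use U1d in simp)
  finally have "J\<^sup>T *\<^sub>v (W\<^sup>T *\<^sub>v u) = sqrt (\<alpha> 1) \<cdot>\<^sub>v unit_vec m 0" .
  moreover have "l2norm (J\<^sup>T *\<^sub>v (W\<^sup>T *\<^sub>v u)) \<le> 1 * l2norm (W\<^sup>T *\<^sub>v u)"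
    using u by (intro norm_boundD norm_bound_transpose norm_bound_orthonormal orthonormal_J) auto
  moreover have "l2norm (unit_vec m 0) = 1" using m by (simp add: l2norm_def)
  ultimately have "sqrt (\<alpha> 1) \<le> l2norm (W\<^sup>T *\<^sub>v u)" using U1(3) by (simp add: l2norm_smult)
  then have "(sqrt (\<alpha> 1))\<^sup>2 \<le> (l2norm (W\<^sup>T *\<^sub>v u))\<^sup>2" using U1(3)
    by (intro power_mono) auto
  then have "\<alpha> 1 \<le> u \<bullet> (A *\<^sub>v u)" using U1(3) u by (simp add: l2norm_sq A_quadratic_form)
  also have "\<dots> \<le> l2norm u * l2norm (A *\<^sub>v u)" using u by (intro scalar_prod_le_l2norm) simp
  also have "\<dots> \<le> sing_val 1 A"
    using norm_boundD[OF norm_bound_sing_val[of A], of u] u assms by (simp add: l2norm_def)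
  finally show ?thesis .
qed

end

section \<open>The perturbed algorithm\<close>

lemma norm_bound_quadratic_form:
  assumes "norm_bound X c" "dim_row X = dim_col X" "dim_vec x = dim_col X"
  shows "\<bar>x \<bullet> (X *\<^sub>v x)\<bar> \<le> c * (x \<bullet> x)"
proof -
  have "\<bar>x \<bullet> (X *\<^sub>v x)\<bar> \<le> l2norm x * l2norm (X *\<^sub>v x)"
    using assms by (intro Cauchy_Schwarz_l2norm) simp
  also have "\<dots> \<le> l2norm x * (c * l2norm x)"
    using assms by (intro mult_left_mono norm_boundD l2norm_ge_0)
  also have "\<dots> = c * (x \<bullet> x)" by (simp add: power2_eq_square flip: l2norm_sq)
  finally show ?thesis .
qed

lemma norm_bound_cong:
  assumes "norm_bound X c" "dim_col Y = dim_col X" "\<And>x. dim_vec x = dim_col X \<Longrightarrow> Y *\<^sub>v x = X *\<^sub>v x"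
  shows "norm_bound Y c"
  using assms by (simp add: norm_bound_def)

lemma mat_diag_transpose [simp]: "(mat_diag n f)\<^sup>T = mat_diag n (f :: nat \<Rightarrow> real)"
  by (rule eq_matI) (auto simp: mat_diag_def)

text \<open>One run of the algorithm in the regime of small \<epsilon>. The constant 1160 makes the
  error 145 S \<eta> / \<delta> of \<open>ZZ_error\<close> at most \<alpha> 1 / 4. The bound 1 \<le>
  \<open>wt 1\<close> allows the absolute error of \<open>Bh\<close> to be compared with a gap
  proportional to \<open>wt 1\<close>.\<close>

locale perturbed_mixture = subspace_mixture +
  fixes Ah Bh V Y Uh :: "real mat" and \<epsilon> \<delta> :: real
  assumes pos: "0 < sing_val n A"
    and Ah: "Ah \<in> carrier_mat d d" "Ah\<^sup>T = Ah" and Bh: "Bh \<in> carrier_mat d d" "Bh\<^sup>T = Bh"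
    and A_error: "norm_bound (Ah - A) \<epsilon>" and B_error: "norm_bound (Bh - B) \<epsilon>" and \<epsilon>: "0 \<le> \<epsilon>"
    and \<delta>: "0 < \<delta>" "\<delta> \<le> 1 / 3" and wt1: "1 \<le> wt 1"
    and wt_gap: "\<And>i. i \<in> {1..k} \<Longrightarrow> i \<noteq> 1 \<Longrightarrow> wt i \<le> (1 / 3 - \<delta>) * wt 1"
    and small: "1160 * sing_val 1 A * \<epsilon> \<le> \<alpha> 1 * sing_val n A * \<delta>"
    and V: "V \<in> carrier_mat d n" "orthonormal_cols V"
    and V_singular: "\<And>j. j < n \<Longrightarrow> singular_vector Ah (sing_val (Suc j) Ah) (col V j)"
    and Y: "top_eigenvectors m (mat_diag n (\<lambda>j. 1 / sqrt (sing_val (Suc j) Ah)) * V\<^sup>T * Bh * V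
              * mat_diag n (\<lambda>j. 1 / sqrt (sing_val (Suc j) Ah))) Y"
    and Uh: "top_eigenvectors m ((V * mat_diag n (\<lambda>j. sqrt (sing_val (Suc j) Ah)) * Y) *
              (V * mat_diag n (\<lambda>j. sqrt (sing_val (Suc j) Ah)) * Y)\<^sup>T) Uh"
begin

declare One_nat_def [simp del]

definition "s = sing_val n A"
definition "S = sing_val 1 A"
text \<open>The size of an \<epsilon>-error after whitening: \<open>T\<close> has squared norm at
  most 2 / s, because the retained singular values of \<open>Ah\<close> are at least s / 2.\<close>

definition "\<eta> = 2 * \<epsilon> / s"
abbreviation "sh j \<equiv> sing_val (Suc j) Ah"

lemma dims' [simp]: "dim_row Ah = d" "dim_col Ah = d" "dim_row Bh = d" "dim_col Bh = d"
  "dim_row V = d" "dim_col V = n" "dim_row (U 1) = d" "dim_col (U 1) = m"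
  using Ah Bh V U1 by auto

lemma nd: "n \<le> d" by (rule n_le_d[OF pos])

lemma parameters: "0 < s" "s \<le> S" "\<alpha> 1 \<le> S" "0 < \<alpha> 1" "0 < S" "0 \<le> \<eta>" "580 * \<eta> \<le> \<delta>" "4 * \<epsilon> \<le> s"
  "580 * S * \<eta> \<le> \<alpha> 1 * \<delta>"
proof -
  have d: "1 \<le> d" using nd n_pos by linarith
  show s: "0 < s" using pos by (simp add: s_def)
  show sS: "s \<le> S" unfolding s_def S_def using nd n_pos by (intro sing_val_antimono) auto
  show a: "\<alpha> 1 \<le> S" unfolding S_def by (rule \<alpha>1_le[OF d])
  show a0: "0 < \<alpha> 1" using U1(3) .
  show S0: "0 < S" using s sS by linarith
  show "0 \<le> \<eta>" using \<epsilon> s by (simp add: \<eta>_def)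
  show "580 * S * \<eta> \<le> \<alpha> 1 * \<delta>"
    using small[folded s_def S_def] s by (simp add: \<eta>_def field_simps)
  \<comment> \<open>Replacing \<alpha> 1 on the right by the larger \<open>S\<close> lets
    \<open>S\<close> cancel.\<close>
  have "1160 * \<epsilon> * S \<le> (s * \<delta>) * \<alpha> 1" using small by (simp add: s_def S_def mult_ac)
  also have "\<dots> \<le> (s * \<delta>) * S" using a s \<delta> by (intro mult_left_mono) auto
  finally have e: "1160 * \<epsilon> \<le> s * \<delta>" using S0 by (rule mult_right_le_imp_le)
  then show "580 * \<eta> \<le> \<delta>" using s by (simp add: \<eta>_def field_simps)
  have "s * \<delta> \<le> s * (1 / 3)" using s \<delta> by (intro mult_left_mono) auto
  then show "4 * \<epsilon> \<le> s" using e \<epsilon> by linarith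
qed

lemma Ah_A: "dim_vec x = d \<Longrightarrow> l2norm (Ah *\<^sub>v x - A *\<^sub>v x) \<le> \<epsilon> * l2norm x"
  using norm_boundD[OF A_error, of x] by (simp add: minus_mat_vec_dim)

section \<open>Singular values and vectors of the perturbed \<open>A\<close>\<close>

lemma sh_lower:
  assumes "j < n"
  shows "s - \<epsilon> \<le> sh j"
proof -
  obtain Q where Q: "Q \<in> carrier_mat d n" "orthonormal_cols Q"
    "\<And>c. dim_vec c = n \<Longrightarrow> s * l2norm c \<le> l2norm (A *\<^sub>v (Q *\<^sub>v c))"
    using A_range(2)[OF pos] unfolding s_def by blast
  note [simp] = carrier_matD[OF Q(1)]
  have n: "Suc (n - 1) = n" using n_pos by linarith
  have "s - \<epsilon> \<le> sing_val (Suc (n - 1)) Ah"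
  proof (rule sing_val_ge[of Q])
    fix c :: "real vec" assume "dim_vec c = Suc (n - 1)"
    then have c: "dim_vec c = n" using n by simp
    let ?x = "Q *\<^sub>v c"
    have "A *\<^sub>v ?x = Ah *\<^sub>v ?x - (Ah *\<^sub>v ?x - A *\<^sub>v ?x)" by (auto intro!: eq_vecI)
    then have "l2norm (A *\<^sub>v ?x) \<le> l2norm (Ah *\<^sub>v ?x) + l2norm (Ah *\<^sub>v ?x - A *\<^sub>v ?x)"
      using l2norm_minus[of "Ah *\<^sub>v ?x" "Ah *\<^sub>v ?x - A *\<^sub>v ?x"] by simp
    then have "l2norm (A *\<^sub>v ?x) \<le> l2norm (Ah *\<^sub>v ?x) + \<epsilon> * l2norm c"
      using Ah_A[of ?x] orthonormal_cols_isometry(3)[OF Q(2), of c] c by simp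
    then show "(s - \<epsilon>) * l2norm c \<le> l2norm (Ah *\<^sub>v ?x)"
      using Q(3)[OF c] by (simp add: left_diff_distrib)
  next
    show "Q \<in> carrier_mat (dim_col Ah) (Suc (n - 1))" unfolding n using Q(1) by simp
    show "n - 1 < dim_col Ah" using nd n_pos unfolding dims' by linarith
    show "0 \<le> s - \<epsilon>" using parameters \<epsilon> by linarith
  qed (use Q in simp)
  also have "\<dots> \<le> sh j" using assms nd n by (intro sing_val_antimono) auto
  finally show ?thesis .
qed

lemma sh_half: "j < n \<Longrightarrow> s / 2 \<le> sh j" and sh_pos: "j < n \<Longrightarrow> 0 < sh j" and sh_\<epsilon>: "j < n \<Longrightarrow> \<epsilon> < sh j"
  using sh_lower[of j] parameters \<epsilon> by linarith+

lemma sh_upper: "sh j \<le> 2 * S"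
proof -
  have "1 \<le> d" using nd n_pos by linarith
  then have "1 \<le> dim_col A" by simp
  then have "norm_bound A S" unfolding S_def by (rule norm_bound_sing_val)
  then have "norm_bound ((Ah - A) + A) (\<epsilon> + S)" using A_error by (intro norm_bound_add) auto
  moreover have "(Ah - A) + A = Ah" by (rule eq_matI) auto
  ultimately have "norm_bound Ah (\<epsilon> + S)" by simp
  then have "sh j \<le> \<epsilon> + S" using \<epsilon> parameters by (intro sing_val_le) auto
  then show ?thesis using parameters \<epsilon> by linarith
qed

lemma V_gram: "j < n \<Longrightarrow> Ah\<^sup>T * Ah *\<^sub>v col V j = (sh j)\<^sup>2 \<cdot>\<^sub>v col V j"
  by (rule singular_vector_gram[OF V_singular])

text \<open>\<open>A\<close> is positive semidefinite, so the form of \<open>Ah\<close> is at least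
  -\<epsilon>, while its top \<open>n\<close> singular values exceed \<epsilon>; none of them can
  come from a negative eigenvalue.\<close>

lemma V_eigenvector:
  assumes "j < n"
  shows "Ah *\<^sub>v col V j = sh j \<cdot>\<^sub>v col V j"
proof (rule singular_vector_eigenvector[OF Ah _ V_gram[OF assms] _ sh_\<epsilon>[OF assms]])
  fix x :: "real vec" assume x: "dim_vec x = d"
  have "x \<bullet> (A *\<^sub>v x) \<ge> 0" unfolding A_quadratic_form[OF x] by (rule scalar_prod_self_ge_0)
  moreover have "\<bar>x \<bullet> ((Ah - A) *\<^sub>v x)\<bar> \<le> \<epsilon> * (x \<bullet> x)"
    using x by (intro norm_bound_quadratic_form A_error) auto
  ultimately show "- (\<epsilon> * (x \<bullet> x)) \<le> x \<bullet> (Ah *\<^sub>v x)"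
    using x by (simp add: minus_mat_vec_dim scalar_prod_expand)
qed (use assms in simp)

text \<open>On the kernel of W^T the matrix \<open>Ah\<close> acts as the error
  \<open>Ah - A\<close>; the variational estimate moves this bound to the complement of
  \<open>V\<close>.\<close>

lemma Ah_orthogonal:
  assumes x: "dim_vec x = d" "V\<^sup>T *\<^sub>v x = 0\<^sub>v n"
  shows "l2norm (Ah *\<^sub>v x) \<le> \<epsilon> * l2norm x"
proof (rule norm_orthogonal_singular_vectors[of V Ah n W])
  fix x :: "real vec" assume "dim_vec x = dim_col Ah" "W\<^sup>T *\<^sub>v x = 0\<^sub>v n"
  then have x: "dim_vec x = d" "A *\<^sub>v x = 0\<^sub>v d" using A_kernel by simp_all
  have "Ah *\<^sub>v x - A *\<^sub>v x = Ah *\<^sub>v x" unfolding x(2) by (auto intro!: eq_vecI)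
  then show "l2norm (Ah *\<^sub>v x) \<le> \<epsilon> * l2norm x" using Ah_A[OF x(1)] by simp
next
  show "W \<in> carrier_mat (dim_col Ah) n" by (rule carrier_matI) simp_all
qed (use V V_gram nd \<epsilon> x in simp_all)

text \<open>The part of \<open>U 1\<close> that is lost by truncation to the span of
  \<open>V\<close>.\<close>

definition F :: "real mat" where
  "F = U 1 - V * (V\<^sup>T * U 1)"

lemma F_dims [simp]: "dim_row F = d" "dim_col F = m"
  by (simp_all add: F_def)

text \<open>For x = F z write U 1 z = A y with s |y| \<le> |z|. Then x \<bullet> x = y \<bullet> A
  x, and |A x| \<le> 2 \<epsilon> |x|: one \<epsilon> for \<open>Ah\<close> on the complement of
  \<open>V\<close>, one for \<open>Ah - A\<close>.\<close>

lemma norm_bound_F: "norm_bound F \<eta>"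
proof (rule norm_boundI)
  fix z :: "real vec" assume "dim_vec z = dim_col F"
  then have z [simp]: "dim_vec z = m" by simp
  define x where "x = F *\<^sub>v z"
  have x [simp]: "dim_vec x = d" by (simp add: x_def)
  obtain y where y: "dim_vec y = d" "A *\<^sub>v y = U 1 *\<^sub>v z" "s * l2norm y \<le> l2norm z"
    using U1_range[OF pos z] unfolding s_def by blast
  have xv: "x = U 1 *\<^sub>v z - V *\<^sub>v (V\<^sup>T *\<^sub>v (U 1 *\<^sub>v z))"
    by (simp add: x_def F_def mat_vec_expand)
  have Vx: "V\<^sup>T *\<^sub>v x = 0\<^sub>v n"
    by (auto intro!: eq_vecI simp: xv mat_vec_expand orthonormal_cols_isometry[OF V(2)])
  have "(V *\<^sub>v (V\<^sup>T *\<^sub>v (U 1 *\<^sub>v z))) \<bullet> x = 0"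
    by (subst mult_mat_vec_scalar_prod) (simp_all add: Vx scalar_prod_def)
  then have "x \<bullet> x = (U 1 *\<^sub>v z) \<bullet> x"
    using scalar_prod_minus_left[of "U 1 *\<^sub>v z" x "V *\<^sub>v (V\<^sup>T *\<^sub>v (U 1 *\<^sub>v z))"]
      by (simp flip: xv)
  also have "\<dots> = y \<bullet> (A *\<^sub>v x)" using y(1)
    by (simp flip: y(2) add: mult_mat_vec_scalar_prod A_sym)
  also have "\<dots> \<le> l2norm y * l2norm (A *\<^sub>v x)" using y by (intro scalar_prod_le_l2norm) simp
  also have "\<dots> \<le> l2norm y * (2 * \<epsilon> * l2norm x)"
  proof (intro mult_left_mono l2norm_ge_0)
    have "A *\<^sub>v x = Ah *\<^sub>v x - (Ah *\<^sub>v x - A *\<^sub>v x)" by (auto intro!: eq_vecI)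
    then have "l2norm (A *\<^sub>v x) \<le> l2norm (Ah *\<^sub>v x) + l2norm (Ah *\<^sub>v x - A *\<^sub>v x)"
      using l2norm_minus[of "Ah *\<^sub>v x" "Ah *\<^sub>v x - A *\<^sub>v x"] by simp
    then show "l2norm (A *\<^sub>v x) \<le> 2 * \<epsilon> * l2norm x"
      using Ah_A[of x] Ah_orthogonal[OF x Vx] by simp
  qed
  finally have "s * (l2norm x * l2norm x) \<le> s * (l2norm y * (2 * \<epsilon> * l2norm x))"
    using parameters(1) by (simp add: power2_eq_square flip: l2norm_sq)
  also have "\<dots> = (s * l2norm y) * (2 * \<epsilon> * l2norm x)" by simp
  also have "\<dots> \<le> l2norm z * (2 * \<epsilon> * l2norm x)"
    using y(3) \<epsilon> l2norm_ge_0 by (intro mult_right_mono) auto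
  finally have "(s * l2norm x) * l2norm x \<le> (2 * \<epsilon> * l2norm z) * l2norm x" by (simp add: mult_ac)
  then have "s * l2norm x \<le> 2 * \<epsilon> * l2norm z"
    using l2norm_ge_0[of x] l2norm_ge_0[of z] \<epsilon>
    by (cases "l2norm x = 0") (auto intro: mult_right_le_imp_le)
  then show "l2norm (F *\<^sub>v z) \<le> \<eta> * l2norm z"
    using parameters(1) by (simp add: \<eta>_def field_simps flip: x_def)
qed

section \<open>Whitening and the eigenspace of the whitened \<open>B\<close>\<close>

definition Di :: "real mat" where "Di = mat_diag n (\<lambda>j. 1 / sqrt (sh j))"
definition Ds :: "real mat" where "Ds = mat_diag n (\<lambda>j. sqrt (sh j))"
definition T :: "real mat" where "T = Di * V\<^sup>T"
text \<open>Undoes \<open>T\<close> up to truncation: \<open>R * T\<close> is the orthogonal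
  projection onto the span of \<open>V\<close>.\<close>

definition R :: "real mat" where "R = V * Ds"
definition Oh :: "real mat" where "Oh = T * W"
definition H :: "real mat" where "H = T * Bh * T\<^sup>T"
definition N :: "real mat" where "N = T * (Bh - B) * T\<^sup>T"

lemma dims'' [simp]: "dim_row Di = n" "dim_col Di = n" "dim_row Ds = n" "dim_col Ds = n"
  "dim_row T = n" "dim_col T = d" "dim_row R = d" "dim_col R = n" "dim_row Oh = n" "dim_col Oh = n"
  "dim_row H = n" "dim_col H = n" "dim_row N = n" "dim_col N = n"
  by (simp_all add: Di_def Ds_def T_def R_def Oh_def H_def N_def)

lemma Di_Ds: "Ds * Di = 1\<^sub>m n"
  unfolding Di_def Ds_def mat_diag_diag
  by (rule eq_matI) (auto simp: mat_diag_def dest: sh_pos)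

lemma norm_bound_sandwich:
  assumes "norm_bound X c" "dim_row X = d" "dim_col X = d" "0 \<le> c"
  shows "norm_bound (T * X * T\<^sup>T) (2 * c / s)"
proof -
  let ?t = "1 / sqrt (s / 2)"
  have "norm_bound Di ?t" unfolding Di_def
  proof (rule norm_bound_mat_diag)
    fix j assume "j < n"
    then have "sqrt (s / 2) \<le> sqrt (sh j)" "0 < sqrt (s / 2)" using sh_half parameters by simp_all
    then show "\<bar>1 / sqrt (sh j)\<bar> \<le> ?t" by (simp add: frac_le)
  qed (use parameters in simp)
  then have "norm_bound T (?t * 1)" unfolding T_def using parameters V(2)
    by (intro norm_bound_mult norm_bound_transpose norm_bound_orthonormal) auto
  then have "norm_bound (T * X * T\<^sup>T) ((?t * 1) * c * (?t * 1))"
    using assms parameters by (intro norm_bound_mult norm_bound_transpose) auto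
  also have "(?t * 1) * c * (?t * 1) = 2 * c / s" using parameters(1) by (simp add: field_simps)
  finally show ?thesis .
qed

text \<open>Rests on Ah V = V Ds Ds, that is, on the columns of \<open>V\<close> being eigenvectors
  with positive eigenvalues and not merely singular vectors.\<close>

lemma whitening: "T * Ah * T\<^sup>T = 1\<^sub>m n"
proof -
  have "Ah * V = V * mat_diag n sh"
    using eigenvector_cols_mult[of Ah V sh] V_eigenvector by simp
  also have "mat_diag n sh = Ds * Ds"
    unfolding Ds_def mat_diag_diag by (rule eq_matI) (auto simp: mat_diag_def dest: sh_pos)
  finally have AV: "Ah * V = V * (Ds * Ds)" .
  have VV: "V\<^sup>T * V = 1\<^sub>m n" using V(2) by (simp add: orthonormal_cols_def)
  have DT: "Di\<^sup>T = Di" by (simp add: Di_def)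
  have DsDi: "Di * Ds = 1\<^sub>m n" using mat_mult_left_right_inverse[of Ds n Di] Di_Ds
    by (simp add: carrier_matI)
  have "T * Ah * T\<^sup>T = Di * (V\<^sup>T * (Ah * V)) * Di"
    by (simp add: T_def transpose_mult_dim DT mult_mat_assoc_dim)
  also have "\<dots> = Di * ((V\<^sup>T * V) * (Ds * Ds)) * Di" unfolding AV by (simp add: mult_mat_assoc_dim)
  also have "\<dots> = (Di * Ds) * (Ds * Di)" unfolding VV
    by (simp add: mult_mat_assoc_dim left_mult_one_mat[of _ n n] carrier_matI)
  also have "\<dots> = 1\<^sub>m n" unfolding Di_Ds DsDi by simp
  finally show ?thesis .
qed

text \<open>By \<open>whitening\<close>, Oh Oh^T = T A T^T = 1 - T (Ah - A) T^T. The second bound is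
  the swap for square matrices.\<close>

lemma Oh_gram: "norm_bound (Oh * Oh\<^sup>T - 1\<^sub>m n) \<eta>" "norm_bound (Oh\<^sup>T * Oh - 1\<^sub>m n) (2 * \<eta>)"
proof -
  have "norm_bound (T * (Ah - A) * T\<^sup>T) \<eta>"
    using norm_bound_sandwich[OF A_error] \<epsilon> by (simp add: \<eta>_def)
  from norm_bound_smult[OF this, of "-1"] have nb: "norm_bound (- 1 \<cdot>\<^sub>m (T * (Ah - A) * T\<^sup>T)) \<eta>" by simp
  have eq: "(Oh * Oh\<^sup>T - 1\<^sub>m n) *\<^sub>v x = (- 1 \<cdot>\<^sub>m (T * (Ah - A) * T\<^sup>T)) *\<^sub>v x"
    if x: "dim_vec x = n" for x
  proof -
    have "T *\<^sub>v (Ah *\<^sub>v (T\<^sup>T *\<^sub>v x)) = x"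
      using arg_cong[OF whitening, of "\<lambda>X. X *\<^sub>v x"] x
        by (simp add: mult_mat_vec_assoc_dim one_mat_vec_dim)
    moreover have "Oh *\<^sub>v (Oh\<^sup>T *\<^sub>v x) = T *\<^sub>v (A *\<^sub>v (T\<^sup>T *\<^sub>v x))"
      using x by (simp add: Oh_def A_eq transpose_mult_dim mult_mat_vec_assoc_dim)
    ultimately show ?thesis using x by (auto intro!: eq_vecI simp: mat_vec_expand)
  qed
  show 1: "norm_bound (Oh * Oh\<^sup>T - 1\<^sub>m n) \<eta>"
    by (rule norm_bound_cong[OF nb]) (simp_all add: eq)
  show "norm_bound (Oh\<^sup>T * Oh - 1\<^sub>m n) (2 * \<eta>)"
  proof (rule norm_bound_gram_swap[OF _ 1])
    show "Oh \<in> carrier_mat n n" by (rule carrier_matI) simp_all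
  qed (use parameters \<delta> in linarith)+
qed

lemma norm_bound_Oh: "norm_bound Oh 2"
proof -
  have "sqrt (1 + 2 * \<eta>) \<le> 2" using parameters \<delta> by (intro real_le_lsqrt) auto
  then show ?thesis using norm_bound_of_gram[of Oh "2 * \<eta>"] Oh_gram(2) parameters
    by (auto intro: norm_bound_mono)
qed

lemma norm_bound_N: "norm_bound N \<eta>"
  unfolding N_def \<eta>_def using \<epsilon> by (intro norm_bound_sandwich B_error) auto

lemma H_vec: "dim_vec x = n \<Longrightarrow> H *\<^sub>v x = Oh *\<^sub>v (M *\<^sub>v (Oh\<^sup>T *\<^sub>v x)) + N *\<^sub>v x"
  by (auto intro!: eq_vecI simp: H_def N_def Oh_def B_eq transpose_mult_dim mat_vec_expand)

lemma H_carrier: "H \<in> carrier_mat n n" "H\<^sup>T = H"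
proof -
  show "H \<in> carrier_mat n n" by (rule carrier_matI) simp_all
  show "H\<^sup>T = H" by (simp add: H_def transpose_mult_dim Bh(2) mult_mat_assoc_dim)
qed

lemma norm_bound_J: "norm_bound J 1" "norm_bound (J\<^sup>T) 1"
  using norm_bound_orthonormal[OF orthonormal_J] by (auto intro: norm_bound_transpose)

definition K :: "real mat" where "K = Oh * J"

lemma K_dims [simp]: "dim_row K = n" "dim_col K = m"
  by (simp_all add: K_def)

lemma Y_top: "top_eigenvectors m H Y"
proof -
  have "Di\<^sup>T = Di" by (simp add: Di_def)
  then have "H = Di * V\<^sup>T * Bh * V * Di" by (simp add: H_def T_def transpose_mult_dim mult_mat_assoc_dim)
  then show ?thesis using Y by (simp add: Di_def)
qed

lemma Y_dims [simp]: "dim_row Y = n" "dim_col Y = m"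
  using top_eigenvectorsD(1)[OF Y_top H_carrier(1)] by auto

lemma wt_le: "i < k \<Longrightarrow> wt (Suc i) \<le> wt 1"
proof (cases "i = 0")
  case False
  assume "i < k"
  then have "wt (Suc i) \<le> (1 / 3 - \<delta>) * wt 1" using wt_gap[of "Suc i"] False by simp
  also have "\<dots> \<le> 1 * wt 1" using \<delta> wt1 by (intro mult_right_mono) auto
  finally show ?thesis by simp
qed (simp add: One_nat_def)

text \<open>The perturbation estimate with L = M1 and gap \<delta> * wt 1. It gives 4 \<eta> + 5 *
  14 \<eta> / \<delta>, and 4 \<eta> \<le> 2 \<eta> / \<delta> leads to 72.\<close>

lemma Y_error: "norm_bound (Y * Y\<^sup>T - K * K\<^sup>T) (72 * \<eta> / \<delta>)"
proof -
  let ?w = "wt 1"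
  have w: "1 \<le> ?w" using wt1 .
  have gramK: "norm_bound (K\<^sup>T * K - 1\<^sub>m m) (1 * (2 * \<eta> * 1))"
  proof (rule norm_bound_cong)
    show "norm_bound (J\<^sup>T * ((Oh\<^sup>T * Oh - 1\<^sub>m n) * J)) (1 * (2 * \<eta> * 1))"
      using Oh_gram(2) norm_bound_J parameters by (intro norm_bound_mult) auto
    show "(K\<^sup>T * K - 1\<^sub>m m) *\<^sub>v x = (J\<^sup>T * ((Oh\<^sup>T * Oh - 1\<^sub>m n) * J)) *\<^sub>v x"
      if "dim_vec x = dim_col (J\<^sup>T * ((Oh\<^sup>T * Oh - 1\<^sub>m n) * J))" for x
      using that by (auto intro!: eq_vecI simp: K_def transpose_mult_dim mat_vec_expand orthonormal_cols_isometry[OF orthonormal_J])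
  qed simp
  \<comment> \<open>By \<open>M_J\<close> the residual consists of the defect of \<open>Oh\<close>,
    at most 12 ?w \<eta>, and the noise \<open>N\<close>, at most 2 \<eta> \<le> 2 ?w \<eta> as ?w
    \<ge> 1.\<close>
  have residual: "norm_bound (H * K - K * M1) (14 * ?w * \<eta>)"
  proof (rule norm_bound_mono)
    show "norm_bound (H * K - K * M1) (2 * (3 * ?w * (2 * \<eta> * 1)) + \<eta> * (2 * 1))"
    proof (rule norm_bound_cong)
      show "norm_bound (Oh * (M * ((Oh\<^sup>T * Oh - 1\<^sub>m n) * J)) + N * (Oh * J)) (2 * (3 * ?w * (2 * \<eta> * 1)) + \<eta> * (2 * 1))"
        using norm_bound_Oh norm_bound_M[of ?w] wt_le w Oh_gram(2) norm_bound_J norm_bound_N parameters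
        by (intro norm_bound_add norm_bound_mult) auto
      fix x :: "real vec" assume "dim_vec x = dim_col (Oh * (M * ((Oh\<^sup>T * Oh - 1\<^sub>m n) * J)) + N * (Oh * J))"
      then have x: "dim_vec x = m" by simp
      have "M *\<^sub>v (J *\<^sub>v x) = J *\<^sub>v (M1 *\<^sub>v x)"
        using arg_cong[OF M_J, of "\<lambda>X. X *\<^sub>v x"] x by (simp add: mult_mat_vec_assoc_dim)
      then show "(H * K - K * M1) *\<^sub>v x = (Oh * (M * ((Oh\<^sup>T * Oh - 1\<^sub>m n) * J)) + N * (Oh * J)) *\<^sub>v x"
        using x by (intro eq_vecI) (simp_all add: K_def H_vec mat_vec_expand)
    qed simp
    have "\<eta> \<le> \<eta> * ?w" using w parameters(6) by (simp add: mult_le_cancel_left1)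
    then show "2 * (3 * ?w * (2 * \<eta> * 1)) + \<eta> * (2 * 1) \<le> 14 * ?w * \<eta>" by (simp add: mult_ac)
  qed
  \<comment> \<open>The other blocks stay below 3 (1/3 - \<delta>) ?w = ?w - 3 \<delta> ?w. Two of
    the three \<delta> ?w pay for the defect of \<open>Oh\<close> and for \<open>N\<close>; one
    remains as the gap.\<close>
  let ?\<mu> = "?w - \<delta> * ?w"
  have upper: "x \<bullet> (H *\<^sub>v x) \<le> ?\<mu> * (x \<bullet> x)"
    if x: "dim_vec x = n" "K\<^sup>T *\<^sub>v x = 0\<^sub>v m" for x
  proof -
    let ?y = "Oh\<^sup>T *\<^sub>v x" and ?\<rho> = "(1 / 3 - \<delta>) * ?w"
    have \<rho>: "0 \<le> ?\<rho>" using \<delta> w by simp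
    have xH: "x \<bullet> (H *\<^sub>v x) = ?y \<bullet> (M *\<^sub>v ?y) + x \<bullet> (N *\<^sub>v x)"
      using x by (simp add: H_vec scalar_prod_expand mult_mat_vec_scalar_prod)
    have "?y \<bullet> ?y = x \<bullet> x + x \<bullet> ((Oh * Oh\<^sup>T - 1\<^sub>m n) *\<^sub>v x)"
      using x by (simp add: mat_vec_expand scalar_prod_expand mult_mat_vec_scalar_prod)
    then have yy: "?y \<bullet> ?y \<le> (1 + \<eta>) * (x \<bullet> x)"
      using norm_bound_quadratic_form[OF Oh_gram(1), of x] x by (simp add: distrib_right)
    have "?y \<bullet> (M *\<^sub>v ?y) \<le> 3 * ?\<rho> * (?y \<bullet> ?y)"
      using x \<rho> wt_gap by (intro M_upper) (auto simp: K_def transpose_mult_dim mult_mat_vec_assoc_dim)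
    also have "\<dots> \<le> 3 * ?\<rho> * ((1 + \<eta>) * (x \<bullet> x))" using yy \<rho>
      by (intro mult_left_mono) auto
    finally have "x \<bullet> (H *\<^sub>v x) \<le> 3 * ?\<rho> * ((1 + \<eta>) * (x \<bullet> x)) + \<eta> * (x \<bullet> x)"
      using norm_bound_quadratic_form[OF norm_bound_N, of x] x unfolding xH by simp
    also have "\<dots> = (3 * ?\<rho> * (1 + \<eta>) + \<eta>) * (x \<bullet> x)"
      by (simp only: distrib_right mult.assoc)
    also have "\<dots> \<le> ?\<mu> * (x \<bullet> x)"
    proof (intro mult_right_mono scalar_prod_self_ge_0)
      have e: "\<eta> \<le> \<delta>" using parameters by linarith
      have 1: "\<eta> \<le> \<delta> * ?w" using mult_mono[OF e w] \<delta> by simp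
      have 2: "?w * \<eta> \<le> ?w * \<delta>" using e w by (intro mult_left_mono) auto
      have 3: "0 \<le> \<delta> * ?w * \<eta>" using \<delta> w parameters by simp
      have "3 * ?\<rho> * (1 + \<eta>) + \<eta> = ?w - 3 * (\<delta> * ?w) + ?w * \<eta> - 3 * (\<delta> * ?w * \<eta>) + \<eta>"
        by (simp add: field_simps)
      then show "3 * ?\<rho> * (1 + \<eta>) + \<eta> \<le> ?\<mu>" using 1 2 3 by (simp add: mult.commute)
    qed
    finally show ?thesis .
  qed
  have g: "14 * ?w * \<eta> / (?w - ?\<mu>) = 14 * \<eta> / \<delta>" using w \<delta> by (simp add: field_simps)
  have "norm_bound (Y * Y\<^sup>T - K * K\<^sup>T) (2 * (2 * \<eta>) + 5 * (14 * ?w * \<eta> / (?w - ?\<mu>)))"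
  proof (rule top_eigenvectors_perturbation[OF H_carrier Y_top m m_le_n, where L = M1 and \<mu> = ?\<mu>])
    show "14 * ?w * \<eta> / (?w - ?\<mu>) \<le> 1 / 2" unfolding g using parameters \<delta>
      by (simp add: field_simps)
    show "?\<mu> < ?w" using \<delta> w by simp
    show "norm_bound (K\<^sup>T * K - 1\<^sub>m m) (2 * \<eta>)" using gramK by simp
    show "2 * \<eta> \<le> 1 / 4" using parameters \<delta> by linarith
    show "0 \<le> 14 * ?w * \<eta>" using parameters w by simp
    show "K \<in> carrier_mat n m" "M1 \<in> carrier_mat m m" by (rule carrier_matI; simp)+
  qed (use parameters M1_lower upper residual in simp_all)
  then show ?thesis
  proof (rule norm_bound_mono)
    have "\<delta> * \<eta> \<le> (1 / 3) * \<eta>" using \<delta> parameters by (intro mult_right_mono) auto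
    then show "2 * (2 * \<eta>) + 5 * (14 * ?w * \<eta> / (?w - ?\<mu>)) \<le> 72 * \<eta> / \<delta>"
      unfolding g using \<delta> parameters(6) by (simp add: field_simps)
  qed
qed

section \<open>Undoing the whitening\<close>

definition ZZ :: "real mat" where "ZZ = (R * Y) * (R * Y)\<^sup>T"

lemma ZZ_dims [simp]: "dim_row ZZ = d" "dim_col ZZ = d"
  by (simp_all add: ZZ_def)

lemma norm_bound_R: "norm_bound R (sqrt (2 * S))"
proof -
  have "norm_bound Ds (sqrt (2 * S))" unfolding Ds_def
    using sh_upper parameters by (intro norm_bound_mat_diag) (auto simp: sing_val_nonneg)
  then have "norm_bound (V * Ds) (1 * sqrt (2 * S))"
    by (intro norm_bound_mult norm_bound_orthonormal V) auto
  then show ?thesis by (simp add: R_def)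
qed

lemma R_K: "dim_vec z = m \<Longrightarrow> R *\<^sub>v (K *\<^sub>v z) = sqrt (\<alpha> 1) \<cdot>\<^sub>v (V *\<^sub>v (V\<^sup>T *\<^sub>v (U 1 *\<^sub>v z)))"
proof -
  assume z: "dim_vec z = m"
  have "R *\<^sub>v (K *\<^sub>v z) = V *\<^sub>v ((Ds * Di) *\<^sub>v (V\<^sup>T *\<^sub>v ((W * J) *\<^sub>v z)))"
    using z by (simp add: R_def K_def Oh_def T_def mult_mat_vec_assoc_dim)
  also have "\<dots> = sqrt (\<alpha> 1) \<cdot>\<^sub>v (V *\<^sub>v (V\<^sup>T *\<^sub>v (U 1 *\<^sub>v z)))"
    unfolding Di_Ds W_J using z by (simp add: one_mat_vec_dim mat_vec_smult_dim smult_mat_vec_dim)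
  finally show ?thesis .
qed

text \<open>With P = U 1 - F one has R K K^T R^T = \<alpha> 1 P P^T and U 1 U 1^T - P P^T = F P^T +
  U 1 F^T. As |R|^2 \<le> 2 S, \<open>Y_error\<close> contributes 144 S \<eta> / \<delta>; the
  truncation adds 2 \<alpha> 1 \<eta> \<le> S \<eta> / \<delta>.\<close>

lemma ZZ_error: "norm_bound (ZZ - \<alpha> 1 \<cdot>\<^sub>m (U 1 * (U 1)\<^sup>T)) (145 * S * \<eta> / \<delta>)"
proof -
  let ?P = "U 1 - F"
  have U1d: "dim_row (U 1) = d" "dim_col (U 1) = m" using U1(1) by auto
  have P: "?P *\<^sub>v z = V *\<^sub>v (V\<^sup>T *\<^sub>v (U 1 *\<^sub>v z))" if "dim_vec z = m" for z
    using that U1d by (auto intro!: eq_vecI simp: F_def mat_vec_expand)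
  have "R * K = sqrt (\<alpha> 1) \<cdot>\<^sub>m ?P"
  proof (rule mat_col_eqI)
    fix j assume "j < dim_col (sqrt (\<alpha> 1) \<cdot>\<^sub>m ?P)"
    then have j: "j < m" by simp
    let ?e = "unit_vec m j :: real vec"
    have "col (R * K) j = R * K *\<^sub>v ?e" using mult_mat_vec_unit[of j "R * K"] j by simp
    also have "\<dots> = sqrt (\<alpha> 1) \<cdot>\<^sub>v (?P *\<^sub>v ?e)" using P[of ?e] R_K[of ?e]
      by (simp add: mult_mat_vec_assoc_dim)
    also have "\<dots> = (sqrt (\<alpha> 1) \<cdot>\<^sub>m ?P) *\<^sub>v ?e" using U1d
      by (subst smult_mat_vec_dim) auto
    also have "\<dots> = col (sqrt (\<alpha> 1) \<cdot>\<^sub>m ?P) j"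
      using mult_mat_vec_unit[of j "sqrt (\<alpha> 1) \<cdot>\<^sub>m ?P"] j by simp
    finally show "col (R * K) j = col (sqrt (\<alpha> 1) \<cdot>\<^sub>m ?P) j" .
  qed (use U1d in simp_all)
  then have RKT: "K\<^sup>T *\<^sub>v (R\<^sup>T *\<^sub>v x) = sqrt (\<alpha> 1) \<cdot>\<^sub>v ((U 1)\<^sup>T *\<^sub>v x - F\<^sup>T *\<^sub>v x)"
    if x: "dim_vec x = d" for x
  proof -
    assume RK: "R * K = sqrt (\<alpha> 1) \<cdot>\<^sub>m ?P"
    have "K\<^sup>T *\<^sub>v (R\<^sup>T *\<^sub>v x) = (R * K)\<^sup>T *\<^sub>v x" using x
      by (simp add: transpose_mult_dim mult_mat_vec_assoc_dim)
    also have "\<dots> = (sqrt (\<alpha> 1) \<cdot>\<^sub>m ((U 1)\<^sup>T - F\<^sup>T)) *\<^sub>v x" unfolding RK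
      using U1d by (intro arg_cong[of _ _ "\<lambda>X. X *\<^sub>v x"] eq_matI) auto
    finally show ?thesis using x U1d by (simp add: mat_vec_expand)
  qed
  have U1B: "norm_bound (U 1) 1" by (rule norm_bound_orthonormal[OF U1(2)])
  have PB: "norm_bound ?P 1"
  proof (rule norm_bound_cong)
    show "norm_bound (V * (V\<^sup>T * U 1)) (1 :: real)"
      using norm_bound_mult[OF norm_bound_orthonormal[OF V(2)] norm_bound_mult[OF norm_bound_transpose[OF norm_bound_orthonormal[OF V(2)]] U1B]]
        U1d by simp
  qed (use U1d P in \<open>simp_all add: mult_mat_vec_assoc_dim\<close>)
  have err: "norm_bound (R * (Y * Y\<^sup>T - K * K\<^sup>T) * R\<^sup>T - \<alpha> 1 \<cdot>\<^sub>m (F * ?P\<^sup>T + U 1 * F\<^sup>T))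
      (sqrt (2 * S) * (72 * \<eta> / \<delta>) * sqrt (2 * S) + \<bar>\<alpha> 1\<bar> * (\<eta> * 1 + 1 * \<eta>))"
    using norm_bound_R Y_error norm_bound_F U1B PB parameters \<delta> U1d
    by (intro norm_bound_minus norm_bound_add norm_bound_mult norm_bound_smult norm_bound_transpose) auto
  have "norm_bound (ZZ - \<alpha> 1 \<cdot>\<^sub>m (U 1 * (U 1)\<^sup>T))
      (sqrt (2 * S) * (72 * \<eta> / \<delta>) * sqrt (2 * S) + \<bar>\<alpha> 1\<bar> * (\<eta> * 1 + 1 * \<eta>))"
  proof (rule norm_bound_cong[OF err])
    fix x :: "real vec" assume "dim_vec x = dim_col (R * (Y * Y\<^sup>T - K * K\<^sup>T) * R\<^sup>T - \<alpha> 1 \<cdot>\<^sub>m (F * ?P\<^sup>T + U 1 * F\<^sup>T))"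
    then have x: "dim_vec x = d" using U1d by simp
    define a where "a = (U 1)\<^sup>T *\<^sub>v x"
    define b where "b = F\<^sup>T *\<^sub>v x"
    have ab [simp]: "dim_vec a = m" "dim_vec b = m" using U1d by (simp_all add: a_def b_def)
    have sq: "sqrt (\<alpha> 1) * (sqrt (\<alpha> 1) * t) = \<alpha> 1 * t" for t using parameters(4)
      by (simp flip: mult.assoc)
    have "R *\<^sub>v (K *\<^sub>v (K\<^sup>T *\<^sub>v (R\<^sup>T *\<^sub>v x))) = \<alpha> 1 \<cdot>\<^sub>v (?P *\<^sub>v (a - b))"
    proof -
      have "R *\<^sub>v (K *\<^sub>v (K\<^sup>T *\<^sub>v (R\<^sup>T *\<^sub>v x))) = sqrt (\<alpha> 1) \<cdot>\<^sub>v (R *\<^sub>v (K *\<^sub>v (a - b)))"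
        unfolding RKT[OF x] by (simp add: mat_vec_smult_dim flip: a_def b_def)
      also have "\<dots> = \<alpha> 1 \<cdot>\<^sub>v (?P *\<^sub>v (a - b))"
        using parameters(4) by (simp add: R_K P smult_smult_assoc)
      finally show ?thesis .
    qed
    also have "\<dots> = \<alpha> 1 \<cdot>\<^sub>v (U 1 *\<^sub>v a - U 1 *\<^sub>v b - F *\<^sub>v (a - b))"
      using U1d by (auto intro!: arg_cong[of _ _ "\<lambda>x. \<alpha> 1 \<cdot>\<^sub>v x"] eq_vecI simp: mat_vec_expand)
    finally have RK: "R *\<^sub>v (K *\<^sub>v (K\<^sup>T *\<^sub>v (R\<^sup>T *\<^sub>v x))) = \<alpha> 1 \<cdot>\<^sub>v (U 1 *\<^sub>v a - U 1 *\<^sub>v b - F *\<^sub>v (a - b))" .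
    have PT: "?P\<^sup>T *\<^sub>v x = a - b" using x U1d
      by (simp add: transpose_minus_dim minus_mat_vec_dim a_def b_def)
    have l: "(ZZ - \<alpha> 1 \<cdot>\<^sub>m (U 1 * (U 1)\<^sup>T)) *\<^sub>v x = R *\<^sub>v (Y *\<^sub>v (Y\<^sup>T *\<^sub>v (R\<^sup>T *\<^sub>v x))) - \<alpha> 1 \<cdot>\<^sub>v (U 1 *\<^sub>v a)"
      using x U1d by (simp add: ZZ_def transpose_mult_dim mat_vec_expand flip: a_def)
    have r: "(R * (Y * Y\<^sup>T - K * K\<^sup>T) * R\<^sup>T - \<alpha> 1 \<cdot>\<^sub>m (F * ?P\<^sup>T + U 1 * F\<^sup>T)) *\<^sub>v x =
       R *\<^sub>v (Y *\<^sub>v (Y\<^sup>T *\<^sub>v (R\<^sup>T *\<^sub>v x))) - R *\<^sub>v (K *\<^sub>v (K\<^sup>T *\<^sub>v (R\<^sup>T *\<^sub>v x))) - \<alpha> 1 \<cdot>\<^sub>v (F *\<^sub>v (a - b) + U 1 *\<^sub>v b)"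
      using x U1d PT by (simp add: mat_vec_expand flip: b_def)
    show "(ZZ - \<alpha> 1 \<cdot>\<^sub>m (U 1 * (U 1)\<^sup>T)) *\<^sub>v x =
        (R * (Y * Y\<^sup>T - K * K\<^sup>T) * R\<^sup>T - \<alpha> 1 \<cdot>\<^sub>m (F * ?P\<^sup>T + U 1 * F\<^sup>T)) *\<^sub>v x"
      unfolding l r RK using U1d by (intro eq_vecI) (simp_all add: algebra_simps)
  qed (use U1d in simp)
  then show ?thesis
  proof (rule norm_bound_mono)
    have 1: "sqrt (2 * S) * (72 * \<eta> / \<delta>) * sqrt (2 * S) = 144 * (S * \<eta> / \<delta>)"
      using parameters(5) by (simp add: field_simps)
    have "2 * \<eta> * \<delta> \<le> \<eta>"
      using mult_left_mono[OF \<delta>(2) parameters(6)] parameters(6) by simp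
    then have "2 * \<eta> \<le> \<eta> / \<delta>" using \<delta> by (simp add: field_simps)
    then have "\<alpha> 1 * (2 * \<eta>) \<le> S * (\<eta> / \<delta>)" using parameters by (intro mult_mono) auto
    then show "sqrt (2 * S) * (72 * \<eta> / \<delta>) * sqrt (2 * S) + \<bar>\<alpha> 1\<bar> * (\<eta> * 1 + 1 * \<eta>) \<le> 145 * S * \<eta> / \<delta>"
      unfolding 1 using parameters(4) by simp
  qed
qed

text \<open>Second use of the perturbation estimate, now with K = U 1, whose Gram matrix is exact,
  and L = \<alpha> 1 times the identity. Here 2900 = 5 * 145 * 2 * 2, with one 2 from the gap
  \<alpha> 1 / 2 and one from \<eta> = 2 \<epsilon> / s.\<close>

lemma Uh_error: "norm_bound (Uh * Uh\<^sup>T - U 1 * (U 1)\<^sup>T) (2900 * S * \<epsilon> / (s * \<delta> * \<alpha> 1))"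
proof -
  have U1d: "dim_row (U 1) = d" "dim_col (U 1) = m" using U1(1) by auto
  let ?\<Delta> = "145 * S * \<eta> / \<delta>" and ?L = "\<alpha> 1 \<cdot>\<^sub>m 1\<^sub>m m :: real mat" and ?X = "\<alpha> 1 \<cdot>\<^sub>m (U 1 * (U 1)\<^sup>T)"
  have \<Delta>: "0 \<le> ?\<Delta>" "?\<Delta> \<le> \<alpha> 1 / 4" using parameters \<delta>
    by (simp_all add: field_simps)
  have ZZ: "ZZ \<in> carrier_mat d d" "ZZ\<^sup>T = ZZ"
    by (rule carrier_matI) (simp_all add: ZZ_def transpose_mult_dim mult_mat_assoc_dim)
  have top: "top_eigenvectors m ZZ Uh" using Uh by (simp add: ZZ_def R_def Ds_def)
  have gram0: "norm_bound ((U 1)\<^sup>T * U 1 - 1\<^sub>m m) 0"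
    using U1(2) U1d by (auto intro!: norm_boundI simp: orthonormal_cols_def minus_mat_vec_dim l2norm_def scalar_prod_def)
  have Lv: "?L *\<^sub>v z = \<alpha> 1 \<cdot>\<^sub>v z" if "dim_vec z = m" for z
    using that by (simp add: smult_mat_vec_dim one_mat_vec_dim)
  have Xv: "?X *\<^sub>v x = \<alpha> 1 \<cdot>\<^sub>v (U 1 *\<^sub>v ((U 1)\<^sup>T *\<^sub>v x))"
    if "dim_vec x = d" for x
    using that U1d by (simp add: mat_vec_expand)
  have "norm_bound (Uh * Uh\<^sup>T - U 1 * (U 1)\<^sup>T) (2 * 0 + 5 * (?\<Delta> / (\<alpha> 1 - \<alpha> 1 / 2)))"
  proof (rule top_eigenvectors_perturbation[OF ZZ top m order.trans[OF m_le_n nd] U1(1) _ gram0, where L = ?L])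
    fix z :: "real vec" assume "dim_vec z = m"
    then show "\<alpha> 1 * (z \<bullet> z) \<le> z \<bullet> (?L *\<^sub>v z)" by (simp add: Lv)
  next
    fix x :: "real vec" assume x: "dim_vec x = d" "(U 1)\<^sup>T *\<^sub>v x = 0\<^sub>v m"
    have "U 1 *\<^sub>v 0\<^sub>v m = 0\<^sub>v d" using mult_mat_vec_zero[of "U 1"] U1d by simp
    then have "?X *\<^sub>v x = 0\<^sub>v d" using Xv x by (auto intro!: eq_vecI)
    then have "(ZZ - ?X) *\<^sub>v x = ZZ *\<^sub>v x"
      using x U1d by (auto intro!: eq_vecI simp: minus_mat_vec_dim)
    then have "x \<bullet> (ZZ *\<^sub>v x) \<le> ?\<Delta> * (x \<bullet> x)"
      using norm_bound_quadratic_form[OF ZZ_error, of x] x U1d by simp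
    also have "\<dots> \<le> \<alpha> 1 / 2 * (x \<bullet> x)" using \<Delta> parameters scalar_prod_self_ge_0
      by (intro mult_right_mono) auto
    finally show "x \<bullet> (ZZ *\<^sub>v x) \<le> \<alpha> 1 / 2 * (x \<bullet> x)" .
  next
    have res: "norm_bound ((ZZ - ?X) * U 1) (?\<Delta> * 1)"
      using ZZ_error \<Delta> U1d by (intro norm_bound_mult norm_bound_orthonormal U1) auto
    have "norm_bound (ZZ * U 1 - U 1 * ?L) (?\<Delta> * 1)"
    proof (rule norm_bound_cong[OF res])
      fix z :: "real vec" assume "dim_vec z = dim_col ((ZZ - ?X) * U 1)"
      then have z: "dim_vec z = m" by simp
      show "(ZZ * U 1 - U 1 * ?L) *\<^sub>v z = (ZZ - ?X) * U 1 *\<^sub>v z"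
        using z orthonormal_cols_isometry(1)[OF U1(2), of z] Lv[OF z]
        by (simp add: mult_mat_vec_assoc_dim minus_mat_vec_dim smult_mat_vec_dim mat_vec_smult_dim)
    qed simp
    then show "norm_bound (ZZ * U 1 - U 1 * ?L) ?\<Delta>" by simp
  next
    have "?\<Delta> / (\<alpha> 1 - \<alpha> 1 / 2) = ?\<Delta> / (\<alpha> 1 / 2)" by simp
    also have "\<dots> \<le> (\<alpha> 1 / 4) / (\<alpha> 1 / 2)" using \<Delta> parameters
      by (intro divide_right_mono) auto
    also have "\<dots> = 1 / 2" using parameters by simp
    finally show "?\<Delta> / (\<alpha> 1 - \<alpha> 1 / 2) \<le> 1 / 2" .
    show "?L \<in> carrier_mat m m" by (rule carrier_matI) simp_all
  qed (use parameters \<Delta> in simp_all)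
  moreover have "2 * 0 + 5 * (?\<Delta> / (\<alpha> 1 - \<alpha> 1 / 2)) = 2900 * S * \<epsilon> / (s * \<delta> * \<alpha> 1)"
    using parameters \<delta> by (simp add: \<eta>_def field_simps)
  ultimately show ?thesis by simp
qed

end

lemma norm_bound_proj: "orthonormal_cols Q \<Longrightarrow> norm_bound (proj Q) 1"
  unfolding proj_def
  using norm_bound_mult[OF norm_bound_orthonormal norm_bound_transpose[OF norm_bound_orthonormal]] by simp

theorem theorem6:
  shows "\<exists>C > (0::real).
    \<forall>(d::nat) (m::nat) (k::nat) (U :: nat \<Rightarrow> real mat) (\<alpha> :: nat \<Rightarrow> real) (v :: real vec)
      (Ah :: real mat) (Bh :: real mat) (Uh :: real mat) (\<epsilon>::real) (\<delta>::real).
      1 \<le> m \<longrightarrow> 1 \<le> k \<longrightarrow>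
      (\<forall>i \<in> {1..k}. U i \<in> carrier_mat d m \<and> orthonormal_cols (U i)) \<longrightarrow>
      (\<forall>i \<in> {1..k}. 0 < \<alpha> i) \<longrightarrow>
      (\<Sum>i = 1..k. \<alpha> i) = 1 \<longrightarrow>
      v \<in> carrier_vec d \<longrightarrow>
      (\<forall>i \<in> {1..k}. i \<noteq> 1 \<longrightarrow>
         l2norm (transpose_mat (U i) *\<^sub>v v) < l2norm (transpose_mat (U 1) *\<^sub>v v)) \<longrightarrow>
      0 < sing_val (m * k) (A_mat d k \<alpha> U) \<longrightarrow>
      Ah \<in> carrier_mat d d \<longrightarrow> transpose_mat Ah = Ah \<longrightarrow>
      Bh \<in> carrier_mat d d \<longrightarrow> transpose_mat Bh = Bh \<longrightarrow>
      spectral_norm (Ah - A_mat d k \<alpha> U) \<le> \<epsilon> \<longrightarrow>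
      spectral_norm (Bh - B_mat d k \<alpha> U v) \<le> \<epsilon> \<longrightarrow>
      0 < \<delta> \<longrightarrow> \<delta> \<le> 1 / 3 \<longrightarrow>
      1 \<le> l2norm (transpose_mat (U 1) *\<^sub>v v) \<longrightarrow>
      (\<forall>i \<in> {1..k}. i \<noteq> 1 \<longrightarrow>
         (l2norm (transpose_mat (U i) *\<^sub>v v))\<^sup>2
           \<le> (1 / 3 - \<delta>) * (l2norm (transpose_mat (U 1) *\<^sub>v v))\<^sup>2) \<longrightarrow>
      subspace_algorithm d m k Ah Bh Uh \<longrightarrow>
      spectral_norm (proj Uh - proj (U 1))
        \<le> C * \<epsilon> * inverse (\<alpha> 1) * (sing_val 1 (A_mat d k \<alpha> U))\<^sup>2
            * inverse ((sing_val (m * k) (A_mat d k \<alpha> U))\<^sup>2) * inverse \<delta>"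
proof (intro exI[of _ 2900] conjI allI impI)
  fix d m k :: nat and U :: "nat \<Rightarrow> real mat" and \<alpha> :: "nat \<Rightarrow> real" and v :: "real vec"
    and Ah Bh Uh :: "real mat" and \<epsilon> \<delta> :: real
  assume mk: "1 \<le> m" "1 \<le> k"
    and U: "\<forall>i \<in> {1..k}. U i \<in> carrier_mat d m \<and> orthonormal_cols (U i)"
    and \<alpha>: "\<forall>i \<in> {1..k}. 0 < \<alpha> i"
    and v: "v \<in> carrier_vec d"
    and pos: "0 < sing_val (m * k) (A_mat d k \<alpha> U)"
    and Ah: "Ah \<in> carrier_mat d d" "Ah\<^sup>T = Ah" and Bh: "Bh \<in> carrier_mat d d" "Bh\<^sup>T = Bh"
    and A_error: "spectral_norm (Ah - A_mat d k \<alpha> U) \<le> \<epsilon>"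
    and B_error: "spectral_norm (Bh - B_mat d k \<alpha> U v) \<le> \<epsilon>"
    and \<delta>: "0 < \<delta>" "\<delta> \<le> 1 / 3" and v1: "1 \<le> l2norm ((U 1)\<^sup>T *\<^sub>v v)"
    and gap: "\<forall>i \<in> {1..k}. i \<noteq> 1 \<longrightarrow>
         (l2norm ((U i)\<^sup>T *\<^sub>v v))\<^sup>2 \<le> (1 / 3 - \<delta>) * (l2norm ((U 1)\<^sup>T *\<^sub>v v))\<^sup>2"
    and alg: "subspace_algorithm d m k Ah Bh Uh"
  interpret subspace_mixture d m k U \<alpha> v using mk U \<alpha> v by unfold_locales auto
  define s where s_eq: "s = sing_val n A"
  define S where S_eq: "S = sing_val 1 A"
  let ?Ds = "mat_diag n (\<lambda>j. sqrt (sing_val (Suc j) Ah))"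
  let ?Di = "mat_diag n (\<lambda>j. 1 / sqrt (sing_val (Suc j) Ah))"
  obtain V Y where VY: "V \<in> carrier_mat d n" "orthonormal_cols V"
    "\<And>j. j < n \<Longrightarrow> singular_vector Ah (sing_val (Suc j) Ah) (col V j)"
    "top_eigenvectors m (?Di * V\<^sup>T * Bh * V * ?Di) Y"
    "top_eigenvectors m ((V * ?Ds * Y) * (V * ?Ds * Y)\<^sup>T) Uh"
    using alg unfolding subspace_algorithm_def Let_def by auto
  have nd: "n \<le> d" using n_le_d pos by simp
  have d: "1 \<le> d" using nd n_pos by linarith
  have s: "0 < s" using pos by (simp add: s_eq)
  have sS: "s \<le> S" unfolding s_eq S_eq using nd n_pos by (intro sing_val_antimono) auto
  have a: "0 < \<alpha> 1" using U1(3) .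
  \<comment> \<open>The sign of \<epsilon> is not assumed; it follows since a matrix with at least
    one column has nonnegative spectral norm.\<close>
  have "0 \<le> spectral_norm (Ah - A)" using spectral_norm_nonneg[of "Ah - A"] d by simp
  then have \<epsilon>: "0 \<le> \<epsilon>" using A_error by linarith
  have Uh: "orthonormal_cols Uh" "Uh \<in> carrier_mat d m"
    using VY(1,5) by (auto simp: top_eigenvectors_def)
  show "spectral_norm (proj Uh - proj (U 1))
        \<le> 2900 * \<epsilon> * inverse (\<alpha> 1) * (sing_val 1 A)\<^sup>2 * inverse ((sing_val n A)\<^sup>2) * inverse \<delta>"
    unfolding s_eq[symmetric] S_eq[symmetric]
  proof (cases "1160 * S * \<epsilon> \<le> \<alpha> 1 * s * \<delta>")
    case True
    interpret perturbed_mixture d m k U \<alpha> v Ah Bh V Y Uh \<epsilon> \<delta>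
    proof unfold_locales
      show "norm_bound (Ah - A) \<epsilon>" "norm_bound (Bh - B) \<epsilon>"
        using norm_bound_mono[OF norm_bound_spectral_norm] A_error B_error by blast+
      show "1 \<le> wt 1" using power_mono[OF v1, of 2] by (simp add: wt_def)
      show "wt i \<le> (1 / 3 - \<delta>) * wt 1" if "i \<in> {1..k}" "i \<noteq> 1" for i
        using gap that by (simp add: wt_def)
      show "1160 * sing_val 1 A * \<epsilon> \<le> \<alpha> 1 * sing_val n A * \<delta>"
        using True by (simp add: s_eq S_eq)
    qed (fact pos Ah Bh \<delta> \<epsilon> VY)+
    have "spectral_norm (proj Uh - proj (U 1)) \<le> 2900 * S * \<epsilon> / (s * \<delta> * \<alpha> 1)"
      using Uh_error s sS a \<delta> \<epsilon> unfolding proj_def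
      by (intro spectral_norm_le) (simp_all add: s_eq S_eq s_def S_def)
    \<comment> \<open>The estimate has S / s to the first power; a further factor S / s \<ge> 1
      produces the squares in the claim.\<close>
    also have "\<dots> \<le> 2900 * S * \<epsilon> / (s * \<delta> * \<alpha> 1) * (S / s)"
      using mult_left_mono[of 1 "S / s" "2900 * S * \<epsilon> / (s * \<delta> * \<alpha> 1)"] s sS a \<delta> \<epsilon> by simp
    also have "\<dots> = 2900 * \<epsilon> * inverse (\<alpha> 1) * S\<^sup>2 * inverse (s\<^sup>2) * inverse \<delta>"
      by (simp add: field_simps power2_eq_square)
    finally show "spectral_norm (proj Uh - proj (U 1)) \<le> 2900 * \<epsilon> * inverse (\<alpha> 1) * S\<^sup>2 * inverse (s\<^sup>2) * inverse \<delta>" .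
  next
    case False
    have "norm_bound (proj Uh - proj (U 1)) (1 + 1)"
      using Uh U1 by (intro norm_bound_minus norm_bound_proj) (auto simp: proj_def)
    then have "spectral_norm (proj Uh - proj (U 1)) \<le> 2" by (intro spectral_norm_le) auto
    \<comment> \<open>Two projections differ by at most 2, and 2900 / 1160 = 5/2 already exceeds
      it.\<close>
    also have "2 \<le> 2900 / 1160 * (S / s)" using sS s by (simp add: field_simps)
    also have "\<dots> = 2900 * (\<alpha> 1 * s * \<delta> / 1160) * (S / (\<alpha> 1 * s\<^sup>2 * \<delta>))"
      using a s \<delta> by (simp add: field_simps power2_eq_square)
    also have "\<dots> \<le> 2900 * (S * \<epsilon>) * (S / (\<alpha> 1 * s\<^sup>2 * \<delta>))"
      using False a s sS \<delta> by (intro mult_right_mono mult_left_mono) auto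
    also have "\<dots> = 2900 * \<epsilon> * inverse (\<alpha> 1) * S\<^sup>2 * inverse (s\<^sup>2) * inverse \<delta>"
      by (simp add: field_simps power2_eq_square)
    finally show "spectral_norm (proj Uh - proj (U 1)) \<le> 2900 * \<epsilon> * inverse (\<alpha> 1) * S\<^sup>2 * inverse (s\<^sup>2) * inverse \<delta>" .
  qed
qed simp

end
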